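(* Consider the Bradley–Terry–Luce model described in the context, with $\theta^*\in\Theta(\kappa)$. Suppose that $\kappa=\mathcal{O}(1)$ and $np\gg(\log n)^{3/2}$. Let $\hat\theta$ be the maximum likelihood estimator and define, for $i\in[n]$, $$b_i=\sum_{j:j\neq i}A_{ij}\big(\bar y_{ij}-\psi(\theta_i^*-\theta_j^* )\big),\qquad d_i=\sum_{j:j\neq i}A_{ij}\psi'(\theta_i^*-\theta_j^* ).$$ Then for every $i\in[n]$, $$\hat\theta_i-\theta_i^*=(1+\epsilon_{1,i})\frac{b_i}{d_i}+\epsilon_{2,i},$$ where $\epsilon_1,\epsilon_2\in\mathbb{R}^n$ are vectors such that, with probability $1-\mathcal{O}(n^{-10})$, $\|\epsilon_1\|_\infty=\mathfrak{o}(1)$ and $\|\epsilon_2\|_\infty=\mathfrak{o}(1/\sqrt{npL})$.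
   Context: Let $n\ge2$, $\psi(t)=e^t/(1+e^t)$ and $\psi'(t)=e^t/(1+e^t)^2$. For $\kappa>0$ let $\Theta(\kappa)=\{\theta\in\mathbb{R}^n:\max_i\theta_i-\min_i\theta_i\le\kappa,\ \sum_{i}\theta_i=0\}$. BTL model: given $\theta^*\in\Theta(\kappa)$, $p\in(0,1]$ and a positive integer $L$, the variables $\{A_{ij}\}_{i<j}$ are i.i.d. Bernoulli$(p)$, with $A_{ji}=A_{ij}$, $A_{ii}=0$; for each $i<j$ with $A_{ij}=1$ one observes $y_{ij\ell}$, $\ell=1,\dots,L$, i.i.d. Bernoulli$(\psi(\theta_i^*-\theta_j^* ))$, independent across pairs and independent of $A$. Put $\bar y_{ij}=L^{-1}\sum_{\ell=1}^L y_{ij\ell}$ and $\bar y_{ji}=1-\bar y_{ij}$ for $i<j$. The maximum likelihood estimator is $\hat\theta\in\arg\min_{\theta\in\mathbb{R}^n:\mathbf 1_n^\top\theta=0}\ell_n(\theta)$, where $\ell_n(\theta)=\sum_{i<j}A_{ij}\big[\bar y_{ij}\log\frac{1}{\psi(\theta_i-\theta_j)}+\bar y_{ji}\log\frac{1}{\psi(\theta_j-\theta_i)}\big]$ (it exists and is unique with probability $1-\mathcal{O}(n^{-10})$; one works on this event). Asymptotics: $n\to\infty$; $p,L,\kappa,\theta^*$ may depend on $n$; $a_n\ll b_n$ means $a_n/b_n\to0$; $\mathfrak{o}(\cdot)$ is the corresponding little-o; $\kappa=\mathcal{O}(1)$ means $\kappa$ is bounded by a constant independent of $n$. "With probability $1-\mathcal{O}(n^{-10})$"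 means with probability at least $1-Cn^{-10}$ for a constant $C$ not depending on $n$. *)

theory Defs
  imports "HOL-Probability.Probability"
begin

text \<open>Players are indexed 0..n-1 (the paper's 1..n). Parameter vectors are
functions nat => real that vanish outside {..<n}.\<close>

definition psi :: "real \<Rightarrow> real" where
  "psi t = exp t / (1 + exp t)"

definition psi' :: "real \<Rightarrow> real" where
  "psi' t = exp t / (1 + exp t)^2"

definition pairs :: "nat \<Rightarrow> (nat \<times> nat) set" where
  "pairs n = {(i, j). i < j \<and> j < n}"

definition Theta :: "nat \<Rightarrow> real \<Rightarrow> (nat \<Rightarrow> real) set" where
  "Theta n \<kappa> = {\<theta>. (\<forall>i\<ge>n. \<theta> i = 0) \<and> (\<Sum>i<n. \<theta> i) = 0 \<and>
                     (\<forall>i<n. \<forall>j<n. \<theta> i - \<theta> j \<le> \<kappa>)}"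

definition centered :: "nat \<Rightarrow> (nat \<Rightarrow> real) set" where
  "centered n = {\<theta>. (\<forall>i\<ge>n. \<theta> i = 0) \<and> (\<Sum>i<n. \<theta> i) = 0}"

text \<open>An outcome: the comparison graph (A(i,j) for i<j) and the raw observations
  Y(i,j,l) for i<j, l<L. Observations for unobserved pairs are generated but
  never used (they are always multiplied by A_ij = 0).\<close>
type_synonym outcome = "((nat \<times> nat) \<Rightarrow> bool) \<times> ((nat \<times> nat \<times> nat) \<Rightarrow> bool)"

definition btl_pmf :: "nat \<Rightarrow> real \<Rightarrow> nat \<Rightarrow> (nat \<Rightarrow> real) \<Rightarrow> outcome pmf" where
  "btl_pmf n p L \<theta> =
     pair_pmf (Pi_pmf (pairs n) False (\<lambda>_. bernoulli_pmf p))
              (Pi_pmf {(i, j, l). i < j \<and> j < n \<and> l < L} False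
                      (\<lambda>(i, j, l). bernoulli_pmf (psi (\<theta> i - \<theta> j))))"

definition adj :: "outcome \<Rightarrow> nat \<Rightarrow> nat \<Rightarrow> real" where
  "adj \<omega> i j = (if i < j then (if fst \<omega> (i, j) then 1 else 0)
                else if j < i then (if fst \<omega> (j, i) then 1 else 0) else 0)"

definition ybar :: "nat \<Rightarrow> outcome \<Rightarrow> nat \<Rightarrow> nat \<Rightarrow> real" where
  "ybar L \<omega> i j =
     (if i < j then (\<Sum>l<L. if snd \<omega> (i, j, l) then 1 else 0) / real L
      else 1 - (\<Sum>l<L. if snd \<omega> (j, i, l) then 1 else 0) / real L)"

definition loglik :: "nat \<Rightarrow> nat \<Rightarrow> outcome \<Rightarrow> (nat \<Rightarrow> real) \<Rightarrow> real" where
  "loglik n L \<omega> \<theta> =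
     (\<Sum>(i, j)\<in>pairs n. adj \<omega> i j *
        (ybar L \<omega> i j * ln (1 / psi (\<theta> i - \<theta> j)) +
         ybar L \<omega> j i * ln (1 / psi (\<theta> j - \<theta> i))))"

definition is_mle :: "nat \<Rightarrow> nat \<Rightarrow> outcome \<Rightarrow> (nat \<Rightarrow> real) \<Rightarrow> bool" where
  "is_mle n L \<omega> \<theta> \<longleftrightarrow> \<theta> \<in> centered n \<and> (\<forall>\<theta>'\<in>centered n. loglik n L \<omega> \<theta> \<le> loglik n L \<omega> \<theta>')"

definition bvec :: "nat \<Rightarrow> nat \<Rightarrow> (nat \<Rightarrow> real) \<Rightarrow> outcome \<Rightarrow> nat \<Rightarrow> real" where
  "bvec n L \<theta> \<omega> i = (\<Sum>j\<in>{..<n} - {i}. adj \<omega> i j * (ybar L \<omega> i j - psi (\<theta> i - \<theta> j)))"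

definition dvec :: "nat \<Rightarrow> (nat \<Rightarrow> real) \<Rightarrow> outcome \<Rightarrow> nat \<Rightarrow> real" where
  "dvec n \<theta> \<omega> i = (\<Sum>j\<in>{..<n} - {i}. adj \<omega> i j * psi' (\<theta> i - \<theta> j))"

end

theory Submission
  imports Defs
begin

text \<open>
Continue the logistic link linearly outside a bounded interval. The score equation then becomes
uniformly strongly monotone on any graph with a spectral gap, so its solution \<open>\<theta>\<^sup>* + \<delta>\<close> exists without a
priori bounds; once \<open>\<delta>\<close> is known to be small, the modification is invisible and strict convexity
identifies the solution with the unique maximum likelihood estimator. The spectral gap comes from edge
expansion of the random graph through Cheeger's inequality.

Write \<open>\<l> = ln n\<close>. The \<open>\<ell>\<^sub>2\<close> norm of \<open>\<delta>\<close> is controlled by that of \<open>b\<close>, which interpolates between a union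
bound over signs for \<open>\<parallel>b\<parallel>\<^sub>1\<close> and Hoeffding's inequality for \<open>\<parallel>b\<parallel>\<^sub>\<infinity>\<close>. For the entry \<open>i\<close> one compares \<open>\<delta>\<close>
with the solution on the graph without vertex \<open>i\<close>, which is independent of the \<open>i\<close>-th row of the
adjacency matrix, so that Bernstein's inequality applies to row sums; this bounds \<open>\<parallel>\<delta>\<parallel>\<^sub>\<infinity>\<close>. Expanding
the \<open>i\<close>-th score equation to first order leaves the row sum of \<open>\<psi>'\<^sub>i\<^sub>j \<delta>\<^sub>j\<close>: its fluctuation is
small by Bernstein's inequality and its mean, a smooth functional of \<open>\<delta>\<close>, is turned into a linear
statistic of the noise by solving a Laplace equation on the graph. Every error is of relative order
\<open>(\<l>\<^bsup>3/2\<^esup> / (n p))\<^bsup>1/2\<^esup>\<close>.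
\<close>

subsection \<open>The logistic link\<close>

text \<open>Let \<nu> = 1/(npL), the square of the target scale. The l2 bound on \<delta> has order
  n \<nu> \<open>sqrt \<l>\<close>, a factor \<open>sqrt \<l>\<close> above what second moments
  predict. In Bernstein's inequality for a row this factor meets the factor \<open>\<l>\<close> of
  the confidence level; the resulting variance np \<nu> \<open>\<l> * sqrt \<l>\<close> has to be
  negligible against (np)^2 \<nu>, which is the origin of the exponent 3/2. The mean of a row sum
  cannot be handled by norms: Cauchy-Schwarz leaves np times the fourth root of \<open>\<l>\<close>
  times the root of \<nu>, more than the allowed error. Cancellation is needed, and it comes from a
  potential that is a function of the graph alone, hence a fixed coefficient vector once the graph
  is given. Bounds for row sums of squares contain the unknown sup norm on their right-hand side; it
  is absorbed because its relative coefficient tends to 0. Chance enters only through a list of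
  inequalities for one outcome, and all constants depend on the least slope of the modified link
  alone.\<close>

lemma psi_minus: "psi (- x) = 1 - psi x"
proof -
  have "1 + exp x \<noteq> 0" using exp_gt_zero[of x] by linarith
  then show ?thesis by (simp add: psi_def exp_minus field_simps)
qed

lemma psi_bounds: "0 < psi x" "psi x < 1"
proof -
  have "0 < 1 + exp x" using exp_gt_zero[of x] by linarith
  then show "0 < psi x" "psi x < 1" by (simp_all add: psi_def)
qed

lemma psi'_eq: "psi' x = psi x * (1 - psi x)"
proof -
  have "1 + exp x \<noteq> 0" using exp_gt_zero[of x] by linarith
  then show ?thesis by (simp add: psi_def psi'_def field_simps power2_eq_square)
qed

lemma psi'_pos: "0 < psi' x"
  using psi_bounds[of x] by (simp add: psi'_eq)

lemma psi'_le: "psi' x \<le> 1 / 4"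
proof -
  have "0 \<le> (psi x - 1/2)^2" by simp
  then show ?thesis by (simp add: psi'_eq power2_eq_square algebra_simps)
qed

lemma psi'_minus: "psi' (- x) = psi' x"
  by (simp add: psi'_eq psi_minus)

lemma psi_deriv: "(psi has_real_derivative psi' x) (at x)"
proof -
  have "1 + exp x \<noteq> 0" using exp_gt_zero[of x] by linarith
  then show ?thesis
    unfolding psi_def[abs_def] psi'_def
    by (auto intro!: derivative_eq_intros simp: field_simps power2_eq_square)
qed

lemma psi_mono: "x \<le> y \<Longrightarrow> psi x \<le> psi y"
  by (rule DERIV_nonneg_imp_nondecreasing) (auto intro!: exI[of _ "psi' _"] psi_deriv less_imp_le[OF psi'_pos])

lemma psi_mvt:
  assumes "s < t"
  obtains \<xi> where "s < \<xi>" "\<xi> < t" "psi t - psi s = psi' \<xi> * (t - s)"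
proof -
  have "\<exists>z. s < z \<and> z < t \<and> psi t - psi s = (t - s) * psi' z"
    by (rule MVT2[OF assms]) (rule psi_deriv)
  then show thesis using that by (auto simp: mult.commute)
qed

lemma psi_diff_le:
  assumes "s \<le> t" shows "psi t - psi s \<le> t - s"
proof (cases "s = t")
  case False
  then obtain \<xi> where "psi t - psi s = psi' \<xi> * (t - s)" using psi_mvt assms by (metis less_eq_real_def)
  moreover have "psi' \<xi> \<le> 1" using psi'_le[of \<xi>] by simp
  ultimately show ?thesis using assms by (simp add: mult_left_le_one_le psi'_pos less_imp_le)
qed simp

text \<open>For q = \<open>psi s\<close> and r = \<open>psi t\<close> the difference q(1-q) - r(1-r)
  factors as (q-r)(1-q-r), and the second factor is at most 1 in modulus. This avoids a second
  derivative.\<close>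

lemma psi'_diff_le: "\<bar>psi' s - psi' t\<bar> \<le> \<bar>s - t\<bar>"
proof -
  have eq: "psi' s - psi' t = (psi s - psi t) * (1 - psi s - psi t)"
    by (simp add: psi'_eq algebra_simps)
  have "\<bar>psi s - psi t\<bar> \<le> \<bar>s - t\<bar>"
    using psi_diff_le[of s t] psi_diff_le[of t s] psi_mono[of s t] psi_mono[of t s] by linarith
  moreover have "\<bar>1 - psi s - psi t\<bar> \<le> 1"
    using psi_bounds[of s] psi_bounds[of t] by linarith
  ultimately show ?thesis unfolding eq abs_mult
    by (metis abs_ge_zero mult.right_neutral mult_mono)
qed

text \<open>The mean value theorem leaves the slope at an intermediate point; replacing it by the
  slope at \<open>s\<close> costs at most \<open>\<bar>t\<bar>\<close> by
  \<open>psi'_diff_le\<close>.\<close>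

lemma psi_taylor: "\<bar>psi (s + t) - psi s - psi' s * t\<bar> \<le> t\<^sup>2"
proof -
  have main: "\<exists>\<xi>. \<bar>\<xi> - s\<bar> \<le> \<bar>t\<bar> \<and> psi (s + t) - psi s = psi' \<xi> * t"
  proof (cases "t = 0")
    case False
    then consider "t > 0" | "t < 0" by linarith
    then show ?thesis
    proof cases
      case 1
      then obtain \<xi> where "s < \<xi>" "\<xi> < s + t" "psi (s+t) - psi s = psi' \<xi> * (s + t - s)"
        using psi_mvt[of s "s+t"] by auto
      then show ?thesis by (intro exI[of _ \<xi>]) auto
    next
      case 2
      then obtain \<xi> where "s + t < \<xi>" "\<xi> < s" "psi s - psi (s+t) = psi' \<xi> * (s - (s + t))"
        using psi_mvt[of "s+t" s] by auto
      then show ?thesis by (intro exI[of _ \<xi>]) (auto simp: algebra_simps)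
    qed
  qed auto
  then obtain \<xi> where x: "\<bar>\<xi> - s\<bar> \<le> \<bar>t\<bar>" "psi (s + t) - psi s = psi' \<xi> * t" by blast
  have "psi (s + t) - psi s - psi' s * t = (psi' \<xi> - psi' s) * t" using x(2) by (simp add: algebra_simps)
  then have "\<bar>psi (s + t) - psi s - psi' s * t\<bar> = \<bar>psi' \<xi> - psi' s\<bar> * \<bar>t\<bar>" by (simp add: abs_mult)
  also have "\<dots> \<le> \<bar>t\<bar> * \<bar>t\<bar>" using psi'_diff_le[of \<xi> s] x(1) by (intro mult_right_mono) auto
  finally show ?thesis by (simp add: power2_eq_square)
qed

text \<open>The value \<open>psi x\<close> lies between \<open>1 - psi R\<close> and
  \<open>psi R\<close>, and the concave function q(1-q) takes its minimum over this interval at the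
  two ends, where it equals \<open>psi' R\<close>.\<close>

lemma psi'_antimono:
  assumes "\<bar>x\<bar> \<le> R" shows "psi' R \<le> psi' x"
proof -
  have "psi (- R) \<le> psi x" "psi x \<le> psi R" using assms by (auto intro!: psi_mono)
  then have "0 \<le> (psi R - psi x) * (psi x - (1 - psi R))" by (simp add: psi_minus)
  then show ?thesis by (simp add: psi'_eq algebra_simps)
qed

definition clamp_real :: "real \<Rightarrow> real \<Rightarrow> real" where
  "clamp_real R t = max (- R) (min R t)"

text \<open>The logistic function, continued linearly outside \<open>[-R, R]\<close>: its slope is bounded below on
  the whole line, so estimates for the corresponding score equation need no a priori bounds.\<close>

definition psi_lin :: "real \<Rightarrow> real \<Rightarrow> real" where
  "psi_lin R t = psi (clamp_real R t) + psi' R * (t - clamp_real R t)"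

lemma psi_lin_eq: "\<bar>t\<bar> \<le> R \<Longrightarrow> psi_lin R t = psi t"
proof -
  assume "\<bar>t\<bar> \<le> R"
  then have "clamp_real R t = t" by (auto simp: clamp_real_def)
  then show ?thesis by (simp add: psi_lin_def)
qed

lemma psi_lin_minus: "0 \<le> R \<Longrightarrow> psi_lin R (- t) = 1 - psi_lin R t"
proof -
  assume "0 \<le> R"
  then have "clamp_real R (- t) = - clamp_real R t" by (simp add: clamp_real_def min_def max_def)
  then show ?thesis by (simp add: psi_lin_def psi_minus algebra_simps)
qed

text \<open>An increment splits into an increment of \<open>psi\<close> between clamped arguments,
  with slope in [\<open>psi' R\<close>, 1] by the mean value theorem, and a linear remainder of
  slope exactly \<open>psi' R\<close>.\<close>

lemma psi_lin_slope:
  assumes "0 \<le> R" "s \<le> t"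
  shows "psi' R * (t - s) \<le> psi_lin R t - psi_lin R s" "psi_lin R t - psi_lin R s \<le> t - s"
proof -
  define a b where "a = clamp_real R s" and "b = clamp_real R t"
  have ab: "a \<le> b" "b - a \<le> t - s" "\<bar>a\<bar> \<le> R" "\<bar>b\<bar> \<le> R"
    using assms by (auto simp: a_def b_def clamp_real_def min_def max_def)
  have eq: "psi_lin R t - psi_lin R s = psi b - psi a + psi' R * ((t - s) - (b - a))"
    by (simp add: psi_lin_def a_def b_def algebra_simps)
  have "psi' R * (b - a) \<le> psi b - psi a"
  proof (cases "a = b")
    case False
    then obtain \<xi> where x: "a < \<xi>" "\<xi> < b" "psi b - psi a = psi' \<xi> * (b - a)"
      using psi_mvt[of a b] ab by (metis less_eq_real_def)
    have "psi' R \<le> psi' \<xi>" using x ab by (intro psi'_antimono) auto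
    then show ?thesis unfolding x(3) using ab by (intro mult_right_mono) auto
  qed simp
  then show "psi' R * (t - s) \<le> psi_lin R t - psi_lin R s" unfolding eq by (simp add: algebra_simps)
  have "psi' R * ((t - s) - (b - a)) \<le> 1 * ((t - s) - (b - a))"
    using psi'_le[of R] ab by (intro mult_right_mono) auto
  then show "psi_lin R t - psi_lin R s \<le> t - s"
    unfolding eq using psi_diff_le[of a b] ab by simp
qed

text \<open>The log-partition function of a Bernoulli variable. With it each term of the negative
  log-likelihood is convex minus linear in the difference of the two parameters.\<close>

definition softplus :: "real \<Rightarrow> real" where
  "softplus x = ln (1 + exp x)"

lemma softplus_deriv: "(softplus has_real_derivative psi x) (at x)"
proof -
  have "0 < 1 + exp x" using exp_gt_zero[of x] by linarith
  then show ?thesis unfolding softplus_def[abs_def] psi_def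
    by (auto intro!: derivative_eq_intros)
qed

lemma ln_inverse_psi: "ln (1 / psi x) = softplus x - x"
proof -
  have "0 < 1 + exp x" using exp_gt_zero[of x] by linarith
  then show ?thesis by (simp add: psi_def softplus_def ln_div)
qed

lemma softplus_minus: "softplus (- x) = softplus x - x"
proof -
  have pos: "0 < 1 + exp x" using exp_gt_zero[of x] by linarith
  have "1 + exp (- x) = (1 + exp x) / exp x" by (simp add: exp_minus field_simps)
  then show ?thesis using pos by (simp add: softplus_def ln_div)
qed

lemma psi_strict_mono: "x < y \<Longrightarrow> psi x < psi y"
  using psi_mvt[of x y] psi'_pos by (metis diff_gt_0_iff_gt mult_pos_pos)

text \<open>The strict tangent inequality; strictness is what later forces any two minimisers to
  agree along every edge.\<close>

lemma softplus_convex: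
  assumes "x \<noteq> y" shows "softplus x + psi x * (y - x) < softplus y"
proof -
  consider "x < y" | "y < x" using assms by linarith
  then show ?thesis
  proof cases
    case 1
    then obtain \<xi> where x: "x < \<xi>" "\<xi> < y" "softplus y - softplus x = (y - x) * psi \<xi>"
      using MVT2[OF 1, of softplus psi] softplus_deriv by metis
    have "(y - x) * psi x < (y - x) * psi \<xi>" using psi_strict_mono[OF x(1)] 1 by simp
    with x(3) show ?thesis by (simp add: algebra_simps)
  next
    case 2
    then obtain \<xi> where x: "y < \<xi>" "\<xi> < x" "softplus x - softplus y = (x - y) * psi \<xi>"
      using MVT2[OF 2, of softplus psi] softplus_deriv by metis
    have "(x - y) * psi \<xi> < (x - y) * psi x" using psi_strict_mono[OF x(2)] 2 by simp
    with x(3) show ?thesis by (simp add: algebra_simps)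
  qed
qed

subsection \<open>Energy forms on weighted graphs\<close>

lemma power2_add_le: "(x + y)\<^sup>2 \<le> 2 * x\<^sup>2 + 2 * (y::real)\<^sup>2"
  using zero_le_power2[of "x - y"] by (simp add: power2_eq_square algebra_simps)

lemma power2_add3_le: "(x + y + z)\<^sup>2 \<le> 3 * x\<^sup>2 + 3 * y\<^sup>2 + 3 * (z::real)\<^sup>2"
  using zero_le_power2[of "x - y"] zero_le_power2[of "x - z"] zero_le_power2[of "y - z"]
  by (simp add: power2_eq_square algebra_simps)

text \<open>The Dirichlet form over ordered pairs: for symmetric weights every edge counts twice,
  which explains the factors 1/2 in summation by parts and the denominators \<open>2 * L\<close> in
  the noise bounds.\<close>

definition energy :: "('a \<Rightarrow> 'a \<Rightarrow> real) \<Rightarrow> 'a set \<Rightarrow> ('a \<Rightarrow> real) \<Rightarrow> real" where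
  "energy A V u = (\<Sum>j\<in>V. \<Sum>l\<in>V. A j l * (u j - u l)\<^sup>2)"

text \<open>Discrete Green formula: exchanging the two summation indices and using antisymmetry, the
  test function enters only through its differences along edges.\<close>

lemma sum_by_parts:
  fixes u :: "'a \<Rightarrow> real"
  assumes "\<And>j l. j \<in> V \<Longrightarrow> l \<in> V \<Longrightarrow> g j l = - g l j"
  shows "(\<Sum>j\<in>V. u j * (\<Sum>l\<in>V. g j l)) = (\<Sum>j\<in>V. \<Sum>l\<in>V. g j l * (u j - u l)) / 2"
proof -
  let ?X = "\<Sum>j\<in>V. \<Sum>l\<in>V. u j * g j l"
  have "?X = (\<Sum>l\<in>V. \<Sum>j\<in>V. u j * g j l)" by (rule sum.swap)
  also have "\<dots> = (\<Sum>l\<in>V. \<Sum>j\<in>V. - (g l j * u j))"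
  proof (intro sum.cong refl)
    fix l j assume "l \<in> V" "j \<in> V"
    then show "u j * g j l = - (g l j * u j)" using assms[of j l] by simp
  qed
  finally have "?X + ?X = (\<Sum>j\<in>V. \<Sum>l\<in>V. g j l * (u j - u l))"
    by (simp add: algebra_simps sum.distrib sum_negf sum_subtractf)
  moreover have "(\<Sum>j\<in>V. u j * (\<Sum>l\<in>V. g j l)) = ?X" by (simp add: sum_distrib_left)
  ultimately show ?thesis by linarith
qed

lemma sum_antisymmetric:
  fixes g :: "'a \<Rightarrow> 'a \<Rightarrow> real"
  assumes "\<And>j l. j \<in> V \<Longrightarrow> l \<in> V \<Longrightarrow> g j l = - g l j"
  shows "(\<Sum>j\<in>V. \<Sum>l\<in>V. g j l) = 0"
  using sum_by_parts[of V g "\<lambda>_. 1", OF assms] by simp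

lemma weighted_Cauchy_Schwarz:
  fixes W x y :: "'a \<Rightarrow> real"
  assumes "\<And>j. j \<in> V \<Longrightarrow> 0 \<le> W j"
  shows "(\<Sum>j\<in>V. W j * (x j * y j))\<^sup>2 \<le> (\<Sum>j\<in>V. W j * (x j)\<^sup>2) * (\<Sum>j\<in>V. W j * (y j)\<^sup>2)"
proof -
  have "(\<Sum>j\<in>V. (sqrt (W j) * x j) * (sqrt (W j) * y j))\<^sup>2
      \<le> (\<Sum>j\<in>V. (sqrt (W j) * x j)\<^sup>2) * (\<Sum>j\<in>V. (sqrt (W j) * y j)\<^sup>2)"
    by (rule Cauchy_Schwarz_ineq_sum)
  moreover have "(\<Sum>j\<in>V. (sqrt (W j) * x j) * (sqrt (W j) * y j)) = (\<Sum>j\<in>V. W j * (x j * y j))"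
    using assms by (intro sum.cong refl) (simp add: real_sqrt_mult[symmetric] algebra_simps)
  moreover have "(\<Sum>j\<in>V. (sqrt (W j) * z j)\<^sup>2) = (\<Sum>j\<in>V. W j * (z j)\<^sup>2)" for z :: "'a \<Rightarrow> real"
    using assms by (intro sum.cong refl) (simp add: power_mult_distrib)
  ultimately show ?thesis by simp
qed

lemma weighted_Cauchy_Schwarz2:
  fixes W x y :: "'a \<Rightarrow> 'b \<Rightarrow> real"
  assumes "\<And>j l. j \<in> V \<Longrightarrow> l \<in> U \<Longrightarrow> 0 \<le> W j l"
  shows "(\<Sum>j\<in>V. \<Sum>l\<in>U. W j l * (x j l * y j l))\<^sup>2
    \<le> (\<Sum>j\<in>V. \<Sum>l\<in>U. W j l * (x j l)\<^sup>2) * (\<Sum>j\<in>V. \<Sum>l\<in>U. W j l * (y j l)\<^sup>2)"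
  using weighted_Cauchy_Schwarz[of "V \<times> U" "case_prod W" "case_prod x" "case_prod y"] assms
  by (auto simp: sum.cartesian_product case_prod_unfold)

subsection \<open>Spectral gap from edge expansion\<close>

text \<open>Take \<open>m\<close> least among the values exceeded by at most half of the points. The
  next smaller value \<open>m'\<close> fails this test, so more than half of the points lie above
  \<open>m'\<close>, and those below \<open>m\<close> are disjoint from them.\<close>

lemma exists_median:
  fixes u :: "'a \<Rightarrow> real"
  assumes "finite V" "V \<noteq> {}"
  obtains m where "2 * card {j\<in>V. m < u j} \<le> card V" "2 * card {j\<in>V. u j < m} \<le> card V"
proof -
  define Q where "Q = {x \<in> u ` V. 2 * card {j\<in>V. x < u j} \<le> card V}"
  have finQ: "finite Q" using assms by (simp add: Q_def)
  have e: "{j\<in>V. Max (u ` V) < u j} = {}" using assms by (auto simp: not_less)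
  have "Max (u ` V) \<in> Q" unfolding Q_def mem_Collect_eq e using assms by simp
  then have "Q \<noteq> {}" by auto
  define m where "m = Min Q"
  have mQ: "m \<in> Q" unfolding m_def using finQ \<open>Q \<noteq> {}\<close> by (rule Min_in)
  have "2 * card {j\<in>V. u j < m} \<le> card V"
  proof (cases "{j\<in>V. u j < m} = {}")
    case False
    define m' where "m' = Max (u ` {j\<in>V. u j < m})"
    have "m' \<in> u ` {j\<in>V. u j < m}" unfolding m'_def using assms False by (intro Max_in) auto
    then have m': "m' \<in> u ` V" "m' < m" by auto
    then have "m' \<notin> Q" using finQ unfolding m_def by (metis Min_le leD)
    then have big: "card V < 2 * card {j\<in>V. m' < u j}" using m' by (simp add: Q_def not_le)
    have le: "u j \<le> m'" if "j \<in> V" "u j < m" for j unfolding m'_def using that assms by (intro Max_ge) auto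
    have "card {j\<in>V. m' < u j} + card {j\<in>V. u j < m} = card ({j\<in>V. m' < u j} \<union> {j\<in>V. u j < m})"
      using assms le by (intro card_Un_disjoint[symmetric]) force+
    also have "\<dots> \<le> card V" using assms by (intro card_mono) auto
    finally show ?thesis using big by linarith
  next
    case True
    then show ?thesis by (simp only: card.empty)
  qed
  then show thesis using that mQ by (auto simp: Q_def)
qed

context
  fixes V :: "'a set" and A :: "'a \<Rightarrow> 'a \<Rightarrow> real" and \<alpha> :: real
  assumes fin: "finite V"
    and nonneg: "\<And>j l. j \<in> V \<Longrightarrow> l \<in> V \<Longrightarrow> 0 \<le> A j l"
    and sym: "\<And>j l. j \<in> V \<Longrightarrow> l \<in> V \<Longrightarrow> A j l = A l j"
    and cut: "\<And>S. S \<subseteq> V \<Longrightarrow> S \<noteq> {} \<Longrightarrow> 2 * card S \<le> card V \<Longrightarrow>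
        \<alpha> * real (card S) \<le> (\<Sum>j\<in>S. \<Sum>l\<in>V - S. A j l)"
begin

text \<open>Discrete co-area argument by peeling off level sets: lowering \<open>w\<close> by its
  least positive value \<open>m\<close> on its support \<open>S\<close> reduces the left side by 2
  \<alpha> m |S| and the right side by 2 m times the cut of \<open>S\<close>, while the support
  shrinks. All supports have at most half of the vertices, so the expansion hypothesis applies
  throughout.\<close>

lemma coarea_inequality:
  fixes w :: "'a \<Rightarrow> real"
  assumes w: "\<And>j. j \<in> V \<Longrightarrow> 0 \<le> w j" "2 * card {j\<in>V. 0 < w j} \<le> card V"
  shows "2 * \<alpha> * (\<Sum>j\<in>V. w j) \<le> (\<Sum>j\<in>V. \<Sum>l\<in>V. A j l * \<bar>w j - w l\<bar>)"
  using w
proof (induction "card {j\<in>V. 0 < w j}" arbitrary: w rule: less_induct)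
  case less
  define S where "S = {j\<in>V. 0 < w j}"
  have SV: "S \<subseteq> V" and finS: "finite S" using fin by (auto simp: S_def)
  have w0: "w j = 0" if "j \<in> V" "j \<notin> S" for j using that less.prems(1)[of j] by (auto simp: S_def)
  show ?case
  proof (cases "S = {}")
    case True
    then have "(\<Sum>j\<in>V. w j) = 0" using w0 by (intro sum.neutral) auto
    then show ?thesis using nonneg by (auto intro!: sum_nonneg)
  next
    case False
    define m where "m = Min (w ` S)"
    have mS: "m \<le> w j" if "j \<in> S" for j unfolding m_def using that finS by auto
    have "m \<in> w ` S" unfolding m_def using finS False by (intro Min_in) auto
    then obtain j0 where j0: "j0 \<in> S" "w j0 = m" by auto
    then have mpos: "0 < m" by (auto simp: S_def)
    define w' where "w' j = (if j \<in> S then w j - m else w j)" for j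
    have "{j\<in>V. 0 < w' j} \<subseteq> S - {j0}" using w0 j0 by (auto simp: w'_def S_def split: if_splits)
    then have sub: "{j\<in>V. 0 < w' j} \<subset> S" using j0 by blast
    then have less': "card {j\<in>V. 0 < w' j} < card S" using finS by (rule psubset_card_mono[rotated])
    have IH: "2 * \<alpha> * (\<Sum>j\<in>V. w' j) \<le> (\<Sum>j\<in>V. \<Sum>l\<in>V. A j l * \<bar>w' j - w' l\<bar>)"
    proof (rule less.hyps)
      show "card {j\<in>V. 0 < w' j} < card {j\<in>V. 0 < w j}" using less' by (simp add: S_def)
      show "0 \<le> w' j" if "j \<in> V" for j using that mS less.prems(1) by (auto simp: w'_def)
      show "2 * card {j\<in>V. 0 < w' j} \<le> card V" using less' less.prems(2) by (simp add: S_def)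
    qed
    have "(\<Sum>j\<in>V. w j) = (\<Sum>j\<in>V. w' j + (if j \<in> S then m else 0))"
      by (intro sum.cong) (auto simp: w'_def)
    also have "\<dots> = (\<Sum>j\<in>V. w' j) + m * real (card S)"
      using fin SV by (simp add: sum.distrib sum.If_cases Int_absorb1)
    finally have s1: "(\<Sum>j\<in>V. w j) = (\<Sum>j\<in>V. w' j) + m * real (card S)" .
    \<comment> \<open>Lowering \<open>w\<close> on \<open>S\<close> changes a difference only across
      the boundary of \<open>S\<close>, and there by exactly \<open>m\<close>, since
      \<open>w\<close> vanishes outside \<open>S\<close> and is at least \<open>m\<close>
      inside.\<close>
    define X where "X j l = (if (j \<in> S) = (l \<in> S) then 0 else m)" for j l
    have absw: "\<bar>w j - w l\<bar> = \<bar>w' j - w' l\<bar> + X j l" if "j \<in> V" "l \<in> V" for j l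
      using mS[of j] mS[of l] w0[of j] w0[of l] mpos that by (auto simp: w'_def X_def)
    have s2: "(\<Sum>j\<in>V. \<Sum>l\<in>V. A j l * \<bar>w j - w l\<bar>)
        = (\<Sum>j\<in>V. \<Sum>l\<in>V. A j l * \<bar>w' j - w' l\<bar>) + (\<Sum>j\<in>V. \<Sum>l\<in>V. A j l * X j l)"
      by (simp add: absw distrib_left sum.distrib)
    have split: "sum f V = sum f S + sum f (V - S)" for f :: "'a \<Rightarrow> real"
      using sum.subset_diff[OF SV fin, of f] by simp
    have "(\<Sum>j\<in>V. \<Sum>l\<in>V. A j l * X j l)
        = (\<Sum>j\<in>S. \<Sum>l\<in>V - S. A j l * m) + (\<Sum>j\<in>V - S. \<Sum>l\<in>S. A j l * m)"
      by (simp add: split X_def)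
    also have "(\<Sum>j\<in>V - S. \<Sum>l\<in>S. A j l * m) = (\<Sum>l\<in>S. \<Sum>j\<in>V - S. A j l * m)" by (rule sum.swap)
    also have "\<dots> = (\<Sum>l\<in>S. \<Sum>j\<in>V - S. A l j * m)"
    proof (intro sum.cong refl)
      fix l j assume "l \<in> S" "j \<in> V - S"
      then show "A j l * m = A l j * m" using SV sym[of j l] by auto
    qed
    finally have s3: "(\<Sum>j\<in>V. \<Sum>l\<in>V. A j l * X j l) = 2 * m * (\<Sum>j\<in>S. \<Sum>l\<in>V - S. A j l)"
      by (simp add: sum_distrib_left mult.commute mult.left_commute)
    have "\<alpha> * real (card S) \<le> (\<Sum>j\<in>S. \<Sum>l\<in>V - S. A j l)"
      using cut[OF SV False] less.prems(2) by (simp add: S_def)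
    then have "2 * m * (\<alpha> * real (card S)) \<le> 2 * m * (\<Sum>j\<in>S. \<Sum>l\<in>V - S. A j l)"
      using mpos by (intro mult_left_mono) auto
    then show ?thesis using IH s1 s2 s3 by (simp add: algebra_simps)
  qed
qed

text \<open>The co-area inequality is applied to the square of \<open>g\<close>. Factoring
  differences of squares, Cauchy-Schwarz separates the energy of \<open>g\<close> from the sums
  \<open>g j + g l\<close>, whose weighted squares are at most 4 \<Delta> times the squared norm;
  one factor of that norm then cancels.\<close>

lemma gap_nonneg_half_support:
  fixes g :: "'a \<Rightarrow> real"
  assumes deg: "\<And>j. j \<in> V \<Longrightarrow> (\<Sum>l\<in>V. A j l) \<le> \<Delta>"
    and \<alpha>: "0 \<le> \<alpha>" and \<Delta>: "0 \<le> \<Delta>"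
    and g: "\<And>j. j \<in> V \<Longrightarrow> 0 \<le> g j" "2 * card {j\<in>V. 0 < g j} \<le> card V"
  shows "\<alpha>\<^sup>2 * (\<Sum>j\<in>V. (g j)\<^sup>2) \<le> \<Delta> * energy A V g"
proof -
  define G where "G = (\<Sum>j\<in>V. (g j)\<^sup>2)"
  have G0: "0 \<le> G" by (simp add: G_def sum_nonneg)
  have E0: "0 \<le> energy A V g" using nonneg by (auto simp: energy_def intro!: sum_nonneg)
  have "{j\<in>V. 0 < (g j)\<^sup>2} = {j\<in>V. 0 < g j}" using g(1) by force
  then have c: "2 * card {j\<in>V. 0 < (g j)\<^sup>2} \<le> card V" using g(2) by simp
  have "2 * \<alpha> * G \<le> (\<Sum>j\<in>V. \<Sum>l\<in>V. A j l * \<bar>(g j)\<^sup>2 - (g l)\<^sup>2\<bar>)"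
    unfolding G_def by (rule coarea_inequality[OF _ c]) auto
  also have "\<dots> = (\<Sum>j\<in>V. \<Sum>l\<in>V. A j l * (\<bar>g j - g l\<bar> * (g j + g l)))"
  proof (intro sum.cong refl)
    fix j l assume "j \<in> V" "l \<in> V"
    then have "\<bar>g j + g l\<bar> = g j + g l" using g(1)[of j] g(1)[of l] by simp
    moreover have "(g j)\<^sup>2 - (g l)\<^sup>2 = (g j - g l) * (g j + g l)" by (simp add: power2_eq_square algebra_simps)
    ultimately show "A j l * \<bar>(g j)\<^sup>2 - (g l)\<^sup>2\<bar> = A j l * (\<bar>g j - g l\<bar> * (g j + g l))" by (simp add: abs_mult)
  qed
  finally have "(2 * \<alpha> * G)\<^sup>2 \<le> (\<Sum>j\<in>V. \<Sum>l\<in>V. A j l * (\<bar>g j - g l\<bar> * (g j + g l)))\<^sup>2"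
    using \<alpha> G0 by (intro power_mono) auto
  also have "\<dots> \<le> (\<Sum>j\<in>V. \<Sum>l\<in>V. A j l * \<bar>g j - g l\<bar>\<^sup>2) * (\<Sum>j\<in>V. \<Sum>l\<in>V. A j l * (g j + g l)\<^sup>2)"
    by (rule weighted_Cauchy_Schwarz2) (rule nonneg)
  also have "\<dots> = energy A V g * (\<Sum>j\<in>V. \<Sum>l\<in>V. A j l * (g j + g l)\<^sup>2)" by (simp add: energy_def)
  also have "(\<Sum>j\<in>V. \<Sum>l\<in>V. A j l * (g j + g l)\<^sup>2) \<le> (\<Sum>j\<in>V. \<Sum>l\<in>V. A j l * (2 * (g j)\<^sup>2 + 2 * (g l)\<^sup>2))"
  proof (intro sum_mono mult_left_mono nonneg)
    fix j l
    have "0 \<le> (g j - g l)\<^sup>2" by simp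
    then show "(g j + g l)\<^sup>2 \<le> 2 * (g j)\<^sup>2 + 2 * (g l)\<^sup>2" by (simp add: power2_eq_square algebra_simps)
  qed
  also have "\<dots> = 2 * (\<Sum>j\<in>V. \<Sum>l\<in>V. A j l * (g j)\<^sup>2) + 2 * (\<Sum>j\<in>V. \<Sum>l\<in>V. A j l * (g l)\<^sup>2)"
    by (simp add: distrib_left sum.distrib sum_distrib_left mult.left_commute)
  also have "(\<Sum>j\<in>V. \<Sum>l\<in>V. A j l * (g l)\<^sup>2) = (\<Sum>l\<in>V. \<Sum>j\<in>V. A j l * (g l)\<^sup>2)" by (rule sum.swap)
  also have "\<dots> = (\<Sum>l\<in>V. \<Sum>j\<in>V. A l j * (g l)\<^sup>2)"
    by (intro sum.cong refl) (simp add: sym)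
  also have "2 * (\<Sum>j\<in>V. \<Sum>l\<in>V. A j l * (g j)\<^sup>2) + 2 * (\<Sum>l\<in>V. \<Sum>j\<in>V. A l j * (g l)\<^sup>2)
      = 4 * (\<Sum>j\<in>V. (\<Sum>l\<in>V. A j l) * (g j)\<^sup>2)" by (simp add: sum_distrib_right)
  also have "(\<Sum>j\<in>V. (\<Sum>l\<in>V. A j l) * (g j)\<^sup>2) \<le> (\<Sum>j\<in>V. \<Delta> * (g j)\<^sup>2)"
    using deg by (intro sum_mono mult_right_mono) auto
  also have "\<dots> = \<Delta> * G" by (simp add: G_def sum_distrib_left)
  finally have "(2 * \<alpha> * G)\<^sup>2 \<le> energy A V g * (4 * (\<Delta> * G))" using E0 by (simp add: mult_left_mono)
  then have "G * (\<alpha>\<^sup>2 * G) \<le> G * (\<Delta> * energy A V g)" by (simp add: power2_eq_square algebra_simps)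
  then show ?thesis
    using G0 \<Delta> E0 by (cases "G = 0") (auto simp: G_def[symmetric])
qed

text \<open>Cheeger's inequality. Cutting \<open>u\<close> at a median gives two nonnegative parts,
  each supported on at most half of the vertices. Their energies add up to at most that of
  \<open>u\<close>, and as \<open>u\<close> has mean zero, subtracting the median can only increase
  the l2 norm.\<close>

lemma cheeger_gap:
  fixes u :: "'a \<Rightarrow> real"
  assumes deg: "\<And>j. j \<in> V \<Longrightarrow> (\<Sum>l\<in>V. A j l) \<le> \<Delta>"
    and \<alpha>: "0 \<le> \<alpha>" and \<Delta>: "0 \<le> \<Delta>"
    and u: "(\<Sum>j\<in>V. u j) = 0"
  shows "\<alpha>\<^sup>2 * (\<Sum>j\<in>V. (u j)\<^sup>2) \<le> \<Delta> * energy A V u"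
proof (cases "V = {}")
  case False
  obtain m where m: "2 * card {j\<in>V. m < u j} \<le> card V" "2 * card {j\<in>V. u j < m} \<le> card V"
    using exists_median[OF fin False] by blast
  define g h where "g j = max 0 (u j - m)" and "h j = max 0 (m - u j)" for j
  have gs: "{j\<in>V. 0 < g j} = {j\<in>V. m < u j}" and hs: "{j\<in>V. 0 < h j} = {j\<in>V. u j < m}"
    by (auto simp: g_def h_def)
  have g0: "0 \<le> g j" and h0: "0 \<le> h j" for j by (auto simp: g_def h_def)
  have ng: "\<alpha>\<^sup>2 * (\<Sum>j\<in>V. (g j)\<^sup>2) \<le> \<Delta> * energy A V g"
    and nh: "\<alpha>\<^sup>2 * (\<Sum>j\<in>V. (h j)\<^sup>2) \<le> \<Delta> * energy A V h"
    by (rule gap_nonneg_half_support[OF deg \<alpha> \<Delta>]; use gs hs m g0 h0 in simp)+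
  have "energy A V g + energy A V h = (\<Sum>j\<in>V. \<Sum>l\<in>V. A j l * ((g j - g l)\<^sup>2 + (h j - h l)\<^sup>2))"
    by (simp add: energy_def sum.distrib distrib_left)
  also have "\<dots> \<le> energy A V u" unfolding energy_def
  proof (intro sum_mono mult_left_mono nonneg)
    fix j l
    \<comment> \<open>The positive part increases with \<open>u\<close> and the negative part
      decreases, so the mixed term in the expanded square has the favourable sign.\<close>
    have "0 \<le> (g j - g l) * (h l - h j)"
      by (auto simp: g_def h_def max_def mult_nonneg_nonneg mult_nonpos_nonpos)
    moreover have "u j - u l = (g j - g l) + (h l - h j)" by (auto simp: g_def h_def)
    ultimately show "(g j - g l)\<^sup>2 + (h j - h l)\<^sup>2 \<le> (u j - u l)\<^sup>2"
      by (simp only:) (simp add: power2_eq_square algebra_simps)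
  qed
  finally have E: "energy A V g + energy A V h \<le> energy A V u" .
  have "(\<Sum>j\<in>V. (u j)\<^sup>2) \<le> (\<Sum>j\<in>V. (u j)\<^sup>2) + real (card V) * m\<^sup>2" by simp
  also have "\<dots> = (\<Sum>j\<in>V. (u j - m)\<^sup>2)"
    using u by (simp add: power2_diff sum.distrib sum_subtractf sum_distrib_left[symmetric] sum_distrib_right[symmetric])
  also have "\<dots> = (\<Sum>j\<in>V. (g j)\<^sup>2) + (\<Sum>j\<in>V. (h j)\<^sup>2)"
    unfolding sum.distrib[symmetric] by (intro sum.cong refl) (auto simp: g_def h_def max_def power2_commute)
  finally have "\<alpha>\<^sup>2 * (\<Sum>j\<in>V. (u j)\<^sup>2) \<le> \<alpha>\<^sup>2 * ((\<Sum>j\<in>V. (g j)\<^sup>2) + (\<Sum>j\<in>V. (h j)\<^sup>2))"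
    by (intro mult_left_mono) auto
  also have "\<dots> \<le> \<Delta> * (energy A V g + energy A V h)" using ng nh by (simp add: algebra_simps)
  also have "\<dots> \<le> \<Delta> * energy A V u" using E \<Delta> by (intro mult_left_mono) auto
  finally show ?thesis .
qed (simp add: energy_def)


end

subsection \<open>Strongly monotone edge systems\<close>

text \<open>The score equation of the model and the linear Laplace equation are both of the form below.\<close>

locale edge_system =
  fixes V :: "'a set" and A :: "'a \<Rightarrow> 'a \<Rightarrow> real" and \<phi> :: "'a \<Rightarrow> 'a \<Rightarrow> real \<Rightarrow> real" and c :: real
  assumes fin: "finite V"
    and A_nonneg: "\<And>j l. 0 \<le> A j l" and A_le: "\<And>j l. A j l \<le> 1"
    and A_sym: "\<And>j l. A j l = A l j"
    and phi_odd: "\<And>j l t. \<phi> j l (- t) = - \<phi> l j t"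
    and phi_lower: "\<And>j l s t. s \<le> t \<Longrightarrow> c * (t - s) \<le> \<phi> j l t - \<phi> j l s"
    and phi_upper: "\<And>j l s t. s \<le> t \<Longrightarrow> \<phi> j l t - \<phi> j l s \<le> t - s"
    and c_pos: "0 < c"
begin

definition flow :: "('a \<Rightarrow> real) \<Rightarrow> 'a \<Rightarrow> real" where
  "flow u j = (\<Sum>l\<in>V. A j l * \<phi> j l (u j - u l))"

definition is_solution :: "('a \<Rightarrow> real) \<Rightarrow> ('a \<Rightarrow> real) \<Rightarrow> bool" where
  "is_solution b u \<longleftrightarrow> (\<Sum>j\<in>V. u j) = 0 \<and> (\<forall>j\<in>V. flow u j = b j)"

lemma phi_mono_prod: "c * (t - s)\<^sup>2 \<le> (\<phi> j l t - \<phi> j l s) * (t - s)"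
proof (cases "s \<le> t")
  case True
  then show ?thesis using phi_lower[OF True, of j l]
    by (metis (no_types) diff_ge_0_iff_ge mult.assoc mult_right_mono power2_eq_square)
next
  case False
  then have "t \<le> s" by simp
  then have "c * (s - t) * (s - t) \<le> (\<phi> j l s - \<phi> j l t) * (s - t)"
    using phi_lower[of t s j l] by (intro mult_right_mono) auto
  then show ?thesis by (simp add: power2_eq_square algebra_simps)
qed

lemma phi_Lipschitz: "\<bar>\<phi> j l t - \<phi> j l s\<bar> \<le> \<bar>t - s\<bar>"
proof -
  have "0 \<le> \<phi> j l t - \<phi> j l s" if "s \<le> t" for s t
    using phi_lower[OF that, of j l] c_pos that by (smt (verit) mult_nonneg_nonneg)
  then show ?thesis using phi_upper[of s t j l] phi_upper[of t s j l] by (smt (verit))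
qed

lemma flow_by_parts:
  "(\<Sum>j\<in>V. v j * (flow u j - flow u' j))
    = (\<Sum>j\<in>V. \<Sum>l\<in>V. A j l * (\<phi> j l (u j - u l) - \<phi> j l (u' j - u' l)) * (v j - v l)) / 2"
proof -
  have "(\<Sum>j\<in>V. v j * (flow u j - flow u' j))
      = (\<Sum>j\<in>V. v j * (\<Sum>l\<in>V. A j l * (\<phi> j l (u j - u l) - \<phi> j l (u' j - u' l))))"
    by (simp add: flow_def sum_subtractf right_diff_distrib)
  also have "\<dots> = (\<Sum>j\<in>V. \<Sum>l\<in>V. A j l * (\<phi> j l (u j - u l) - \<phi> j l (u' j - u' l)) * (v j - v l)) / 2"
  proof (rule sum_by_parts)
    fix j l
    have "\<phi> l j (u l - u j) = - \<phi> j l (u j - u l)" "\<phi> l j (u' l - u' j) = - \<phi> j l (u' j - u' l)"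
      using phi_odd[of l j "u j - u l"] phi_odd[of l j "u' j - u' l"] by simp_all
    then show "A j l * (\<phi> j l (u j - u l) - \<phi> j l (u' j - u' l))
        = - (A l j * (\<phi> l j (u l - u j) - \<phi> l j (u' l - u' j)))"
      using A_sym[of j l] by (simp add: algebra_simps)
  qed
  finally show ?thesis .
qed

lemma flow_monotone:
  "c / 2 * energy A V (\<lambda>j. u j - u' j) \<le> (\<Sum>j\<in>V. (u j - u' j) * (flow u j - flow u' j))"
proof -
  have "c * energy A V (\<lambda>j. u j - u' j)
      = (\<Sum>j\<in>V. \<Sum>l\<in>V. A j l * (c * ((u j - u l) - (u' j - u' l))\<^sup>2))"
    by (simp add: energy_def sum_distrib_left algebra_simps)
  also have "\<dots> \<le> (\<Sum>j\<in>V. \<Sum>l\<in>V. A j l * ((\<phi> j l (u j - u l) - \<phi> j l (u' j - u' l)) * ((u j - u l) - (u' j - u' l))))"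
    by (intro sum_mono mult_left_mono phi_mono_prod A_nonneg)
  also have "\<dots> = 2 * (\<Sum>j\<in>V. (u j - u' j) * (flow u j - flow u' j))"
    unfolding flow_by_parts by (simp add: algebra_simps)
  finally show ?thesis by simp
qed

lemma sum_flow: "(\<Sum>j\<in>V. flow u j) = 0"
  unfolding flow_def
proof (rule sum_antisymmetric)
  fix j l
  show "A j l * \<phi> j l (u j - u l) = - (A l j * \<phi> l j (u l - u j))"
    using phi_odd[of l j "u j - u l"] A_sym[of j l] by simp
qed

text \<open>A crude Lipschitz constant, twice the number of vertices, suffices: it only fixes the
  step size of the iteration that constructs solutions and enters no estimate for them.\<close>

lemma flow_diff_le:
  "(\<Sum>j\<in>V. (flow u j - flow u' j)\<^sup>2) \<le> 4 * (real (card V))\<^sup>2 * (\<Sum>j\<in>V. (u j - u' j)\<^sup>2)"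
proof -
  define w where "w j = u j - u' j" for j
  define N where "N = real (card V)"
  have "(\<Sum>j\<in>V. (flow u j - flow u' j)\<^sup>2) \<le> (\<Sum>j\<in>V. N * (\<Sum>l\<in>V. (w j - w l)\<^sup>2))"
  proof (rule sum_mono)
    fix j assume "j \<in> V"
    have "\<bar>flow u j - flow u' j\<bar> = \<bar>\<Sum>l\<in>V. A j l * (\<phi> j l (u j - u l) - \<phi> j l (u' j - u' l))\<bar>"
      by (simp add: flow_def sum_subtractf right_diff_distrib)
    also have "\<dots> \<le> (\<Sum>l\<in>V. \<bar>A j l * (\<phi> j l (u j - u l) - \<phi> j l (u' j - u' l))\<bar>)" by (rule sum_abs)
    also have "\<dots> \<le> (\<Sum>l\<in>V. \<bar>w j - w l\<bar>)"
    proof (rule sum_mono)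
      fix l
      have "\<bar>A j l\<bar> * \<bar>\<phi> j l (u j - u l) - \<phi> j l (u' j - u' l)\<bar> \<le> 1 * \<bar>(u j - u l) - (u' j - u' l)\<bar>"
        using A_nonneg[of j l] A_le[of j l] by (intro mult_mono phi_Lipschitz) auto
      then show "\<bar>A j l * (\<phi> j l (u j - u l) - \<phi> j l (u' j - u' l))\<bar> \<le> \<bar>w j - w l\<bar>"
        unfolding abs_mult w_def by (smt (verit))
    qed
    finally have "(flow u j - flow u' j)\<^sup>2 \<le> (\<Sum>l\<in>V. \<bar>w j - w l\<bar>)\<^sup>2"
      using power_mono[of "\<bar>flow u j - flow u' j\<bar>" _ 2] by simp
    also have "\<dots> \<le> (\<Sum>l\<in>V. 1\<^sup>2) * (\<Sum>l\<in>V. \<bar>w j - w l\<bar>\<^sup>2)"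
      using Cauchy_Schwarz_ineq_sum[of "\<lambda>_. 1" "\<lambda>l. \<bar>w j - w l\<bar>" V] by simp
    finally show "(flow u j - flow u' j)\<^sup>2 \<le> N * (\<Sum>l\<in>V. (w j - w l)\<^sup>2)" by (simp add: N_def)
  qed
  also have "\<dots> \<le> (\<Sum>j\<in>V. N * (\<Sum>l\<in>V. 2 * (w j)\<^sup>2 + 2 * (w l)\<^sup>2))"
  proof (intro sum_mono mult_left_mono)
    fix j l
    have "0 \<le> (w j + w l)\<^sup>2" by simp
    then show "(w j - w l)\<^sup>2 \<le> 2 * (w j)\<^sup>2 + 2 * (w l)\<^sup>2" by (simp add: power2_eq_square algebra_simps)
  qed (simp add: N_def)
  also have "\<dots> = 4 * N\<^sup>2 * (\<Sum>j\<in>V. (w j)\<^sup>2)"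
    by (simp add: sum.distrib sum_distrib_left N_def[symmetric] power2_eq_square algebra_simps)
  finally show ?thesis by (simp add: w_def N_def)
qed

text \<open>The iteration u - s (flow u - b) keeps the sum at zero, because flow and right-hand side
  both sum to zero. On that hyperplane the spectral gap makes the flow strongly monotone, so for
  small \<open>s\<close> the map contracts in l2 and its limit is a fixed point.\<close>

lemma solution_exists:
  assumes g: "0 < g"
    and gap: "\<And>u. (\<Sum>j\<in>V. u j) = 0 \<Longrightarrow> g * (\<Sum>j\<in>V. (u j)\<^sup>2) \<le> energy A V u"
    and b: "(\<Sum>j\<in>V. b j) = 0"
  shows "\<exists>u. is_solution b u"
proof (cases "V = {}")
  case False
  define N where "N = real (card V)"
  have N: "1 \<le> N" using False fin by (simp add: N_def Suc_leI card_gt_0_iff)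
  define \<mu> where "\<mu> = min (c * g) 1"
  have \<mu>: "0 < \<mu>" "\<mu> \<le> 1" "\<mu> \<le> c * g" using g c_pos by (auto simp: \<mu>_def)
  \<comment> \<open>This \<open>s\<close> minimises the contraction factor 1 - s \<mu> + 4 s^2 N^2,
    with minimum \<open>r\<close>. Capping \<mu> at 1 keeps \<open>r\<close> nonnegative.\<close>
  define s where "s = \<mu> / (8 * N\<^sup>2)"
  define r where "r = 1 - \<mu>\<^sup>2 / (16 * N\<^sup>2)"
  have s: "0 < s" using \<mu> N by (simp add: s_def)
  have "\<mu>\<^sup>2 \<le> 1" "1 \<le> N\<^sup>2" using \<mu> N by (auto simp: power_le_one)
  then have "\<mu>\<^sup>2 \<le> 16 * N\<^sup>2" by linarith
  then have r: "0 \<le> r" "r < 1" using \<mu> N by (auto simp: r_def)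
  define T where "T u j = u j - s * (flow u j - b j)" for u j
  have T_sum: "(\<Sum>j\<in>V. T u j) = (\<Sum>j\<in>V. u j)" for u
    by (simp add: T_def sum_subtractf sum_distrib_left[symmetric] sum_flow b)
  have contr: "(\<Sum>j\<in>V. (T u j - T v j)\<^sup>2) \<le> r * (\<Sum>j\<in>V. (u j - v j)\<^sup>2)"
    if z: "(\<Sum>j\<in>V. u j) = 0" "(\<Sum>j\<in>V. v j) = 0" for u v
  proof -
    define W where "W = (\<Sum>j\<in>V. (u j - v j)\<^sup>2)"
    have W0: "0 \<le> W" by (simp add: W_def sum_nonneg)
    have "(\<Sum>j\<in>V. (T u j - T v j)\<^sup>2) = (\<Sum>j\<in>V. (u j - v j)\<^sup>2 - 2 * s * ((u j - v j) * (flow u j - flow v j))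
        + s\<^sup>2 * (flow u j - flow v j)\<^sup>2)"
      by (intro sum.cong refl) (simp add: T_def power2_eq_square algebra_simps)
    also have "\<dots> = W - 2 * s * (\<Sum>j\<in>V. (u j - v j) * (flow u j - flow v j))
        + s\<^sup>2 * (\<Sum>j\<in>V. (flow u j - flow v j)\<^sup>2)"
      by (simp add: W_def sum.distrib sum_subtractf sum_distrib_left)
    finally have eq: "(\<Sum>j\<in>V. (T u j - T v j)\<^sup>2) = \<dots>" .
    have "\<mu> * W \<le> c * g * W" using \<mu> W0 by (intro mult_right_mono)
    also have "\<dots> \<le> c * energy A V (\<lambda>j. u j - v j)"
      using gap[of "\<lambda>j. u j - v j"] z c_pos by (simp add: sum_subtractf W_def mult.assoc)
    finally have "\<mu> / 2 * W \<le> (\<Sum>j\<in>V. (u j - v j) * (flow u j - flow v j))"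
      using flow_monotone[of u v] by simp
    then have "2 * s * (\<mu> / 2 * W) \<le> 2 * s * (\<Sum>j\<in>V. (u j - v j) * (flow u j - flow v j))"
      using s by (intro mult_left_mono) auto
    moreover have "s\<^sup>2 * (\<Sum>j\<in>V. (flow u j - flow v j)\<^sup>2) \<le> s\<^sup>2 * (4 * N\<^sup>2 * W)"
      using flow_diff_le[of u v] by (intro mult_left_mono) (auto simp: N_def W_def)
    ultimately have "(\<Sum>j\<in>V. (T u j - T v j)\<^sup>2) \<le> W - 2 * s * (\<mu> / 2 * W) + s\<^sup>2 * (4 * N\<^sup>2 * W)"
      unfolding eq by linarith
    also have "\<dots> = r * W" using N by (simp add: s_def r_def field_simps power2_eq_square)
    finally show ?thesis by (simp add: W_def)
  qed
  define U where "U k = (T ^^ k) (\<lambda>_. 0)" for k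
  have U_Suc: "U (Suc k) = T (U k)" for k by (simp add: U_def)
  have U_sum: "(\<Sum>j\<in>V. U k j) = 0" for k
    by (induction k) (simp_all add: U_Suc T_sum, simp add: U_def)
  define d where "d = (\<Sum>j\<in>V. (U 1 j - U 0 j)\<^sup>2)"
  have step: "(\<Sum>j\<in>V. (U (Suc k) j - U k j)\<^sup>2) \<le> r ^ k * d" for k
  proof (induction k)
    case (Suc k)
    have "(\<Sum>j\<in>V. (U (Suc (Suc k)) j - U (Suc k) j)\<^sup>2) \<le> r * (\<Sum>j\<in>V. (U (Suc k) j - U k j)\<^sup>2)"
      unfolding U_Suc[of "Suc k"] U_Suc[of k]
      using contr[of "T (U k)" "U k"] U_sum T_sum by (simp add: U_Suc)
    also have "\<dots> \<le> r * (r ^ k * d)" using Suc r by (intro mult_left_mono)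
    finally show ?case by (simp add: mult.assoc)
  qed (simp add: d_def)
  have conv: "convergent (\<lambda>k. U k j)" if j: "j \<in> V" for j
  proof -
    have "summable (\<lambda>k. sqrt d * sqrt r ^ k)"
      using r by (intro summable_mult summable_geometric) auto
    then have "summable (\<lambda>k. U (Suc k) j - U k j)"
    proof (rule summable_comparison_test'[where N = 0])
      fix k
      have "(U (Suc k) j - U k j)\<^sup>2 \<le> (\<Sum>j\<in>V. (U (Suc k) j - U k j)\<^sup>2)"
        using fin j by (intro member_le_sum) auto
      also have "\<dots> \<le> r ^ k * d" by (rule step)
      finally have "\<bar>U (Suc k) j - U k j\<bar> \<le> sqrt (r ^ k * d)" by (rule real_le_rsqrt[of "\<bar>_\<bar>", simplified])
      then show "norm (U (Suc k) j - U k j) \<le> sqrt d * sqrt r ^ k"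
        by (simp add: real_sqrt_mult real_sqrt_power mult.commute)
    qed
    then have "convergent (\<lambda>n. \<Sum>k<n. U (Suc k) j - U k j)" by (simp add: summable_iff_convergent)
    then have "convergent (\<lambda>n. U n j - U 0 j)" using sum_lessThan_telescope[of "\<lambda>k. U k j"] by simp
    then have "convergent (\<lambda>n. (U n j - U 0 j) + U 0 j)" by (intro convergent_add convergent_const)
    then show ?thesis by simp
  qed
  define v where "v j = lim (\<lambda>k. U k j)" for j
  have lim: "(\<lambda>k. U k j) \<longlonglongrightarrow> v j" if "j \<in> V" for j
    using conv[OF that] by (simp add: v_def convergent_LIMSEQ_iff)
  have phi_cont: "isCont (\<phi> j l) x" for j l x
  proof -
    have "((\<lambda>t. \<phi> j l t - \<phi> j l x) \<longlongrightarrow> 0) (at x)"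
    proof (rule Lim_null_comparison)
      show "\<forall>\<^sub>F t in at x. norm (\<phi> j l t - \<phi> j l x) \<le> \<bar>t - x\<bar>" using phi_Lipschitz by simp
      show "((\<lambda>t. \<bar>t - x\<bar>) \<longlongrightarrow> 0) (at x)" by (auto intro!: tendsto_eq_intros)
    qed
    then show ?thesis unfolding isCont_def by (rule LIM_zero_cancel)
  qed
  have flow_lim: "(\<lambda>k. flow (U k) j) \<longlonglongrightarrow> flow v j" if "j \<in> V" for j
    unfolding flow_def
    by (intro tendsto_sum tendsto_mult tendsto_const isCont_tendsto_compose[OF phi_cont] tendsto_diff lim that)
  have "flow v j = b j" if j: "j \<in> V" for j
  proof -
    have "(\<lambda>k. U (Suc k) j) \<longlonglongrightarrow> v j - s * (flow v j - b j)"
      unfolding U_Suc T_def by (intro tendsto_intros lim flow_lim j)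
    moreover have "(\<lambda>k. U (Suc k) j) \<longlonglongrightarrow> v j" using lim[OF j] by (rule LIMSEQ_Suc)
    ultimately have "v j - s * (flow v j - b j) = v j" by (rule LIMSEQ_unique)
    then show ?thesis using s by simp
  qed
  moreover have "(\<Sum>j\<in>V. v j) = 0"
  proof -
    have "(\<lambda>k. \<Sum>j\<in>V. U k j) \<longlonglongrightarrow> (\<Sum>j\<in>V. v j)" by (intro tendsto_sum lim)
    then show ?thesis by (simp add: U_sum LIMSEQ_const_iff)
  qed
  ultimately show ?thesis unfolding is_solution_def by blast
next
  case True
  then have "is_solution b (\<lambda>_. 0)" unfolding is_solution_def by simp
  then show ?thesis by blast
qed

end

text \<open>Cauchy-Schwarz bounds the pairing by the two norms, the gap turns the norm of
  \<open>q\<close> into energy, and one factor of the energy cancels. The abstract form serves the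
  score equation, the leave-one-out difference and the Laplace equation alike.\<close>

lemma gap_energy_bounds:
  fixes q r :: "'a \<Rightarrow> real"
  assumes g: "0 < g" and c: "0 < c" and E: "g * (\<Sum>j\<in>V. (q j)\<^sup>2) \<le> energy A V q"
    and le: "c / 2 * energy A V q \<le> (\<Sum>j\<in>V. q j * r j)"
  shows "energy A V q \<le> 4 / (c\<^sup>2 * g) * (\<Sum>j\<in>V. (r j)\<^sup>2)"
    and "(\<Sum>j\<in>V. (q j)\<^sup>2) \<le> 4 / (c\<^sup>2 * g\<^sup>2) * (\<Sum>j\<in>V. (r j)\<^sup>2)"
proof -
  define E Q R where "E = energy A V q" and "Q = (\<Sum>j\<in>V. (q j)\<^sup>2)" and "R = (\<Sum>j\<in>V. (r j)\<^sup>2)"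
  have Q0: "0 \<le> Q" and R0: "0 \<le> R" by (simp_all add: Q_def R_def sum_nonneg)
  have gQ: "g * Q \<le> E" using E by (simp add: E_def Q_def)
  then have E0: "0 \<le> E" using g Q0 by (smt (verit) mult_nonneg_nonneg)
  have "(c / 2 * E)\<^sup>2 \<le> (\<Sum>j\<in>V. q j * r j)\<^sup>2" using le c E0 by (intro power_mono) (auto simp: E_def)
  also have "\<dots> \<le> Q * R" unfolding Q_def R_def by (rule Cauchy_Schwarz_ineq_sum)
  also have "\<dots> \<le> E / g * R" using gQ g R0 by (intro mult_right_mono) (auto simp: field_simps)
  finally have "E * E \<le> E * (4 / (c\<^sup>2 * g) * R)" using c g by (simp add: field_simps power2_eq_square)
  then have main: "E \<le> 4 / (c\<^sup>2 * g) * R"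
    using E0 c g R0 by (cases "E = 0") (simp, metis less_eq_real_def mult_le_cancel_left_pos)
  then show "energy A V q \<le> 4 / (c\<^sup>2 * g) * (\<Sum>j\<in>V. (r j)\<^sup>2)" by (simp add: E_def R_def)
  have "Q \<le> E / g" using gQ g by (simp add: field_simps)
  also have "\<dots> \<le> 4 / (c\<^sup>2 * g) * R / g" using main g by (intro divide_right_mono) auto
  finally show "(\<Sum>j\<in>V. (q j)\<^sup>2) \<le> 4 / (c\<^sup>2 * g\<^sup>2) * (\<Sum>j\<in>V. (r j)\<^sup>2)"
    by (simp add: Q_def R_def power2_eq_square algebra_simps)
qed

subsection \<open>Concentration inequalities\<close>

text \<open>Fubini with a bound uniform over the first component; this is how conditioning on the
  graph is expressed. The mirrored version below conditions on the second component.\<close>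

lemma prob_pair_pmf_le:
  assumes "\<And>x. measure_pmf.prob N {y. (x, y) \<in> S} \<le> e"
  shows "measure_pmf.prob (pair_pmf M N) S \<le> e"
proof -
  have e: "0 \<le> e" using assms[of undefined] measure_nonneg order_trans by blast
  have "emeasure (pair_pmf M N) S = (\<integral>\<^sup>+z. indicator S z \<partial>pair_pmf M N)" by simp
  also have "\<dots> = (\<integral>\<^sup>+x. \<integral>\<^sup>+y. indicator S (x, y) \<partial>N \<partial>M)" by (rule nn_integral_pair_pmf')
  also have "\<dots> = (\<integral>\<^sup>+x. emeasure N {y. (x, y) \<in> S} \<partial>M)"
  proof (intro nn_integral_cong)
    fix x
    have "(\<lambda>y. indicator S (x, y) :: ennreal) = indicator {y. (x, y) \<in> S}" by (auto simp: indicator_def)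
    then show "(\<integral>\<^sup>+y. indicator S (x, y) \<partial>N) = emeasure N {y. (x, y) \<in> S}" by simp
  qed
  also have "\<dots> \<le> (\<integral>\<^sup>+x. ennreal e \<partial>M)"
    using assms by (intro nn_integral_mono) (simp add: measure_pmf.emeasure_eq_measure ennreal_leI)
  also have "\<dots> = ennreal e" by (simp add: measure_pmf.emeasure_space_1)
  finally show ?thesis using e by (simp add: measure_pmf.emeasure_eq_measure)
qed

lemma prob_pair_pmf_le':
  assumes "\<And>y. measure_pmf.prob M {x. (x, y) \<in> S} \<le> e"
  shows "measure_pmf.prob (pair_pmf M N) S \<le> e"
proof -
  have "measure_pmf.prob (pair_pmf N M) ((\<lambda>(x, y). (y, x)) -` S) \<le> e"
    by (rule prob_pair_pmf_le) (use assms in simp)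
  then show ?thesis by (subst pair_commute_pmf) simp
qed

text \<open>Chernoff's method: Markov's inequality for the exponential, whose expectation factorises
  over the independent coordinates.\<close>

lemma prob_exp_markov:
  fixes z :: "'a \<Rightarrow> bool \<Rightarrow> real"
  assumes fin: "finite I"
    and mgf: "\<And>e. e \<in> I \<Longrightarrow> measure_pmf.expectation (bernoulli_pmf (q e)) (\<lambda>v. exp (z e v)) \<le> exp (k e)"
  shows "measure_pmf.prob (Pi_pmf I d (\<lambda>e. bernoulli_pmf (q e))) {a. t \<le> (\<Sum>e\<in>I. z e (a e))}
    \<le> exp ((\<Sum>e\<in>I. k e) - t)"
proof -
  let ?M = "Pi_pmf I d (\<lambda>e. bernoulli_pmf (q e))"
  have int: "integrable (measure_pmf (bernoulli_pmf (q e))) f" for e and f :: "bool \<Rightarrow> real"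
    by (rule integrable_measure_pmf_finite) (rule finite_subset[OF subset_UNIV], simp)
  have "integrable (measure_pmf ?M) (\<lambda>a. \<Prod>e\<in>I. exp (z e (a e)))"
    by (rule integrable_prod_Pi_pmf[OF fin int])
  then have integ: "integrable (measure_pmf ?M) (\<lambda>a. exp (\<Sum>e\<in>I. z e (a e)))" by (simp add: exp_sum fin)
  have "measure_pmf.prob ?M {a. exp t \<le> exp (\<Sum>e\<in>I. z e (a e))}
      \<le> measure_pmf.expectation ?M (\<lambda>a. exp (\<Sum>e\<in>I. z e (a e))) / exp t"
    using integral_Markov_inequality_measure[OF integ, of "{}" "exp t"] by simp
  also have "measure_pmf.expectation ?M (\<lambda>a. exp (\<Sum>e\<in>I. z e (a e)))
      = (\<Prod>e\<in>I. measure_pmf.expectation (bernoulli_pmf (q e)) (\<lambda>v. exp (z e v)))"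
    unfolding exp_sum[OF fin] by (rule expectation_prod_Pi_pmf[OF fin int]) simp
  also have "\<dots> \<le> (\<Prod>e\<in>I. exp (k e))"
    using mgf by (intro prod_mono) (auto intro!: Bochner_Integration.integral_nonneg)
  also have "\<dots> = exp (\<Sum>e\<in>I. k e)" by (simp add: exp_sum fin)
  finally show ?thesis by (simp add: exp_diff divide_right_mono)
qed

lemma exp_le_quadratic:
  fixes s :: real
  assumes "\<bar>s\<bar> \<le> 1" shows "exp s \<le> 1 + s + s\<^sup>2"
proof (cases "0 \<le> s")
  case True
  then show ?thesis using exp_bound[of s] assms by simp
next
  case False
  define x where "x = - s"
  have x: "0 \<le> x" "x \<le> 1" using False assms by (auto simp: x_def)
  have pos: "0 \<le> 1 - x + x\<^sup>2" using x by simp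
  \<comment> \<open>The polynomial is the product of the claimed bound at \<open>- x\<close> with
    the quadratic Taylor minorant of \<open>exp x\<close>; all its nonconstant coefficients are
    nonnegative.\<close>
  have "1 \<le> 1 + x\<^sup>2 / 2 + x^3 / 2 + x^4 / 2" using x by simp
  also have "\<dots> = (1 - x + x\<^sup>2) * (1 + x + x\<^sup>2 / 2)"
    by (simp add: field_simps power2_eq_square power3_eq_cube power4_eq_xxxx)
  also have "\<dots> \<le> (1 - x + x\<^sup>2) * exp x"
    using pos exp_lower_Taylor_quadratic[OF x(1)] by (intro mult_left_mono) auto
  finally have "exp (- x) \<le> 1 - x + x\<^sup>2" by (simp add: exp_minus field_simps)
  then show ?thesis by (simp add: x_def)
qed

text \<open>The variance proxy \<open>q\<close>, in place of the constant of Hoeffding's inequality,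
  makes fluctuations of a row of the sparse graph scale with the edge probability.\<close>

lemma bernstein_mgf_bernoulli:
  assumes q: "0 \<le> q" "q \<le> 1" and s: "\<bar>s\<bar> \<le> 1"
  shows "measure_pmf.expectation (bernoulli_pmf q) (\<lambda>v. exp (s * (of_bool v - q))) \<le> exp (q * s\<^sup>2)"
proof -
  have "measure_pmf.expectation (bernoulli_pmf q) (\<lambda>v. exp (s * (of_bool v - q)))
      = q * exp (s * (1 - q)) + (1 - q) * exp (- (s * q))" using q by (simp add: integral_bernoulli_pmf)
  also have "\<dots> = exp (- s * q) * (1 + q * (exp s - 1))"
    by (simp add: algebra_simps exp_add[symmetric] exp_diff exp_minus divide_inverse)
  also have "\<dots> \<le> exp (- s * q) * exp (q * (exp s - 1))" by (intro mult_left_mono exp_ge_add_one_self) auto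
  also have "\<dots> = exp (q * (exp s - 1 - s))" by (simp add: exp_add[symmetric] algebra_simps)
  also have "\<dots> \<le> exp (q * s\<^sup>2)" using exp_le_quadratic[OF s] q by (simp add: mult_left_mono)
  finally show ?thesis .
qed

text \<open>Chernoff's method with the quadratic moment bound, which is available only for exponents
  with \<open>s * m \<le> 1\<close>; this constraint produces the term linear in
  \<open>m\<close>.\<close>

lemma bernstein_one_sided:
  fixes f :: "'a \<Rightarrow> real"
  assumes fin: "finite I" and p: "0 \<le> p" "p \<le> 1" and \<alpha>: "0 < \<alpha>"
    and m: "\<And>e. e \<in> I \<Longrightarrow> \<bar>f e\<bar> \<le> m" "0 < m"
  shows "measure_pmf.prob (Pi_pmf I d (\<lambda>e. bernoulli_pmf p))
    {a. 2 * sqrt (\<alpha> * p * (\<Sum>e\<in>I. (f e)\<^sup>2)) + 2 * \<alpha> * m \<le> (\<Sum>e\<in>I. (of_bool (a e) - p) * f e)} \<le> exp (- \<alpha>)"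
proof -
  define F where "F = (\<Sum>e\<in>I. (f e)\<^sup>2)"
  define t where "t = 2 * sqrt (\<alpha> * p * F) + 2 * \<alpha> * m"
  have F0: "0 \<le> F" by (simp add: F_def sum_nonneg)
  \<comment> \<open>The free optimum \<open>sqrt (\<alpha> / (p * F))\<close> is taken when it obeys
    \<open>s * m \<le> 1\<close>; otherwise \<open>s = 1/m\<close>. In both cases the quadratic part
    is at most \<alpha> and \<open>s * t\<close> at least 2 \<alpha>.\<close>
  obtain s where s: "0 < s" "s * m \<le> 1" "p * s\<^sup>2 * F - s * t \<le> - \<alpha>"
  proof (cases "p * F < m\<^sup>2 * \<alpha>")
    case True
    then have "p * (1/m)\<^sup>2 * F \<le> \<alpha>" using m(2) by (simp add: field_simps)
    moreover have "2 * \<alpha> \<le> (1/m) * t" using m(2) \<alpha> p F0 by (simp add: t_def field_simps)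
    ultimately show thesis using m(2) by (intro that[of "1/m"]) auto
  next
    case False
    then have a: "0 < \<alpha>" "m\<^sup>2 * \<alpha> \<le> p * F" using \<alpha> by auto
    have pF: "0 < p * F" using a m(2) by (smt (verit) mult_pos_pos zero_less_power)
    define s where "s = sqrt (\<alpha> / (p * F))"
    have s2: "s\<^sup>2 = \<alpha> / (p * F)" using a pF by (simp add: s_def)
    have "(s * m)\<^sup>2 \<le> 1" using a pF by (simp add: power_mult_distrib s2 field_simps)
    then have sm: "s * m \<le> 1" by (metis abs_le_square_iff abs_of_nonneg abs_one one_power2 abs_ge_self order_trans)
    have "s * sqrt (\<alpha> * p * F) = \<alpha>"
      using a pF by (auto simp: s_def real_sqrt_mult[symmetric] mult.assoc)
    moreover have "0 \<le> s * (2 * \<alpha> * m)" using a pF m by (simp add: s_def)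
    moreover have "s * t = 2 * (s * sqrt (\<alpha> * p * F)) + s * (2 * \<alpha> * m)" by (simp add: t_def algebra_simps)
    ultimately have "2 * \<alpha> \<le> s * t" by linarith
    moreover have "p * s\<^sup>2 * F = \<alpha>" unfolding s2 using pF by (auto simp: field_simps)
    moreover have "0 < s" using a pF by (simp add: s_def)
    ultimately show thesis using sm by (intro that[of s]) auto
  qed
  have "measure_pmf.prob (Pi_pmf I d (\<lambda>e. bernoulli_pmf p))
      {a. s * t \<le> (\<Sum>e\<in>I. (s * f e) * (of_bool (a e) - p))} \<le> exp ((\<Sum>e\<in>I. p * (s * f e)\<^sup>2) - s * t)"
  proof (rule prob_exp_markov[OF fin])
    fix e assume "e \<in> I"
    then have "\<bar>s * f e\<bar> \<le> s * m" using m s by (simp add: abs_mult)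
    then show "measure_pmf.expectation (bernoulli_pmf p) (\<lambda>v. exp (s * f e * (of_bool v - p))) \<le> exp (p * (s * f e)\<^sup>2)"
      using p s by (intro bernstein_mgf_bernoulli) auto
  qed
  also have "(\<Sum>e\<in>I. p * (s * f e)\<^sup>2) - s * t = p * s\<^sup>2 * F - s * t"
    by (simp add: F_def sum_distrib_left power_mult_distrib mult.assoc)
  also have "exp \<dots> \<le> exp (- \<alpha>)" using s by simp
  also have "{a. s * t \<le> (\<Sum>e\<in>I. (s * f e) * (of_bool (a e) - p))} = {a. t \<le> (\<Sum>e\<in>I. (of_bool (a e) - p) * f e)}"
  proof -
    have "(\<Sum>e\<in>I. (s * f e) * (of_bool (a e) - p)) = s * (\<Sum>e\<in>I. (of_bool (a e) - p) * f e)" for a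
      by (simp add: sum_distrib_left ac_simps)
    then show ?thesis using s(1) by simp
  qed
  finally show ?thesis by (simp add: t_def F_def)
qed

text \<open>The bound \<open>m\<close> is quantified inside the event because the coefficients will
  later be random, with a bound known only for the given outcome. The union over all admissible
  \<open>m\<close> equals the event for the smallest one, the maximum of the coefficients.\<close>

lemma bernstein:
  fixes f :: "'a \<Rightarrow> real"
  assumes fin: "finite I" and p: "0 \<le> p" "p \<le> 1" and \<alpha>: "0 < \<alpha>"
  shows "measure_pmf.prob (Pi_pmf I d (\<lambda>e. bernoulli_pmf p))
    {a. \<exists>m\<ge>0. (\<forall>e\<in>I. \<bar>f e\<bar> \<le> m) \<and>
        2 * sqrt (\<alpha> * p * (\<Sum>e\<in>I. (f e)\<^sup>2)) + 2 * \<alpha> * m < \<bar>\<Sum>e\<in>I. (of_bool (a e) - p) * f e\<bar>}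
    \<le> 2 * exp (- \<alpha>)" (is "measure_pmf.prob ?M ?B \<le> _")
proof -
  define m where "m = Max (insert 0 ((\<lambda>e. \<bar>f e\<bar>) ` I))"
  have m0: "0 \<le> m" and mI: "\<And>e. e \<in> I \<Longrightarrow> \<bar>f e\<bar> \<le> m" using fin by (auto simp: m_def)
  define t where "t = 2 * sqrt (\<alpha> * p * (\<Sum>e\<in>I. (f e)\<^sup>2)) + 2 * \<alpha> * m"
  have sub: "?B \<subseteq> {a. t < \<bar>\<Sum>e\<in>I. (of_bool (a e) - p) * f e\<bar>}"
  proof safe
    fix a m' assume m': "0 \<le> m'" "\<forall>e\<in>I. \<bar>f e\<bar> \<le> m'"
      and lt: "2 * sqrt (\<alpha> * p * (\<Sum>e\<in>I. (f e)\<^sup>2)) + 2 * \<alpha> * m' < \<bar>\<Sum>e\<in>I. (of_bool (a e) - p) * f e\<bar>"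
    have "m \<le> m'" unfolding m_def using m' fin by auto
    then have "2 * \<alpha> * m \<le> 2 * \<alpha> * m'" using \<alpha> by simp
    with lt show "t < \<bar>\<Sum>e\<in>I. (of_bool (a e) - p) * f e\<bar>" by (simp add: t_def)
  qed
  show ?thesis
  proof (cases "m = 0")
    case True
    then have "f e = 0" if "e \<in> I" for e using mI[OF that] by simp
    then have "?B \<subseteq> {}" using sub True by (auto simp: t_def)
    then have "?B = {}" by (rule subset_empty[THEN iffD1])
    then show ?thesis by (simp only: measure_empty) simp
  next
    case False
    then have m: "0 < m" using m0 by simp
    let ?P = "{a. t \<le> (\<Sum>e\<in>I. (of_bool (a e) - p) * f e)}"
    let ?N = "{a. t \<le> (\<Sum>e\<in>I. (of_bool (a e) - p) * (- f e))}"
    have "measure_pmf.prob ?M ?B \<le> measure_pmf.prob ?M (?P \<union> ?N)"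
    proof (rule measure_pmf.finite_measure_mono)
      have "{a. t < \<bar>\<Sum>e\<in>I. (of_bool (a e) - p) * f e\<bar>} \<subseteq> ?P \<union> ?N" by (auto simp: sum_negf abs_real_def)
      with sub show "?B \<subseteq> ?P \<union> ?N" by (rule subset_trans)
    qed simp
    also have "\<dots> \<le> measure_pmf.prob ?M ?P + measure_pmf.prob ?M ?N"
      by (rule measure_Un_le) auto
    also have "measure_pmf.prob ?M ?P \<le> exp (- \<alpha>)"
      unfolding t_def by (rule bernstein_one_sided[OF fin p \<alpha> mI m])
    also have "measure_pmf.prob ?M ?N \<le> exp (- \<alpha>)"
      using bernstein_one_sided[OF fin p \<alpha>, of "\<lambda>e. - f e" m] mI m by (simp add: t_def)
    finally show ?thesis by simp
  qed
qed

text \<open>Strict inequality in the event makes it empty when all coefficients vanish, so this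
  degenerate case need not be excluded from the statement.\<close>

lemma hoeffding_bernoulli:
  fixes x :: "'a \<Rightarrow> real"
  assumes fin: "finite I" and q: "\<And>e. e \<in> I \<Longrightarrow> 0 \<le> q e" "\<And>e. e \<in> I \<Longrightarrow> q e \<le> 1" and \<alpha>: "0 \<le> \<alpha>"
  shows "measure_pmf.prob (Pi_pmf I d (\<lambda>e. bernoulli_pmf (q e)))
    {a. sqrt (\<alpha> * (\<Sum>e\<in>I. (x e)\<^sup>2)) < \<bar>\<Sum>e\<in>I. x e * (of_bool (a e) - q e)\<bar>} \<le> 2 * exp (- 2 * \<alpha>)"
    (is "measure_pmf.prob ?M ?B \<le> _")
proof (cases "(\<Sum>e\<in>I. (x e)\<^sup>2) = 0")
  case True
  then have "x e = 0" if "e \<in> I" for e using fin that by (simp add: sum_nonneg_eq_0_iff)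
  then have "?B = {}" by simp
  then show ?thesis by simp
next
  case False
  have X: "0 < (\<Sum>e\<in>I. (x e)\<^sup>2)" using False sum_nonneg[of I "\<lambda>e. (x e)\<^sup>2"] by simp
  define Z where "Z e a = x e * of_bool (a e)" for e :: 'a and a
  have "prob_space.indep_vars (measure_pmf ?M) (\<lambda>_. borel) (\<lambda>e. (\<lambda>v. x e * of_bool v) \<circ> (\<lambda>a. a e)) I"
    by (rule prob_space.indep_vars_compose[OF measure_pmf.prob_space_axioms indep_vars_Pi_pmf[OF fin]]) simp
  then have indep: "prob_space.indep_vars (measure_pmf ?M) (\<lambda>_. borel) Z I" by (simp add: Z_def[abs_def] o_def)
  interpret H: Hoeffding_ineq ?M I Z "\<lambda>e. min 0 (x e)" "\<lambda>e. max 0 (x e)" "\<Sum>e\<in>I. measure_pmf.expectation ?M (Z e)"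
    by unfold_locales (auto simp: fin indep Z_def)
  have "measure_pmf.expectation ?M (Z e) = x e * q e" if "e \<in> I" for e
  proof -
    have "measure_pmf.expectation ?M (Z e) = measure_pmf.expectation (map_pmf (\<lambda>a. a e) ?M) (\<lambda>v. x e * of_bool v)"
      by (simp add: Z_def[abs_def])
    then show ?thesis using that q by (simp add: Pi_pmf_component[OF fin] integral_bernoulli_pmf)
  qed
  then have "(\<Sum>e\<in>I. Z e a) - (\<Sum>e\<in>I. measure_pmf.expectation ?M (Z e)) = (\<Sum>e\<in>I. x e * (of_bool (a e) - q e))" for a
    by (simp add: Z_def sum_subtractf right_diff_distrib)
  moreover have "(max 0 (x e) - min 0 (x e))\<^sup>2 = (x e)\<^sup>2" for e by (simp add: max_def min_def)
  ultimately have "measure_pmf.prob ?M {a. t \<le> \<bar>\<Sum>e\<in>I. x e * (of_bool (a e) - q e)\<bar>}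
      \<le> 2 * exp (- 2 * t\<^sup>2 / (\<Sum>e\<in>I. (x e)\<^sup>2))" if "0 \<le> t" for t
    using H.Hoeffding_ineq_abs_ge[OF that] X by simp
  from this[of "sqrt (\<alpha> * (\<Sum>e\<in>I. (x e)\<^sup>2))"]
  have "measure_pmf.prob ?M {a. sqrt (\<alpha> * (\<Sum>e\<in>I. (x e)\<^sup>2)) \<le> \<bar>\<Sum>e\<in>I. x e * (of_bool (a e) - q e)\<bar>}
      \<le> 2 * exp (- 2 * \<alpha>)" using \<alpha> X by simp
  moreover have "measure_pmf.prob ?M ?B
      \<le> measure_pmf.prob ?M {a. sqrt (\<alpha> * (\<Sum>e\<in>I. (x e)\<^sup>2)) \<le> \<bar>\<Sum>e\<in>I. x e * (of_bool (a e) - q e)\<bar>}"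
    by (intro measure_pmf.finite_measure_mono) auto
  ultimately show ?thesis by linarith
qed

subsection \<open>Concentration in the Bradley--Terry--Luce model\<close>

lemma finite_pairs: "finite (pairs n)"
  by (rule finite_subset[of _ "{..<n} \<times> {..<n}"]) (auto simp: pairs_def)

lemma adj_sym: "adj \<omega> i j = adj \<omega> j i"
  by (auto simp: adj_def)

lemma adj_01: "adj \<omega> i j = 0 \<or> adj \<omega> i j = 1"
  by (auto simp: adj_def)

lemma adj_bounds: "0 \<le> adj \<omega> i j" "adj \<omega> i j \<le> 1"
  by (auto simp: adj_def)

lemma adj_self [simp]: "adj \<omega> i i = 0"
  by (simp add: adj_def)

lemma adj_square: "(adj \<omega> i j)\<^sup>2 = adj \<omega> i j"
  using adj_01[of \<omega> i j] by auto

lemma sum_pairs: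
  fixes g :: "nat \<Rightarrow> nat \<Rightarrow> real"
  assumes sym: "\<And>j l. g j l = g l j" and diag: "\<And>j. g j j = 0"
  shows "(\<Sum>j<n. \<Sum>l<n. g j l) = 2 * (\<Sum>(j, l)\<in>pairs n. g j l)"
proof -
  let ?sw = "\<lambda>(j, l). (l, j) :: nat \<times> nat"
  have inj: "inj_on ?sw (pairs n)" by (auto simp: inj_on_def)
  have "(\<Sum>j<n. \<Sum>l<n. g j l) = (\<Sum>(j, l)\<in>{..<n} \<times> {..<n}. g j l)" by (rule sum.cartesian_product)
  also have "\<dots> = (\<Sum>(j, l)\<in>pairs n \<union> ?sw ` pairs n. g j l)"
    by (rule sum.mono_neutral_right) (auto simp: pairs_def image_iff not_less_iff_gr_or_eq diag)
  also have "\<dots> = (\<Sum>(j, l)\<in>pairs n. g j l) + (\<Sum>(j, l)\<in>?sw ` pairs n. g j l)"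
    using finite_pairs by (intro sum.union_disjoint) (auto simp: pairs_def)
  also have "(\<Sum>(j, l)\<in>?sw ` pairs n. g j l) = (\<Sum>(j, l)\<in>pairs n. g j l)"
    unfolding sum.reindex[OF inj] by (intro sum.cong) (auto simp: sym)
  finally show ?thesis by simp
qed

definition edge :: "nat \<Rightarrow> nat \<Rightarrow> nat \<times> nat" where
  "edge i j = (min i j, max i j)"

lemma adj_edge: "i \<noteq> j \<Longrightarrow> adj \<omega> i j = of_bool (fst \<omega> (edge i j))"
  by (auto simp: adj_def edge_def min_def max_def)

lemma edge_in_pairs: "i \<noteq> j \<Longrightarrow> i < n \<Longrightarrow> j < n \<Longrightarrow> edge i j \<in> pairs n"
  by (auto simp: edge_def pairs_def min_def max_def)

lemma inj_on_edge:
  assumes "S \<inter> T = {}" shows "inj_on (case_prod edge) (S \<times> T)"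
  using assms by (auto simp: inj_on_def edge_def min_def max_def split: if_splits)

definition noise :: "nat \<Rightarrow> (nat \<Rightarrow> real) \<Rightarrow> outcome \<Rightarrow> nat \<Rightarrow> nat \<Rightarrow> real" where
  "noise L \<theta> \<omega> i j = adj \<omega> i j * (ybar L \<omega> i j - psi (\<theta> i - \<theta> j))"

lemma noise_antisym: "noise L \<theta> \<omega> i j = - noise L \<theta> \<omega> j i"
proof (cases "i = j")
  case False
  have "psi (\<theta> j - \<theta> i) = 1 - psi (\<theta> i - \<theta> j)" using psi_minus[of "\<theta> i - \<theta> j"] by simp
  moreover have "ybar L \<omega> j i = 1 - ybar L \<omega> i j" using False by (auto simp: ybar_def)
  ultimately show ?thesis unfolding noise_def adj_sym[of \<omega> j i] by (simp only:) (simp add: algebra_simps)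
qed (simp add: noise_def)

lemma bvec_eq_sum_noise: "i < n \<Longrightarrow> bvec n L \<theta> \<omega> i = (\<Sum>j<n. noise L \<theta> \<omega> i j)"
  unfolding bvec_def noise_def by (intro sum.mono_neutral_left) auto

text \<open>Each average is a sum of \<open>L\<close> independent bits of weight 1/L, so the squared
  weights add up to the squared coefficients divided by \<open>L\<close>.\<close>

lemma hoeffding_ybar:
  fixes x :: "nat \<times> nat \<Rightarrow> real"
  assumes L: "1 \<le> L" and \<alpha>: "0 \<le> \<alpha>"
  shows "measure_pmf.prob (Pi_pmf {(i, j, l). i < j \<and> j < n \<and> l < L} False
                      (\<lambda>(i, j, l). bernoulli_pmf (psi (\<theta> i - \<theta> j))))
    {y. sqrt (\<alpha> * (\<Sum>e\<in>pairs n. (x e)\<^sup>2) / L)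
        < \<bar>\<Sum>(i, j)\<in>pairs n. x (i, j) * (ybar L (a, y) i j - psi (\<theta> i - \<theta> j))\<bar>} \<le> 2 * exp (- 2 * \<alpha>)"
proof -
  define T where "T = {(i, j, l). i < j \<and> j < n \<and> l < L}"
  define X where "X = (\<lambda>(i, j, l :: nat). x (i, j) / real L)"
  define q where "q = (\<lambda>(i, j, l :: nat). psi (\<theta> i - \<theta> j))"
  have sumT: "(\<Sum>e\<in>T. g e) = (\<Sum>(i, j)\<in>pairs n. \<Sum>l<L. g (i, j, l))" for g :: "nat \<times> nat \<times> nat \<Rightarrow> real"
  proof -
    have "(\<Sum>(i, j)\<in>pairs n. \<Sum>l<L. g (i, j, l)) = (\<Sum>e\<in>pairs n. \<Sum>l\<in>{..<L}. (\<lambda>((i, j), l). g (i, j, l)) (e, l))"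
      by (intro sum.cong) auto
    also have "\<dots> = (\<Sum>z\<in>pairs n \<times> {..<L}. (\<lambda>((i, j), l). g (i, j, l)) z)"
      by (simp add: sum.cartesian_product)
    also have "\<dots> = (\<Sum>e\<in>T. g e)"
      by (rule sum.reindex_bij_witness[of _ "\<lambda>(i, j, l). ((i, j), l)" "\<lambda>((i, j), l). (i, j, l)"])
        (auto simp: T_def pairs_def)
    finally show ?thesis by simp
  qed
  have finT: "finite T"
    by (rule finite_subset[of _ "{..<n} \<times> {..<n} \<times> {..<L}"]) (auto simp: T_def)
  have "measure_pmf.prob (Pi_pmf T False (\<lambda>e. bernoulli_pmf (q e)))
      {y. sqrt (\<alpha> * (\<Sum>e\<in>T. (X e)\<^sup>2)) < \<bar>\<Sum>e\<in>T. X e * (of_bool (y e) - q e)\<bar>} \<le> 2 * exp (- 2 * \<alpha>)"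
    by (rule hoeffding_bernoulli[OF finT _ _ \<alpha>]) (auto simp: q_def psi_bounds less_imp_le)
  moreover have "(\<Sum>e\<in>T. (X e)\<^sup>2) = (\<Sum>e\<in>pairs n. (x e)\<^sup>2) / L"
    using L by (simp add: sumT X_def power_divide sum_divide_distrib case_prod_unfold power2_eq_square)
  moreover have "(\<Sum>e\<in>T. X e * (of_bool (y e) - q e))
      = (\<Sum>(i, j)\<in>pairs n. x (i, j) * (ybar L (a, y) i j - psi (\<theta> i - \<theta> j)))" for y
    unfolding sumT
  proof (intro sum.cong refl, clarify)
    fix i j assume "(i, j) \<in> pairs n"
    then have ij: "i < j" by (simp add: pairs_def)
    have "(\<Sum>l<L. X (i, j, l) * (of_bool (y (i, j, l)) - q (i, j, l)))
        = x (i, j) / L * ((\<Sum>l<L. of_bool (y (i, j, l))) - real L * psi (\<theta> i - \<theta> j))"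
      by (simp add: X_def q_def sum_divide_distrib[symmetric] sum_distrib_left[symmetric] sum_subtractf)
    also have "\<dots> = x (i, j) * (ybar L (a, y) i j - psi (\<theta> i - \<theta> j))"
      using L ij by (simp add: ybar_def field_simps of_bool_def)
    finally show "(\<Sum>l<L. X (i, j, l) * (of_bool (y (i, j, l)) - q (i, j, l)))
        = x (i, j) * (ybar L (a, y) i j - psi (\<theta> i - \<theta> j))" .
  qed
  moreover have "(\<lambda>(i, j, l). bernoulli_pmf (psi (\<theta> i - \<theta> j))) = (\<lambda>e. bernoulli_pmf (q e))"
    by (auto simp: q_def)
  ultimately show ?thesis by (simp add: T_def)
qed

text \<open>Given the graph, \<open>v\<close> is a fixed vector and only the observations are
  random. Summation by parts writes the statistic as a sum over edges with coefficients
  \<open>v j - v l\<close>, whose squares add up to half the energy; hence Hoeffding's inequality is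
  governed by the energy of \<open>v\<close>.\<close>

lemma prob_linear_noise:
  fixes v :: "(nat \<times> nat \<Rightarrow> bool) \<Rightarrow> nat \<Rightarrow> real"
  assumes L: "1 \<le> L" and \<alpha>: "0 \<le> \<alpha>"
  shows "measure_pmf.prob (btl_pmf n p L \<theta>)
    {\<omega>. sqrt (\<alpha> * energy (adj \<omega>) {..<n} (v (fst \<omega>)) / (2 * L))
        < \<bar>\<Sum>j<n. v (fst \<omega>) j * bvec n L \<theta> \<omega> j\<bar>} \<le> 2 * exp (- 2 * \<alpha>)" (is "measure_pmf.prob _ ?B \<le> _")
  unfolding btl_pmf_def
proof (rule prob_pair_pmf_le)
  fix a
  define x where "x = (\<lambda>(j, l). adj (a, undefined) j l * (v a j - v a l))"
  \<comment> \<open>\<open>adj\<close> reads only the graph, so filling in \<open>undefined\<close>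
    for the observations is harmless.\<close>
  have adj_a: "adj (a, y) = adj (a, y')" for y y' by (intro ext) (simp add: adj_def)
  have E: "energy (adj (a, y)) {..<n} (v a) = 2 * (\<Sum>e\<in>pairs n. (x e)\<^sup>2)" for y
  proof -
    have "energy (adj (a, y)) {..<n} (v a) = 2 * (\<Sum>(j, l)\<in>pairs n. adj (a, y) j l * (v a j - v a l)\<^sup>2)"
      unfolding energy_def by (rule sum_pairs) (simp_all add: adj_sym power2_commute)
    also have "\<dots> = 2 * (\<Sum>e\<in>pairs n. (x e)\<^sup>2)"
      by (simp add: x_def power_mult_distrib case_prod_unfold adj_square adj_a[of y undefined])
    finally show ?thesis .
  qed
  have lin: "(\<Sum>j<n. v a j * bvec n L \<theta> (a, y) j)
      = (\<Sum>(i, j)\<in>pairs n. x (i, j) * (ybar L (a, y) i j - psi (\<theta> i - \<theta> j)))" for y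
  proof -
    have "(\<Sum>j<n. v a j * bvec n L \<theta> (a, y) j) = (\<Sum>j<n. v a j * (\<Sum>l<n. noise L \<theta> (a, y) j l))"
      by (intro sum.cong) (auto simp: bvec_eq_sum_noise)
    also have "\<dots> = (\<Sum>j<n. \<Sum>l<n. noise L \<theta> (a, y) j l * (v a j - v a l)) / 2"
      by (rule sum_by_parts) (rule noise_antisym)
    also have "(\<Sum>j<n. \<Sum>l<n. noise L \<theta> (a, y) j l * (v a j - v a l))
        = 2 * (\<Sum>(j, l)\<in>pairs n. noise L \<theta> (a, y) j l * (v a j - v a l))"
    proof (rule sum_pairs)
      fix j l
      show "noise L \<theta> (a, y) j l * (v a j - v a l) = noise L \<theta> (a, y) l j * (v a l - v a j)"
        using noise_antisym[of L \<theta> "(a, y)" j l] by (simp add: algebra_simps)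
    qed simp
    finally show ?thesis
      by (simp add: x_def noise_def case_prod_unfold adj_a[of y undefined] mult.commute mult.left_commute)
  qed
  show "measure_pmf.prob (Pi_pmf {(i, j, l). i < j \<and> j < n \<and> l < L} False
          (\<lambda>(i, j, l). bernoulli_pmf (psi (\<theta> i - \<theta> j))))
        {y. (a, y) \<in> ?B} \<le> 2 * exp (- 2 * \<alpha>)"
    using hoeffding_ybar[OF L \<alpha>, of n \<theta> x a] by (simp add: E lin)
qed

lemma prob_ybar_deviation:
  assumes L: "1 \<le> L" and \<alpha>: "0 \<le> \<alpha>" and e: "(i, j) \<in> pairs n"
  shows "measure_pmf.prob (btl_pmf n p L \<theta>)
    {\<omega>. sqrt (\<alpha> / L) < \<bar>ybar L \<omega> i j - psi (\<theta> i - \<theta> j)\<bar>} \<le> 2 * exp (- 2 * \<alpha>)" (is "measure_pmf.prob _ ?B \<le> _")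
  unfolding btl_pmf_def
proof (rule prob_pair_pmf_le)
  fix a
  define x where "x e = (of_bool (e = (i, j)) :: real)" for e
  have "(\<Sum>e\<in>pairs n. (x e)\<^sup>2) = (\<Sum>e\<in>pairs n. if e = (i, j) then 1 else 0)"
    by (intro sum.cong) (auto simp: x_def)
  then have s1: "(\<Sum>e\<in>pairs n. (x e)\<^sup>2) = 1" using e finite_pairs by simp
  have s2: "(\<Sum>(k, l)\<in>pairs n. x (k, l) * (ybar L (a, y) k l - psi (\<theta> k - \<theta> l)))
      = ybar L (a, y) i j - psi (\<theta> i - \<theta> j)" for y
  proof -
    have "(\<Sum>(k, l)\<in>pairs n. x (k, l) * (ybar L (a, y) k l - psi (\<theta> k - \<theta> l)))
      = (\<Sum>e\<in>pairs n. if e = (i, j) then ybar L (a, y) i j - psi (\<theta> i - \<theta> j) else 0)"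
      by (intro sum.cong) (auto simp: x_def)
    then show ?thesis using e finite_pairs by simp
  qed
  show "measure_pmf.prob (Pi_pmf {(i, j, l). i < j \<and> j < n \<and> l < L} False
          (\<lambda>(i, j, l). bernoulli_pmf (psi (\<theta> i - \<theta> j))))
        {y. (a, y) \<in> ?B} \<le> 2 * exp (- 2 * \<alpha>)"
    using hoeffding_ybar[OF L \<alpha>, of n \<theta> x a] by (simp add: s1 s2)
qed

text \<open>The pairs containing \<open>i\<close> are split off as an independent factor.
  Conditionally on the other pairs and on all observations the coefficients \<open>f\<close> are
  constants, and Bernstein's inequality applies to the remaining randomness.\<close>

lemma prob_row_bernstein:
  fixes f :: "outcome \<Rightarrow> nat \<Rightarrow> real"
  assumes p: "0 \<le> p" "p \<le> 1" and \<alpha>: "0 < \<alpha>" and i: "i < n"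
    and indep: "\<And>a a' y. (\<And>j l. j \<noteq> i \<Longrightarrow> l \<noteq> i \<Longrightarrow> a (j, l) = a' (j, l)) \<Longrightarrow> f (a, y) = f (a', y)"
  shows "measure_pmf.prob (btl_pmf n p L \<theta>)
    {\<omega>. \<exists>m\<ge>0. (\<forall>j\<in>{..<n} - {i}. \<bar>f \<omega> j\<bar> \<le> m) \<and>
        2 * sqrt (\<alpha> * p * (\<Sum>j\<in>{..<n} - {i}. (f \<omega> j)\<^sup>2)) + 2 * \<alpha> * m
        < \<bar>\<Sum>j\<in>{..<n} - {i}. (adj \<omega> i j - p) * f \<omega> j\<bar>} \<le> 2 * exp (- \<alpha>)"
    (is "measure_pmf.prob _ ?B \<le> _")
  unfolding btl_pmf_def
proof (rule prob_pair_pmf_le')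
  fix y
  define J where "J = {..<n} - {i}"
  define R where "R = edge i ` J"
  have injR: "inj_on (edge i) J" by (auto simp: inj_on_def edge_def J_def min_def max_def split: if_splits)
  have RP: "R \<subseteq> pairs n" using i by (auto simp: R_def J_def intro: edge_in_pairs)
  have finR: "finite R" by (simp add: R_def J_def)
  have notR: "(j, l) \<notin> R" if "j \<noteq> i" "l \<noteq> i" for j l
    using that by (auto simp: R_def edge_def min_def max_def split: if_splits)
  have sumR: "(\<Sum>e\<in>R. g e) = (\<Sum>j\<in>J. g (edge i j))" for g :: "nat \<times> nat \<Rightarrow> real"
    unfolding R_def by (simp add: sum.reindex[OF injR])
  have un: "pairs n = R \<union> (pairs n - R)" using RP by blast
  have split: "Pi_pmf (pairs n) False (\<lambda>_. bernoulli_pmf p) =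
      map_pmf (\<lambda>(r, g) x. if x \<in> R then r x else g x)
        (pair_pmf (Pi_pmf R False (\<lambda>_. bernoulli_pmf p)) (Pi_pmf (pairs n - R) False (\<lambda>_. bernoulli_pmf p)))"
    by (subst un, rule Pi_pmf_union) (auto simp: finR finite_pairs)
  show "measure_pmf.prob (Pi_pmf (pairs n) False (\<lambda>_. bernoulli_pmf p)) {a. (a, y) \<in> ?B} \<le> 2 * exp (- \<alpha>)"
    unfolding split measure_map_pmf
  proof (rule prob_pair_pmf_le')
    fix g
    define F where "F j = f (g, y) j" for j
    \<comment> \<open>Coefficients are moved from vertices to edges at \<open>i\<close>: an edge
      receives the value at its endpoint other than \<open>i\<close>.\<close>
    define F' where "F' e = F (if fst e = i then snd e else fst e)" for e
    have F': "F' (edge i j) = F j" if "j \<in> J" for j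
      using that by (auto simp: F'_def edge_def J_def min_def max_def)
    have comb: "f (\<lambda>x. if x \<in> R then r x else g x, y) = F" for r
      unfolding F_def by (rule indep) (simp add: notR)
    have adjr: "adj (\<lambda>x. if x \<in> R then r x else g x, y) i j = of_bool (r (edge i j))" if "j \<in> J" for r j
      using that by (simp add: adj_edge J_def R_def)
    have "measure_pmf.prob (Pi_pmf R False (\<lambda>_. bernoulli_pmf p))
        {r. \<exists>m\<ge>0. (\<forall>e\<in>R. \<bar>F' e\<bar> \<le> m) \<and>
        2 * sqrt (\<alpha> * p * (\<Sum>e\<in>R. (F' e)\<^sup>2)) + 2 * \<alpha> * m < \<bar>\<Sum>e\<in>R. (of_bool (r e) - p) * F' e\<bar>} \<le> 2 * exp (- \<alpha>)"
      by (rule bernstein[OF finR p \<alpha>])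
    moreover have "(\<forall>e\<in>R. \<bar>F' e\<bar> \<le> m) \<longleftrightarrow> (\<forall>j\<in>J. \<bar>F j\<bar> \<le> m)" for m
      unfolding R_def using F' by auto
    moreover have "(\<Sum>e\<in>R. (F' e)\<^sup>2) = (\<Sum>j\<in>J. (F j)\<^sup>2)" by (simp add: sumR F')
    moreover have "(\<Sum>e\<in>R. (of_bool (r e) - p) * F' e) = (\<Sum>j\<in>J. (of_bool (r (edge i j)) - p) * F j)" for r
      by (simp add: sumR F')
    ultimately show "measure_pmf.prob (Pi_pmf R False (\<lambda>_. bernoulli_pmf p))
        {r. (r, g) \<in> (\<lambda>(r, g) x. if x \<in> R then r x else g x) -` {a. (a, y) \<in> ?B}} \<le> 2 * exp (- \<alpha>)"
      by (simp add: comb J_def[symmetric] adjr)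
  qed
qed

text \<open>Since \<open>S\<close> and \<open>T\<close> are disjoint, each pair between them is
  counted once and the log moment generating functions add. Leaving the sign of \<open>s\<close>
  open covers both tails: \<open>s = 1\<close> for degrees and \<open>s = - 1\<close> for
  cuts.\<close>

lemma prob_cross_edges:
  assumes p: "0 \<le> p" "p \<le> 1" and S: "S \<subseteq> {..<n}" and T: "T \<subseteq> {..<n}" and ST: "S \<inter> T = {}"
    and k: "p * exp s + (1 - p) \<le> exp k"
  shows "measure_pmf.prob (btl_pmf n p L \<theta>) {\<omega>. t \<le> s * (\<Sum>j\<in>S. \<Sum>l\<in>T. adj \<omega> j l)}
    \<le> exp (k * (real (card S) * real (card T)) - t)" (is "measure_pmf.prob _ ?B \<le> _")
  unfolding btl_pmf_def
proof (rule prob_pair_pmf_le')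
  fix y
  define C where "C = case_prod edge ` (S \<times> T)"
  have injC: "inj_on (case_prod edge) (S \<times> T)" using ST by (rule inj_on_edge)
  have CP: "C \<subseteq> pairs n" using S T ST by (auto simp: C_def intro!: edge_in_pairs)
  have cardC: "real (card C) = real (card S) * real (card T)"
    by (simp add: C_def card_image[OF injC] card_cartesian_product)
  have sum_adj: "s * (\<Sum>j\<in>S. \<Sum>l\<in>T. adj (a, y) j l) = (\<Sum>e\<in>pairs n. s * of_bool (e \<in> C \<and> a e))" for a
  proof -
    have "(\<Sum>j\<in>S. \<Sum>l\<in>T. adj (a, y) j l) = (\<Sum>j\<in>S. \<Sum>l\<in>T. of_bool (a (edge j l)))"
      using ST by (intro sum.cong refl adj_edge[of _ _ "(a, y)", simplified]) auto
    also have "\<dots> = (\<Sum>e\<in>C. of_bool (a e))"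
      unfolding C_def sum.reindex[OF injC] sum.cartesian_product by (intro sum.cong) auto
    also have "\<dots> = (\<Sum>e\<in>pairs n. of_bool (e \<in> C \<and> a e))"
      by (rule sum.mono_neutral_cong_left) (use CP finite_pairs in auto)
    finally show ?thesis by (simp add: sum_distrib_left)
  qed
  have "measure_pmf.prob (Pi_pmf (pairs n) False (\<lambda>_. bernoulli_pmf p))
      {a. t \<le> (\<Sum>e\<in>pairs n. s * of_bool (e \<in> C \<and> a e))} \<le> exp ((\<Sum>e\<in>pairs n. k * of_bool (e \<in> C)) - t)"
  proof (rule prob_exp_markov[OF finite_pairs])
    show "measure_pmf.expectation (bernoulli_pmf p) (\<lambda>v. exp (s * of_bool (e \<in> C \<and> v))) \<le> exp (k * of_bool (e \<in> C))" for e
      using p k by (simp add: integral_bernoulli_pmf mult.commute)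
  qed
  also have "(\<Sum>e\<in>pairs n. k * of_bool (e \<in> C)) = k * (real (card S) * real (card T))"
  proof -
    have "(\<Sum>e\<in>pairs n. of_bool (e \<in> C)) = (\<Sum>e\<in>C. 1 :: real)"
      by (rule sum.mono_neutral_cong_right) (use CP finite_pairs in auto)
    then show ?thesis by (simp only: sum_distrib_left[symmetric]) (simp add: cardC)
  qed
  finally show "measure_pmf.prob (Pi_pmf (pairs n) False (\<lambda>_. bernoulli_pmf p)) {a. (a, y) \<in> ?B}
      \<le> exp (k * (real (card S) * real (card T)) - t)" by (simp add: sum_adj)
qed

lemma prob_degree:
  assumes p: "0 \<le> p" "p \<le> 1" and i: "i < n"
  shows "measure_pmf.prob (btl_pmf n p L \<theta>) {\<omega>. 4 * (n * p) < (\<Sum>j<n. adj \<omega> i j)} \<le> exp (- 2 * (n * p))"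
    (is "measure_pmf.prob ?M ?B \<le> _")
proof -
  \<comment> \<open>With \<open>exp 1 \<le> 3\<close> the rate is \<open>2 * p\<close>, so the
    threshold 4 n p leaves an exponent of at most -2 n p.\<close>
  have "p * exp 1 + (1 - p) \<le> 1 + 2 * p" using mult_left_mono[OF exp_le p(1)] by simp
  also have "\<dots> \<le> exp (2 * p)" by (rule exp_ge_add_one_self)
  finally have k: "p * exp 1 + (1 - p) \<le> exp (2 * p)" .
  have "(\<Sum>j<n. adj \<omega> i j) = (\<Sum>j\<in>{..<n} - {i}. adj \<omega> i j)" for \<omega>
    by (intro sum.mono_neutral_right) auto
  then have "measure_pmf.prob ?M ?B \<le> measure_pmf.prob ?M {\<omega>. 4 * (n * p) \<le> 1 * (\<Sum>j\<in>{i}. \<Sum>l\<in>{..<n} - {i}. adj \<omega> j l)}"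
    by (intro measure_pmf.finite_measure_mono) auto
  also have "\<dots> \<le> exp (2 * p * (real (card {i}) * real (card ({..<n} - {i}))) - 4 * (n * p))"
    by (rule prob_cross_edges[OF p _ _ _ k]) (use i in auto)
  also have "\<dots> \<le> exp (- 2 * (n * p))"
  proof -
    have "p * real (n - 1) \<le> p * n" using p by (intro mult_left_mono) auto
    then show ?thesis using i by (simp add: mult.commute)
  qed
  finally show ?thesis .
qed

text \<open>As \<open>S\<close> has at most n/2 elements, the mean cut \<open>m\<close> is at least
  n p |S| / 2, so the event lies below a quarter of the mean. The resulting bound is geometric in
  the size of \<open>S\<close>, as summation over all sets requires.\<close>

lemma prob_single_cut:
  assumes p: "0 \<le> p" "p \<le> 1" and S: "S \<subseteq> {..<n}" "2 * card S \<le> n"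
  shows "measure_pmf.prob (btl_pmf n p L \<theta>)
    {\<omega>. (\<Sum>j\<in>S. \<Sum>l\<in>{..<n} - S. adj \<omega> j l) < n * p / 8 * card S} \<le> exp (- (n * p / 8)) ^ card S"
    (is "measure_pmf.prob ?M ?B \<le> _")
proof -
  have finS: "finite S" using S finite_subset by blast
  have card: "real (card ({..<n} - S)) = real n - real (card S)"
    using S finS by (simp add: card_Diff_subset of_nat_diff)
  define m where "m = p * (real (card S) * real (card ({..<n} - S)))"
  have m: "n * p / 8 * card S \<le> m / 4"
  proof -
    have "real n / 2 \<le> real (card ({..<n} - S))" using S(2) card by linarith
    then have "p * card S * (real n / 2) \<le> p * card S * real (card ({..<n} - S))" using p by (intro mult_left_mono) auto
    then show ?thesis by (simp add: m_def ac_simps)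
  qed
  have "(2::real) \<le> exp 1" using exp_ge_add_one_self[of 1] by simp
  then have "exp (- 1 :: real) \<le> 1 / 2" by (simp add: exp_minus field_simps)
  then have "p * exp (- 1) + (1 - p) \<le> 1 + - (p / 2)" using mult_left_mono[of "exp (- 1)" "1/2" p] p by simp
  also have "\<dots> \<le> exp (- (p / 2))" by (rule exp_ge_add_one_self)
  finally have k: "p * exp (- 1) + (1 - p) \<le> exp (- (p / 2))" .
  have "measure_pmf.prob ?M ?B \<le> measure_pmf.prob ?M {\<omega>. - (m / 4) \<le> - 1 * (\<Sum>j\<in>S. \<Sum>l\<in>{..<n} - S. adj \<omega> j l)}"
    by (rule measure_pmf.finite_measure_mono, rule subsetI, unfold mem_Collect_eq) (use m in linarith, simp)
  also have "\<dots> \<le> exp (- (p / 2) * (real (card S) * real (card ({..<n} - S))) - - (m / 4))"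
    by (rule prob_cross_edges[OF p _ _ _ k]) (use S in auto)
  also have "\<dots> \<le> exp (real (card S) * (- (n * p / 8)))" using m by (simp add: m_def ac_simps)
  also have "\<dots> = exp (- (n * p / 8)) ^ card S" by (rule exp_of_nat_mult)
  finally show ?thesis .
qed

text \<open>By the binomial theorem the union bound over nonempty sets is (1 + x)^n - 1, which is at
  most exp (n x) - 1 and hence at most 2 n x when n x is at most 1.\<close>

lemma prob_cuts:
  assumes p: "0 \<le> p" "p \<le> 1" and x: "n * exp (- (n * p / 8)) \<le> 1"
  shows "measure_pmf.prob (btl_pmf n p L \<theta>)
    {\<omega>. \<exists>S\<subseteq>{..<n}. S \<noteq> {} \<and> 2 * card S \<le> n \<and> (\<Sum>j\<in>S. \<Sum>l\<in>{..<n} - S. adj \<omega> j l) < n * p / 8 * card S}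
    \<le> 2 * n * exp (- (n * p / 8))"
proof -
  define x where "x = exp (- (n * p / 8))"
  define \<S> where "\<S> = {S. S \<subseteq> {..<n} \<and> S \<noteq> {} \<and> 2 * card S \<le> n}"
  have fin: "finite \<S>" by (rule finite_subset[of _ "Pow {..<n}"]) (auto simp: \<S>_def)
  let ?B = "\<lambda>S. {\<omega>. (\<Sum>j\<in>S. \<Sum>l\<in>{..<n} - S. adj \<omega> j l) < n * p / 8 * card S}"
  have "measure_pmf.prob (btl_pmf n p L \<theta>) (\<Union>S\<in>\<S>. ?B S) \<le> (\<Sum>S\<in>\<S>. measure_pmf.prob (btl_pmf n p L \<theta>) (?B S))"
    using fin by (intro measure_pmf.finite_measure_subadditive_finite) auto
  also have "\<dots> \<le> (\<Sum>S\<in>\<S>. x ^ card S)"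
    unfolding x_def by (intro sum_mono prob_single_cut[OF p]) (auto simp: \<S>_def)
  also have "\<dots> \<le> (\<Sum>S\<in>Pow {..<n} - {{}}. x ^ card S)"
    by (intro sum_mono2) (auto simp: \<S>_def x_def)
  also have "\<dots> = (\<Sum>S\<in>Pow {..<n}. x ^ card S) - 1" by (subst sum_diff1) auto
  also have "(\<Sum>S\<in>Pow {..<n}. x ^ card S) = (1 + x) ^ n"
    using prod_add[of "{..<n}" "\<lambda>_. x" "\<lambda>_. 1"] by (simp add: add.commute)
  also have "(1 + x) ^ n \<le> exp x ^ n" by (intro power_mono exp_ge_add_one_self) (simp add: x_def)
  also have "\<dots> = exp (n * x)" by (rule exp_of_nat_mult[symmetric])
  also have "\<dots> \<le> 1 + n * x + (n * x)\<^sup>2"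
    using x by (intro exp_bound) (auto simp: x_def)
  also have "(n * x)\<^sup>2 \<le> n * x"
    using x mult_left_le_one_le[of "n * x" "n * x"] by (simp add: x_def power2_eq_square)
  finally have "measure_pmf.prob (btl_pmf n p L \<theta>) (\<Union>S\<in>\<S>. ?B S) \<le> 2 * n * x" by linarith
  moreover have "(\<Union>S\<in>\<S>. ?B S) = {\<omega>. \<exists>S\<subseteq>{..<n}. S \<noteq> {} \<and> 2 * card S \<le> n \<and>
      (\<Sum>j\<in>S. \<Sum>l\<in>{..<n} - S. adj \<omega> j l) < n * p / 8 * card S}" by (auto simp: \<S>_def)
  ultimately show ?thesis by (simp only: x_def)
qed

subsection \<open>Linearised score equation and leave-one-out estimators\<close>

text \<open>The link recentred at the true parameter: the unknown of the edge system is then the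
  estimation error and its right-hand side is the noise vector.\<close>

definition phi :: "real \<Rightarrow> (nat \<Rightarrow> real) \<Rightarrow> nat \<Rightarrow> nat \<Rightarrow> real \<Rightarrow> real" where
  "phi R \<theta> j l t = psi_lin R (\<theta> j - \<theta> l + t) - psi_lin R (\<theta> j - \<theta> l)"

text \<open>The maximum only matters for indices outside \<open>{..<n}\<close>; it makes the lower bound unconditional.\<close>

definition wgt :: "real \<Rightarrow> (nat \<Rightarrow> real) \<Rightarrow> nat \<Rightarrow> nat \<Rightarrow> real" where
  "wgt R \<theta> j l = max (psi' R) (psi' (\<theta> j - \<theta> l))"

lemma wgt_bounds: "psi' R \<le> wgt R \<theta> j l" "wgt R \<theta> j l \<le> 1"
  using psi'_le[of R] psi'_le[of "\<theta> j - \<theta> l"] by (auto simp: wgt_def)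

lemma wgt_sym: "wgt R \<theta> j l = wgt R \<theta> l j"
  using psi'_minus[of "\<theta> j - \<theta> l"] by (simp add: wgt_def)

lemma wgt_eq: "\<bar>\<theta> j - \<theta> l\<bar> \<le> R \<Longrightarrow> wgt R \<theta> j l = psi' (\<theta> j - \<theta> l)"
  using psi'_antimono by (simp add: wgt_def max_def)

lemma edge_system_phi:
  assumes "finite V" "0 \<le> R" shows "edge_system V (adj \<omega>) (phi R \<theta>) (psi' R)"
proof
  fix j l and s t :: real
  show "phi R \<theta> j l (- t) = - phi R \<theta> l j t"
    using psi_lin_minus[OF assms(2), of "\<theta> j - \<theta> l - t"] psi_lin_minus[OF assms(2), of "\<theta> j - \<theta> l"]
    by (simp add: phi_def algebra_simps)
  assume "s \<le> t"
  then show "psi' R * (t - s) \<le> phi R \<theta> j l t - phi R \<theta> j l s" "phi R \<theta> j l t - phi R \<theta> j l s \<le> t - s"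
    using psi_lin_slope[OF assms(2), of "\<theta> j - \<theta> l + s" "\<theta> j - \<theta> l + t"] by (simp_all add: phi_def)
qed (use assms adj_bounds adj_sym psi'_pos in auto)

lemma edge_system_wgt:
  assumes "finite V" shows "edge_system V (adj \<omega>) (\<lambda>j l t. wgt R \<theta> j l * t) (psi' R)"
proof
  fix j l and s t :: real
  show "wgt R \<theta> j l * - t = - (wgt R \<theta> l j * t)" using wgt_sym[of R \<theta> j l] by simp
  assume "s \<le> t"
  then have "psi' R * (t - s) \<le> wgt R \<theta> j l * (t - s)" "wgt R \<theta> j l * (t - s) \<le> 1 * (t - s)"
    using wgt_bounds[of R \<theta> j l] by (intro mult_right_mono; simp)+
  then show "psi' R * (t - s) \<le> wgt R \<theta> j l * t - wgt R \<theta> j l * s" "wgt R \<theta> j l * t - wgt R \<theta> j l * s \<le> t - s"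
    by (simp_all add: algebra_simps)
qed (use assms adj_bounds adj_sym psi'_pos in auto)

text \<open>By choice this is a function of the data away from \<open>i\<close> whether or not the
  equation is solvable. Independence of row \<open>i\<close> thus holds for every outcome, although
  solvability is shown only on the good event.\<close>

definition loo :: "nat \<Rightarrow> nat \<Rightarrow> (nat \<Rightarrow> real) \<Rightarrow> real \<Rightarrow> nat \<Rightarrow> outcome \<Rightarrow> nat \<Rightarrow> real" where
  "loo n L \<theta> R i \<omega> = (SOME d. (\<Sum>j\<in>{..<n} - {i}. d j) = 0 \<and>
     (\<forall>j\<in>{..<n} - {i}. (\<Sum>l\<in>{..<n} - {i}. adj \<omega> j l * phi R \<theta> j l (d j - d l))
        = (\<Sum>l\<in>{..<n} - {i}. noise L \<theta> \<omega> j l)))"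

text \<open>The observations \<open>\<lambda>_. False\<close> are a filler, as \<open>adj\<close>
  reads the graph alone; depending on nothing else makes this vector admissible in
  \<open>prob_linear_noise\<close>. The row of weights is centred because every flow sums to
  zero.\<close>

definition potential :: "nat \<Rightarrow> (nat \<Rightarrow> real) \<Rightarrow> real \<Rightarrow> nat \<Rightarrow> (nat \<times> nat \<Rightarrow> bool) \<Rightarrow> nat \<Rightarrow> real" where
  "potential n \<theta> R i a = (SOME h. (\<Sum>j<n. h j) = 0 \<and>
     (\<forall>j<n. (\<Sum>l<n. adj (a, \<lambda>_. False) j l * (wgt R \<theta> j l * (h j - h l)))
        = wgt R \<theta> i j - (\<Sum>k<n. wgt R \<theta> i k) / n))"

text \<open>The defining equations mention only pairs avoiding \<open>i\<close>, so the two
  predicates under the choice operator coincide.\<close>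

lemma loo_indep:
  assumes "\<And>j l. j \<noteq> i \<Longrightarrow> l \<noteq> i \<Longrightarrow> a (j, l) = a' (j, l)"
  shows "loo n L \<theta> R i (a, y) = loo n L \<theta> R i (a', y)"
proof -
  have "adj (a, y) j l = adj (a', y) j l" if "j \<noteq> i" "l \<noteq> i" for j l
    using assms that by (simp add: adj_def)
  moreover have "ybar L (a, y) = ybar L (a', y)" by (intro ext) (simp add: ybar_def)
  ultimately show ?thesis unfolding loo_def noise_def by (intro arg_cong[where f = Eps] ext) simp
qed

text \<open>All that chance contributes, stated for a single outcome. The margin 1 in
  \<open>theta\<close> keeps differences perturbed by at most 1 where the link is unmodified. The
  level \<open>12 * ln n\<close> gives failure probabilities of order at most n^-12, to be summed
  over at most n^2 events; the level \<open>n\<close> in \<open>lin_signs\<close> pays for the 2^n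
  sign patterns.\<close>

locale btl_good =
  fixes n :: nat and p :: real and L :: nat and \<theta> :: "nat \<Rightarrow> real" and R :: real and \<omega> :: outcome
  assumes n2: "2 \<le> n" and p_pos: "0 < p" and p_le: "p \<le> 1" and L: "1 \<le> L" and R: "0 \<le> R"
    and theta: "\<And>j l. j < n \<Longrightarrow> l < n \<Longrightarrow> \<bar>\<theta> j - \<theta> l\<bar> \<le> R - 1"
    and cut: "\<And>S. S \<subseteq> {..<n} \<Longrightarrow> S \<noteq> {} \<Longrightarrow> 2 * card S \<le> n \<Longrightarrow>
      n * p / 8 * card S \<le> (\<Sum>j\<in>S. \<Sum>l\<in>{..<n} - S. adj \<omega> j l)"
    and deg_le: "\<And>i. i < n \<Longrightarrow> (\<Sum>j<n. adj \<omega> i j) \<le> 4 * (n * p)"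
    and ybar_dev: "\<And>j l. (j, l) \<in> pairs n \<Longrightarrow> \<bar>ybar L \<omega> j l - psi (\<theta> j - \<theta> l)\<bar> \<le> sqrt (12 * ln n / L)"
    and lin_unit: "\<And>i. i < n \<Longrightarrow> \<bar>\<Sum>j<n. of_bool (j = i) * bvec n L \<theta> \<omega> j\<bar>
      \<le> sqrt (12 * ln n * energy (adj \<omega>) {..<n} (\<lambda>j. of_bool (j = i)) / (2 * L))"
    and lin_potential: "\<And>i. i < n \<Longrightarrow> \<bar>\<Sum>j<n. potential n \<theta> R i (fst \<omega>) j * bvec n L \<theta> \<omega> j\<bar>
      \<le> sqrt (12 * ln n * energy (adj \<omega>) {..<n} (potential n \<theta> R i (fst \<omega>)) / (2 * L))"
    and lin_signs: "\<And>S. S \<subseteq> {..<n} \<Longrightarrow> \<bar>\<Sum>j<n. (if j \<in> S then 1 else - 1) * bvec n L \<theta> \<omega> j\<bar>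
      \<le> sqrt (n * energy (adj \<omega>) {..<n} (\<lambda>j. if j \<in> S then 1 else - 1) / (2 * L))"
    and bernstein_sq: "\<And>i m. i < n \<Longrightarrow> 0 \<le> m \<Longrightarrow> (\<forall>j\<in>{..<n} - {i}. \<bar>(loo n L \<theta> R i \<omega> j)\<^sup>2\<bar> \<le> m) \<Longrightarrow>
      \<bar>\<Sum>j\<in>{..<n} - {i}. (adj \<omega> i j - p) * (loo n L \<theta> R i \<omega> j)\<^sup>2\<bar>
      \<le> 2 * sqrt (12 * ln n * p * (\<Sum>j\<in>{..<n} - {i}. ((loo n L \<theta> R i \<omega> j)\<^sup>2)\<^sup>2)) + 2 * (12 * ln n) * m"
    and bernstein_lin: "\<And>i m. i < n \<Longrightarrow> 0 \<le> m \<Longrightarrow>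
        (\<forall>j\<in>{..<n} - {i}. \<bar>wgt R \<theta> i j * loo n L \<theta> R i \<omega> j\<bar> \<le> m) \<Longrightarrow>
      \<bar>\<Sum>j\<in>{..<n} - {i}. (adj \<omega> i j - p) * (wgt R \<theta> i j * loo n L \<theta> R i \<omega> j)\<bar>
      \<le> 2 * sqrt (12 * ln n * p * (\<Sum>j\<in>{..<n} - {i}. (wgt R \<theta> i j * loo n L \<theta> R i \<omega> j)\<^sup>2)) + 2 * (12 * ln n) * m"
    and P_ge: "1024 \<le> n * p" and ln_ge: "1 \<le> ln n"
begin

section \<open>Spectral gap, degrees and size of the noise on the good event\<close>

abbreviation "A \<equiv> adj \<omega>"
abbreviation "b \<equiv> bvec n L \<theta> \<omega>"
abbreviation "c \<equiv> psi' R"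
abbreviation "P \<equiv> real n * p"
abbreviation "\<l> \<equiv> ln (real n)"
abbreviation "\<D> i \<equiv> loo n L \<theta> R i \<omega>"

sublocale S: edge_system "{..<n}" "adj \<omega>" "phi R \<theta>" "psi' R"
  by (rule edge_system_phi) (simp_all add: R)

sublocale W: edge_system "{..<n}" "adj \<omega>" "\<lambda>j l t. wgt R \<theta> j l * t" "psi' R"
  by (rule edge_system_wgt) simp

lemma c_bounds: "0 < c" "c \<le> 1"
  using psi'_pos[of R] psi'_le[of R] by auto

lemma P_pos: "0 < P" using P_ge by simp

lemma P_le_n: "P \<le> n" using p_le p_pos by (simp add: mult_left_le)

text \<open>Cheeger's inequality with expansion P/8 and degrees at most 4P: the gap is (P/8)^2 /
  (4P).\<close>

lemma gap: "(\<Sum>j<n. u j) = 0 \<Longrightarrow> P / 256 * (\<Sum>j<n. (u j)\<^sup>2) \<le> energy A {..<n} u"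
proof -
  assume u: "(\<Sum>j<n. u j) = 0"
  have "(P / 8)\<^sup>2 * (\<Sum>j<n. (u j)\<^sup>2) \<le> 4 * P * energy A {..<n} u"
  proof (rule cheeger_gap)
    show "P / 8 * real (card S) \<le> (\<Sum>j\<in>S. \<Sum>l\<in>{..<n} - S. A j l)"
      if "S \<subseteq> {..<n}" "S \<noteq> {}" "2 * card S \<le> card {..<n}" for S using cut that by simp
    show "(\<Sum>l<n. A j l) \<le> 4 * P" if "j \<in> {..<n}" for j using deg_le that by simp
  qed (use P_pos u in \<open>auto simp: adj_bounds adj_sym\<close>)
  then have "P * (P / 256 * (\<Sum>j<n. (u j)\<^sup>2)) \<le> P * energy A {..<n} u"
    by (simp add: power2_eq_square algebra_simps)
  then show ?thesis using P_pos by (simp only: mult_le_cancel_left_pos)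
qed

lemma energy_remove:
  assumes i: "i < n" and ui: "u i = 0"
  shows "energy A {..<n} u = energy A ({..<n} - {i}) u + 2 * (\<Sum>j\<in>{..<n} - {i}. A i j * (u j)\<^sup>2)"
proof -
  have ins: "sum g {..<n} = g i + sum g ({..<n} - {i})" for g :: "nat \<Rightarrow> real"
    using i by (intro sum.remove) auto
  have "(\<Sum>j\<in>{..<n} - {i}. A j i * (u j)\<^sup>2) = (\<Sum>j\<in>{..<n} - {i}. A i j * (u j)\<^sup>2)"
    by (simp add: adj_sym)
  then show ?thesis unfolding energy_def by (simp add: ins ui sum.distrib)
qed

lemma energy_shift: "energy A V (\<lambda>j. u j - x) = energy A V u"
  by (simp add: energy_def)

text \<open>Extending \<open>u\<close> by 0 at \<open>i\<close> preserves the zero sum, and the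
  edges at \<open>i\<close> add at most twice the squared norm to the energy. Since \<open>P\<close>
  is at least 1024, this loss is at most half of the gap P/256.\<close>

lemma gap_loo:
  assumes i: "i < n" and u: "(\<Sum>j\<in>{..<n} - {i}. u j) = 0"
  shows "P / 512 * (\<Sum>j\<in>{..<n} - {i}. (u j)\<^sup>2) \<le> energy A ({..<n} - {i}) u"
proof -
  define v where "v j = (if j = i then 0 else u j)" for j
  have eqE: "energy A ({..<n} - {i}) v = energy A ({..<n} - {i}) u"
    unfolding energy_def by (intro sum.cong) (auto simp: v_def)
  have ins: "sum g {..<n} = g i + sum g ({..<n} - {i})" for g :: "nat \<Rightarrow> real"
    using i by (intro sum.remove) auto
  have cong: "(\<Sum>j\<in>{..<n} - {i}. g j (v j)) = (\<Sum>j\<in>{..<n} - {i}. g j (u j))" for g :: "nat \<Rightarrow> real \<Rightarrow> real"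
    by (intro sum.cong) (auto simp: v_def)
  define U where "U = (\<Sum>j\<in>{..<n} - {i}. (u j)\<^sup>2)"
  have "(\<Sum>j<n. v j) = 0" unfolding ins using u cong[of "\<lambda>_ x. x"] by (simp add: v_def)
  then have "P / 256 * (\<Sum>j<n. (v j)\<^sup>2) \<le> energy A {..<n} v" by (rule gap)
  moreover have "(\<Sum>j<n. (v j)\<^sup>2) = U" unfolding ins U_def using cong[of "\<lambda>_ x. x\<^sup>2"] by (simp add: v_def)
  moreover have "(\<Sum>j\<in>{..<n} - {i}. A i j * (v j)\<^sup>2) \<le> U"
    unfolding cong[of "\<lambda>j x. A i j * x\<^sup>2"] U_def by (intro sum_mono) (simp add: mult_left_le_one_le adj_bounds)
  moreover have "energy A {..<n} v = energy A ({..<n} - {i}) v + 2 * (\<Sum>j\<in>{..<n} - {i}. A i j * (v j)\<^sup>2)"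
    by (rule energy_remove[OF i]) (simp add: v_def)
  ultimately have "P / 256 * U \<le> energy A ({..<n} - {i}) u + 2 * U" using eqE by simp
  moreover have "4 * U \<le> P / 256 * U" using P_ge by (intro mult_right_mono) (auto simp: U_def sum_nonneg)
  ultimately show ?thesis by (simp add: U_def)
qed

text \<open>A singleton is an admissible cut, because \<open>n\<close> is at least 2.\<close>

lemma deg_ge: "i < n \<Longrightarrow> P / 8 \<le> (\<Sum>j<n. A i j)"
proof -
  assume i: "i < n"
  have "P / 8 \<le> (\<Sum>l\<in>{..<n} - {i}. A i l)" using cut[of "{i}"] i n2 by simp
  also have "\<dots> = (\<Sum>j<n. A i j)" by (intro sum.mono_neutral_left) auto
  finally show ?thesis .
qed

lemma noise_sq_le: "j < n \<Longrightarrow> l < n \<Longrightarrow> (noise L \<theta> \<omega> j l)\<^sup>2 \<le> A j l * (12 * \<l> / L)"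
proof -
  have less: "(noise L \<theta> \<omega> j l)\<^sup>2 \<le> A j l * (12 * \<l> / L)" if "j < l" "l < n" for j l
  proof -
    have "\<bar>ybar L \<omega> j l - psi (\<theta> j - \<theta> l)\<bar>\<^sup>2 \<le> (sqrt (12 * \<l> / L))\<^sup>2"
      using that by (intro power_mono ybar_dev) (auto simp: pairs_def)
    also have "\<dots> = 12 * \<l> / L" using ln_ge by simp
    finally have "(ybar L \<omega> j l - psi (\<theta> j - \<theta> l))\<^sup>2 \<le> 12 * \<l> / L" by simp
    then show ?thesis unfolding noise_def power_mult_distrib adj_square by (intro mult_left_mono adj_bounds)
  qed
  assume "j < n" "l < n"
  then consider "j < l" | "l < j" | "j = l" by linarith
  then show ?thesis
  proof cases
    case 2
    then show ?thesis using less[of l j] noise_antisym[of L \<theta> \<omega> j l] adj_sym[of \<omega> j l] \<open>j < n\<close> by simp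
  qed (use less \<open>l < n\<close> in \<open>auto simp: noise_def\<close>)
qed

text \<open>The indicator of a vertex has energy twice its degree, hence at most 8P.\<close>

lemma b_sq_le: "i < n \<Longrightarrow> (b i)\<^sup>2 \<le> 48 * \<l> * P / L"
proof -
  assume i: "i < n"
  have "energy A {..<n} (\<lambda>j. of_bool (j = i)) \<le> 8 * P"
  proof -
    have "energy A {..<n} (\<lambda>j. of_bool (j = i))
      = (\<Sum>j<n. \<Sum>l<n. (if j = i then A i l else 0) + (if l = i then A j i else 0))"
      unfolding energy_def by (intro sum.cong refl) auto
    also have "\<dots> = (\<Sum>l<n. A i l) + (\<Sum>j<n. A j i)"
    proof -
      have "(\<Sum>j<n. \<Sum>l<n. if j = i then A i l else 0) = (\<Sum>j<n. if j = i then (\<Sum>l<n. A i l) else 0)"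
        by (intro sum.cong) auto
      then show ?thesis using i by (simp add: sum.distrib)
    qed
    also have "(\<Sum>j<n. A j i) = (\<Sum>j<n. A i j)" by (simp add: adj_sym)
    finally show ?thesis using deg_le[OF i] by linarith
  qed
  then have e: "12 * \<l> * energy A {..<n} (\<lambda>j. of_bool (j = i)) / (2 * L) \<le> 12 * \<l> * (8 * P) / (2 * L)"
    using ln_ge by (intro divide_right_mono mult_left_mono) auto
  have bi: "(\<Sum>j<n. of_bool (j = i) * b j) = b i"
    using i by (simp add: of_bool_def if_distrib[of "\<lambda>x. x * _"] sum.If_cases cong: if_cong)
  have "\<bar>b i\<bar> \<le> sqrt (12 * \<l> * (8 * P) / (2 * L))"
    using lin_unit[OF i] e unfolding bi by (meson order_trans real_sqrt_le_mono)
  then have "\<bar>b i\<bar>\<^sup>2 \<le> (sqrt (12 * \<l> * (8 * P) / (2 * L)))\<^sup>2" by (intro power_mono) auto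
  moreover have "(sqrt (12 * \<l> * (8 * P) / (2 * L)))\<^sup>2 = 12 * \<l> * (8 * P) / (2 * L)"
    using ln_ge p_pos by (intro real_sqrt_pow2) simp
  ultimately show ?thesis by (simp add: ac_simps)
qed

text \<open>The l1 norm is the linear statistic of the noise for the best sign pattern. This pattern
  depends on the observations, which is allowed because \<open>lin_signs\<close> covers all patterns
  simultaneously.\<close>

lemma b_abs_sum_le: "(\<Sum>j<n. \<bar>b j\<bar>) \<le> sqrt (8 * (real n)\<^sup>2 * P / L)"
proof -
  define S where "S = {j\<in>{..<n}. 0 \<le> b j}"
  let ?e = "\<lambda>j. if j \<in> S then 1 else - 1 :: real"
  have "energy A {..<n} ?e \<le> (\<Sum>j<n. \<Sum>l<n. A j l * 4)"
    unfolding energy_def by (intro sum_mono mult_left_mono adj_bounds) auto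
  also have "\<dots> = 4 * (\<Sum>j<n. \<Sum>l<n. A j l)" by (simp add: sum_distrib_left mult.commute)
  also have "(\<Sum>j<n. \<Sum>l<n. A j l) \<le> (\<Sum>j<n. 4 * P)" by (intro sum_mono deg_le) simp
  finally have "energy A {..<n} ?e \<le> 16 * n * P" by simp
  then have "n * energy A {..<n} ?e / (2 * L) \<le> n * (16 * n * P) / (2 * L)"
    by (intro divide_right_mono mult_left_mono) auto
  moreover have "(\<Sum>j<n. ?e j * b j) = (\<Sum>j<n. \<bar>b j\<bar>)"
    by (intro sum.cong) (auto simp: S_def)
  ultimately have "(\<Sum>j<n. \<bar>b j\<bar>) \<le> sqrt (n * (16 * n * P) / (2 * L))"
    using lin_signs[of S] by (auto simp: S_def intro: order_trans real_sqrt_le_mono)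
  then show ?thesis by (simp add: power2_eq_square algebra_simps)
qed

text \<open>Interpolating between the \<open>\<ell>\<^sub>1\<close> and the \<open>\<ell>\<^sub>\<infinity>\<close> norm loses only \<open>\<surd>\<l>\<close>, which is just affordable
  when \<open>n p\<close> dominates \<open>\<l>\<close> to the power \<open>3/2\<close>.\<close>

lemma b_sq_sum_le: "(\<Sum>j<n. (b j)\<^sup>2) \<le> 20 * n * P * sqrt \<l> / L"
proof -
  have "(\<Sum>j<n. (b j)\<^sup>2) \<le> (\<Sum>j<n. sqrt (48 * \<l> * P / L) * \<bar>b j\<bar>)"
  proof (rule sum_mono)
    fix j assume "j \<in> {..<n}"
    then have "\<bar>b j\<bar> \<le> sqrt (48 * \<l> * P / L)" using b_sq_le[of j] by (simp add: real_le_rsqrt)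
    then have "\<bar>b j\<bar> * \<bar>b j\<bar> \<le> sqrt (48 * \<l> * P / L) * \<bar>b j\<bar>" by (rule mult_right_mono) simp
    then show "(b j)\<^sup>2 \<le> sqrt (48 * \<l> * P / L) * \<bar>b j\<bar>" by (simp add: power2_eq_square)
  qed
  also have "\<dots> = sqrt (48 * \<l> * P / L) * (\<Sum>j<n. \<bar>b j\<bar>)" by (simp add: sum_distrib_left)
  also have "\<dots> \<le> sqrt (48 * \<l> * P / L) * sqrt (8 * (real n)\<^sup>2 * P / L)"
    using ln_ge P_pos by (intro mult_left_mono b_abs_sum_le) auto
  also have "\<dots> = sqrt (384 * (n * P / L)\<^sup>2 * \<l>)"
    unfolding real_sqrt_mult[symmetric] by (rule arg_cong[where f = sqrt]) (simp add: power2_eq_square field_simps)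
  \<comment> \<open>The product 384 = 48 * 8 is rounded up to the square of 20.\<close>
  also have "\<dots> \<le> sqrt ((20 * (n * P / L))\<^sup>2 * \<l>)"
    unfolding power_mult_distrib[of 20] using ln_ge by (intro real_sqrt_le_mono mult_right_mono) auto
  also have "\<dots> = 20 * (n * P / L) * sqrt \<l>" using P_pos by (simp add: real_sqrt_mult)
  finally show ?thesis by simp
qed


section \<open>Linearisation and solvability of the edge systems\<close>

lemma phi_eq_0 [simp]: "phi R \<theta> j l 0 = 0"
  by (simp add: phi_def)

lemma phi_abs_le: "\<bar>phi R \<theta> j l t\<bar> \<le> \<bar>t\<bar>"
  using S.phi_Lipschitz[of j l t 0] by simp

lemma wgt_eq_psi': "j < n \<Longrightarrow> l < n \<Longrightarrow> wgt R \<theta> j l = psi' (\<theta> j - \<theta> l)"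
  using theta[of j l] by (intro wgt_eq) simp

lemma phi_eq_psi:
  assumes "j < n" "l < n" "\<bar>t\<bar> \<le> 1"
  shows "phi R \<theta> j l t = psi (\<theta> j - \<theta> l + t) - psi (\<theta> j - \<theta> l)"
  using theta[OF assms(1,2)] assms(3) by (simp add: phi_def psi_lin_eq)

text \<open>For \<open>\<bar>t\<bar> \<le> 1\<close> this is Taylor's formula for the unmodified
  link. For larger \<open>t\<close> both terms are at most \<open>\<bar>t\<bar>\<close>, which its
  square dominates; so the quadratic bound needs no prior smallness of the solution.\<close>

lemma phi_linearise: "j < n \<Longrightarrow> l < n \<Longrightarrow> \<bar>phi R \<theta> j l t - wgt R \<theta> j l * t\<bar> \<le> 2 * t\<^sup>2"
proof (cases "\<bar>t\<bar> \<le> 1")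
  case True
  assume jl: "j < n" "l < n"
  have "\<bar>phi R \<theta> j l t - wgt R \<theta> j l * t\<bar> \<le> t\<^sup>2"
    using psi_taylor[of "\<theta> j - \<theta> l" t] by (simp add: phi_eq_psi[OF jl True] wgt_eq_psi'[OF jl])
  then show ?thesis using zero_le_power2[of t] by linarith
next
  case False
  have "\<bar>wgt R \<theta> j l * t\<bar> \<le> \<bar>t\<bar>"
    using wgt_bounds[of R \<theta> j l] c_bounds by (simp add: abs_mult mult_left_le_one_le)
  then have "\<bar>phi R \<theta> j l t - wgt R \<theta> j l * t\<bar> \<le> 2 * \<bar>t\<bar>" using phi_abs_le[of j l t] by linarith
  also have "\<bar>t\<bar> \<le> \<bar>t\<bar> * \<bar>t\<bar>" using False mult_right_mono[of 1 "\<bar>t\<bar>" "\<bar>t\<bar>"] by simp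
  finally show ?thesis by (simp add: power2_eq_square)
qed

lemma sum_b: "(\<Sum>j<n. b j) = 0"
proof -
  have "(\<Sum>j<n. b j) = (\<Sum>j<n. \<Sum>l<n. noise L \<theta> \<omega> j l)" by (intro sum.cong) (auto simp: bvec_eq_sum_noise)
  also have "\<dots> = 0" by (rule sum_antisymmetric) (rule noise_antisym)
  finally show ?thesis .
qed

lemma score_solution_exists: "\<exists>d. S.is_solution b d"
  by (rule S.solution_exists[OF _ gap sum_b]) (use P_pos in auto)

lemma loo_solution:
  assumes i: "i < n"
  shows "(\<Sum>j\<in>{..<n} - {i}. \<D> i j) = 0"
    and "\<And>j. j \<in> {..<n} - {i} \<Longrightarrow>
      (\<Sum>l\<in>{..<n} - {i}. A j l * phi R \<theta> j l (\<D> i j - \<D> i l))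
        = (\<Sum>l\<in>{..<n} - {i}. noise L \<theta> \<omega> j l)"
proof -
  interpret S': edge_system "{..<n} - {i}" A "phi R \<theta>" c by (rule edge_system_phi) (simp_all add: R)
  have "\<exists>d. S'.is_solution (\<lambda>j. \<Sum>l\<in>{..<n} - {i}. noise L \<theta> \<omega> j l) d"
  proof (rule S'.solution_exists[OF _ gap_loo[OF i]])
    show "(\<Sum>j\<in>{..<n} - {i}. \<Sum>l\<in>{..<n} - {i}. noise L \<theta> \<omega> j l) = 0"
      by (rule sum_antisymmetric) (rule noise_antisym)
  qed (use P_pos in auto)
  then have "\<exists>d. (\<Sum>j\<in>{..<n} - {i}. d j) = 0 \<and>
     (\<forall>j\<in>{..<n} - {i}. (\<Sum>l\<in>{..<n} - {i}. A j l * phi R \<theta> j l (d j - d l))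
        = (\<Sum>l\<in>{..<n} - {i}. noise L \<theta> \<omega> j l))"
    unfolding S'.is_solution_def S'.flow_def .
  from someI_ex[OF this] show "(\<Sum>j\<in>{..<n} - {i}. \<D> i j) = 0"
    and "\<And>j. j \<in> {..<n} - {i} \<Longrightarrow>
      (\<Sum>l\<in>{..<n} - {i}. A j l * phi R \<theta> j l (\<D> i j - \<D> i l))
        = (\<Sum>l\<in>{..<n} - {i}. noise L \<theta> \<omega> j l)"
    unfolding loo_def by blast+
qed

lemma potential_solution:
  "W.is_solution (\<lambda>j. wgt R \<theta> i j - (\<Sum>k<n. wgt R \<theta> i k) / n) (potential n \<theta> R i (fst \<omega>))"
proof -
  have "\<exists>h. W.is_solution (\<lambda>j. wgt R \<theta> i j - (\<Sum>k<n. wgt R \<theta> i k) / n) h"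
    by (rule W.solution_exists[OF _ gap]) (use P_pos n2 in \<open>auto simp: sum_subtractf\<close>)
  moreover have "adj (fst \<omega>, \<lambda>_. False) = A" by (intro ext) (simp add: adj_def)
  ultimately have "\<exists>h. (\<Sum>j<n. h j) = 0 \<and>
     (\<forall>j<n. (\<Sum>l<n. adj (fst \<omega>, \<lambda>_. False) j l * (wgt R \<theta> j l * (h j - h l)))
        = wgt R \<theta> i j - (\<Sum>k<n. wgt R \<theta> i k) / n)"
    by (simp add: W.is_solution_def W.flow_def Ball_def)
  from someI_ex[OF this] have "(\<Sum>j<n. potential n \<theta> R i (fst \<omega>) j) = 0 \<and>
     (\<forall>j<n. (\<Sum>l<n. adj (fst \<omega>, \<lambda>_. False) j l * (wgt R \<theta> j l * (potential n \<theta> R i (fst \<omega>) j - potential n \<theta> R i (fst \<omega>) l)))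
        = wgt R \<theta> i j - (\<Sum>k<n. wgt R \<theta> i k) / n)"
    unfolding potential_def by blast
  then show ?thesis using \<open>adj (fst \<omega>, \<lambda>_. False) = A\<close> by (simp add: W.is_solution_def W.flow_def)
qed

text \<open>Testing the equation with its solution removes the centring constant, as the solution
  sums to zero. The remaining right-hand side has squared norm at most \<open>n\<close>, and the gap
  contributes the factor 1/P.\<close>

lemma potential_energy: "energy A {..<n} (potential n \<theta> R i (fst \<omega>)) \<le> 1024 / c\<^sup>2 * (n / P)"
proof -
  define h where "h = potential n \<theta> R i (fst \<omega>)"
  define ub where "ub = (\<Sum>k<n. wgt R \<theta> i k) / n"
  have h0: "(\<Sum>j<n. h j) = 0" and hf: "\<And>j. j < n \<Longrightarrow> W.flow h j = wgt R \<theta> i j - ub"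
    using potential_solution[of i] by (auto simp: W.is_solution_def h_def ub_def)
  have "c / 2 * energy A {..<n} h \<le> (\<Sum>j<n. h j * W.flow h j)"
    using W.flow_monotone[of h "\<lambda>_. 0"] by (simp add: W.flow_def)
  also have "\<dots> = (\<Sum>j<n. h j * wgt R \<theta> i j) - (\<Sum>j<n. h j) * ub"
    by (simp add: hf right_diff_distrib sum_subtractf sum_distrib_right)
  finally have le: "c / 2 * energy A {..<n} h \<le> (\<Sum>j<n. h j * wgt R \<theta> i j)" by (simp add: h0)
  have "energy A {..<n} h \<le> 4 / (c\<^sup>2 * (P / 256)) * (\<Sum>j<n. (wgt R \<theta> i j)\<^sup>2)"
    by (rule gap_energy_bounds(1)[OF _ _ gap[OF h0] le]) (use P_pos c_bounds in auto)
  also have "\<dots> \<le> 4 / (c\<^sup>2 * (P / 256)) * (\<Sum>j<n. 1)"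
  proof (intro mult_left_mono sum_mono)
    show "(wgt R \<theta> i j)\<^sup>2 \<le> 1" for j
      using wgt_bounds[of R \<theta> i j] c_bounds by (intro power_le_one) auto
  qed (use P_pos c_bounds in auto)
  also have "\<dots> = 1024 / c\<^sup>2 * (n / P)" by simp
  finally show ?thesis by (simp only: h_def)
qed

end

text \<open>All these constants are functions of the slope bound \<open>c\<close> alone, so they
  stay fixed as n, p, L and the true parameter vary; standing outside the locale, they can be named
  when the limit is taken.\<close>

definition const_l2 :: "real \<Rightarrow> real" where "const_l2 c = 5242880 / c\<^sup>2"
definition const_loo :: "real \<Rightarrow> real" where "const_loo c = 100663296 / c\<^sup>2 + 2"
definition const_row :: "real \<Rightarrow> real" where "const_row c = 8 * const_l2 c + 144 + 154 * const_loo c"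
definition const_abs :: "real \<Rightarrow> real" where "const_abs c = 64 / c\<^sup>2 * (96 + 8 * const_row c)"
definition const_sup :: "real \<Rightarrow> real" where "const_sup c = 2 * const_abs c"
definition const_loo' :: "real \<Rightarrow> real" where "const_loo' c = const_loo c * (1 + const_sup c)"
definition const_row' :: "real \<Rightarrow> real" where "const_row' c = const_row c * (1 + const_sup c)"
definition const_smooth :: "real \<Rightarrow> real" where
  "const_smooth c = 8 * const_sup c * (1024 / c\<^sup>2) * (20480 / c\<^sup>2) + 12 * (1024 / c\<^sup>2)"
definition const_lin :: "real \<Rightarrow> real" where
  "const_lin c = 12 * const_loo' c + 3 * (192 * (const_l2 c + const_loo' c) + 2304 * (const_sup c + const_loo' c))
     + 9 * (const_smooth c + const_sup c + const_loo' c)"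
definition const_rem :: "real \<Rightarrow> real" where "const_rem c = 8 / c * (sqrt (const_lin c) + 4 * const_row' c)"

locale btl_score_solution = btl_good +
  fixes \<delta> :: "nat \<Rightarrow> real"
  assumes \<delta>: "S.is_solution b \<delta>"
begin

abbreviation "K_l2 \<equiv> const_l2 c"
abbreviation "K_loo \<equiv> const_loo c"
abbreviation "K_row \<equiv> const_row c"
abbreviation "K_abs \<equiv> const_abs c"
abbreviation "K_sup \<equiv> const_sup c"
abbreviation "K_loo' \<equiv> const_loo' c"
abbreviation "K_row' \<equiv> const_row' c"
abbreviation "K_smooth \<equiv> const_smooth c"
abbreviation "K_lin \<equiv> const_lin c"
abbreviation "K_rem \<equiv> const_rem c"

definition M where "M = Max ((\<lambda>j. \<bar>\<delta> j\<bar>) ` {..<n})"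

text \<open>The square of the scale 1/sqrt(npL) against which additive errors are measured.\<close>

definition \<nu> where "\<nu> = 1 / (P * L)"

section \<open>Energy, l2 norm and leave-one-out stability of the score solution\<close>

lemma \<delta>_sum: "(\<Sum>j<n. \<delta> j) = 0" and \<delta>_flow: "\<And>j. j < n \<Longrightarrow> S.flow \<delta> j = b j"
  using \<delta> by (auto simp: S.is_solution_def)

lemma M_ge: "j < n \<Longrightarrow> \<bar>\<delta> j\<bar> \<le> M"
  unfolding M_def by (intro Max_ge) auto

lemma M_attained: "\<exists>j<n. M = \<bar>\<delta> j\<bar>"
proof -
  have "M \<in> (\<lambda>j. \<bar>\<delta> j\<bar>) ` {..<n}" unfolding M_def using n2 by (intro Max_in) (auto simp: lessThan_empty_iff)
  then show ?thesis by auto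
qed

lemma M_nonneg: "0 \<le> M"
  using M_attained by auto

lemma \<delta>_sq_le: "j < n \<Longrightarrow> (\<delta> j)\<^sup>2 \<le> M\<^sup>2"
  using power_mono[OF M_ge, of j 2] by simp

lemma \<delta>_diff_le: "j < n \<Longrightarrow> l < n \<Longrightarrow> \<bar>\<delta> j - \<delta> l\<bar> \<le> 2 * M"
  using M_ge[of j] M_ge[of l] by linarith

lemma \<nu>_pos: "0 < \<nu>"
  using P_pos L by (simp add: \<nu>_def)

lemma P_\<nu>_le: "P * \<nu> \<le> 1"
  using P_pos L by (simp add: \<nu>_def)

lemma \<delta>_monotone: "c / 2 * energy A {..<n} \<delta> \<le> (\<Sum>j<n. \<delta> j * b j)"
proof -
  have "c / 2 * energy A {..<n} \<delta> \<le> (\<Sum>j<n. \<delta> j * S.flow \<delta> j)"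
    using S.flow_monotone[of \<delta> "\<lambda>_. 0"] by (simp add: S.flow_def)
  then show ?thesis by (simp add: \<delta>_flow)
qed

lemma \<delta>_energy: "energy A {..<n} \<delta> \<le> 20480 / c\<^sup>2 * (n * sqrt \<l> / L)"
proof -
  have "energy A {..<n} \<delta> \<le> 4 / (c\<^sup>2 * (P / 256)) * (\<Sum>j<n. (b j)\<^sup>2)"
    by (rule gap_energy_bounds(1)[OF _ _ gap[OF \<delta>_sum] \<delta>_monotone]) (use P_pos c_bounds in auto)
  also have "\<dots> \<le> 4 / (c\<^sup>2 * (P / 256)) * (20 * n * P * sqrt \<l> / L)"
    using P_pos by (intro mult_left_mono b_sq_sum_le) auto
  also have "\<dots> = 20480 / c\<^sup>2 * (n * sqrt \<l> / L)"
    using P_pos by (auto simp: field_simps)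
  finally show ?thesis .
qed

lemma \<delta>_l2: "(\<Sum>j<n. (\<delta> j)\<^sup>2) \<le> 5242880 / c\<^sup>2 * (n * sqrt \<l> * \<nu>)"
proof -
  have "P / 256 * (\<Sum>j<n. (\<delta> j)\<^sup>2) \<le> 20480 / c\<^sup>2 * (n * sqrt \<l> / L)"
    using gap[OF \<delta>_sum] \<delta>_energy by linarith
  then have "(\<Sum>j<n. (\<delta> j)\<^sup>2) \<le> 20480 / c\<^sup>2 * (n * sqrt \<l> / L) / (P / 256)"
    using P_pos by (subst pos_le_divide_eq) (simp, simp only: mult.commute)
  also have "\<dots> = 5242880 / c\<^sup>2 * (n * sqrt \<l> * \<nu>)" by (simp add: \<nu>_def)
  finally show ?thesis .
qed

text \<open>Removing vertex \<open>i\<close> perturbs the score equation only at the neighbours of \<open>i\<close>.\<close>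

lemma loo_close:
  assumes i: "i < n"
  shows "(\<Sum>j\<in>{..<n} - {i}. (\<delta> j - \<D> i j)\<^sup>2) \<le> K_loo * (\<l> * \<nu> + M\<^sup>2 / P)"
proof -
  define V where "V = {..<n} - {i}"
  interpret S': edge_system V A "phi R \<theta>" c unfolding V_def by (rule edge_system_phi) (simp_all add: R)
  define d where "d = \<D> i"
  \<comment> \<open>The contribution of vertex \<open>i\<close> to the score equation at
    \<open>j\<close>: its noise minus its flow. It vanishes unless \<open>j\<close> is a neighbour
    of \<open>i\<close>.\<close>
  define r where "r j = noise L \<theta> \<omega> j i - A j i * phi R \<theta> j i (\<delta> j - \<delta> i)" for j
  define q where "q j = \<delta> j - d j" for j
  have ins: "sum g {..<n} = g i + sum g V" for g :: "nat \<Rightarrow> real"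
    unfolding V_def using i by (intro sum.remove) auto
  have cardV: "real (card V) = n - 1" using i by (simp add: V_def of_nat_diff)
  have n1: "0 < real n - 1" using n2 by simp
  have flow_d: "S'.flow d j = (\<Sum>l\<in>V. noise L \<theta> \<omega> j l)" if "j \<in> V" for j
    unfolding S'.flow_def using loo_solution(2)[OF i] that by (simp add: V_def d_def)
  have flow_diff: "S'.flow \<delta> j - S'.flow d j = r j" if "j \<in> V" for j
  proof -
    have j: "j < n" using that by (simp add: V_def)
    have "(\<Sum>l<n. A j l * phi R \<theta> j l (\<delta> j - \<delta> l)) = (\<Sum>l<n. noise L \<theta> \<omega> j l)"
      using \<delta>_flow[OF j] by (simp add: S.flow_def bvec_eq_sum_noise[OF j])
    then show ?thesis unfolding flow_d[OF that] by (simp add: ins r_def S'.flow_def)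
  qed
  have sum_r: "(\<Sum>j\<in>V. r j) = 0"
    using flow_diff S'.sum_flow by (simp flip: flow_diff add: sum_subtractf)
  \<comment> \<open>On the reduced vertex set \<open>q\<close> sums to - \<open>\<delta> i\<close>
    rather than 0, so it is centred before the gap is used; undoing this later costs the square of
    \<open>\<delta> i\<close> divided by n - 1.\<close>
  define qb where "qb = (\<Sum>j\<in>V. q j) / (n - 1)"
  have sum_q: "(\<Sum>j\<in>V. q j) = - \<delta> i"
    using loo_solution(1)[OF i] ins[of \<delta>] \<delta>_sum by (simp add: q_def sum_subtractf d_def V_def)
  have sum_qb: "(\<Sum>j\<in>V. q j - qb) = 0" using n1 by (simp add: sum_subtractf cardV qb_def)
  have "c / 2 * energy A V q \<le> (\<Sum>j\<in>V. q j * r j)"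
    using S'.flow_monotone[of \<delta> d] flow_diff by (simp add: q_def[abs_def])
  also have "\<dots> = (\<Sum>j\<in>V. (q j - qb) * r j)"
    by (simp add: left_diff_distrib sum_subtractf sum_distrib_left[symmetric] sum_r)
  finally have mon: "c / 2 * energy A V (\<lambda>j. q j - qb) \<le> (\<Sum>j\<in>V. (q j - qb) * r j)" by (simp add: energy_shift)
  have "(\<Sum>j\<in>V. (r j)\<^sup>2) \<le> (\<Sum>j\<in>V. A i j * (24 * \<l> / L + 8 * M\<^sup>2))"
  proof (rule sum_mono)
    fix j assume "j \<in> V"
    then have j: "j < n" by (simp add: V_def)
    have "\<bar>phi R \<theta> j i (\<delta> j - \<delta> i)\<bar> \<le> 2 * M" using phi_abs_le[of j i "\<delta> j - \<delta> i"] \<delta>_diff_le[OF j i] by linarith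
    then have "\<bar>phi R \<theta> j i (\<delta> j - \<delta> i)\<bar>\<^sup>2 \<le> (2 * M)\<^sup>2" by (rule power_mono) simp
    then have "A j i * (phi R \<theta> j i (\<delta> j - \<delta> i))\<^sup>2 \<le> A j i * (4 * M\<^sup>2)"
      by (intro mult_left_mono adj_bounds) (simp add: power_mult_distrib)
    moreover have "(r j)\<^sup>2 \<le> 2 * (noise L \<theta> \<omega> j i)\<^sup>2 + 2 * (A j i * phi R \<theta> j i (\<delta> j - \<delta> i))\<^sup>2"
      unfolding r_def by (smt (verit) power2_sum power2_diff zero_le_power2)
    moreover have "A i j * (24 * \<l> / L + 8 * M\<^sup>2) = 2 * (A j i * (12 * \<l> / L)) + 2 * (A j i * (4 * M\<^sup>2))"
      by (simp add: adj_sym[of \<omega> i j] algebra_simps)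
    ultimately show "(r j)\<^sup>2 \<le> A i j * (24 * \<l> / L + 8 * M\<^sup>2)"
      using noise_sq_le[OF j i] unfolding power_mult_distrib adj_square by linarith
  qed
  also have "\<dots> = (\<Sum>j\<in>V. A i j) * (24 * \<l> / L + 8 * M\<^sup>2)" by (simp add: sum_distrib_right)
  \<comment> \<open>The coefficient 8 is raised to 24 so that both terms carry the same
    constant.\<close>
  also have "\<dots> \<le> 4 * P * (24 * \<l> / L + 24 * M\<^sup>2)"
    using deg_le[OF i] ins[of "A i"] P_pos ln_ge by (intro mult_mono) auto
  finally have r_le: "(\<Sum>j\<in>V. (r j)\<^sup>2) \<le> 4 * P * (24 * \<l> / L + 24 * M\<^sup>2)" .
  have "(\<Sum>j\<in>V. (q j - qb)\<^sup>2) \<le> 4 / (c\<^sup>2 * (P / 512)\<^sup>2) * (\<Sum>j\<in>V. (r j)\<^sup>2)"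
    by (rule gap_energy_bounds(2)[OF _ _ _ mon])
      (use P_pos c_bounds gap_loo[OF i, of "\<lambda>j. q j - qb"] sum_qb in \<open>auto simp: V_def\<close>)
  also have "\<dots> \<le> 4 / (c\<^sup>2 * (P / 512)\<^sup>2) * (4 * P * (24 * \<l> / L + 24 * M\<^sup>2))"
    using r_le by (intro mult_left_mono) auto
  also have "\<dots> = 100663296 / c\<^sup>2 * (\<l> * \<nu> + M\<^sup>2 / P)"
    using P_pos L c_bounds unfolding \<nu>_def by (simp add: divide_simps power2_eq_square)
  finally have centred: "(\<Sum>j\<in>V. (q j - qb)\<^sup>2) \<le> 100663296 / c\<^sup>2 * (\<l> * \<nu> + M\<^sup>2 / P)" .
  have "(\<Sum>j\<in>V. (q j)\<^sup>2) = (\<Sum>j\<in>V. (q j - qb)\<^sup>2 + (2 * qb * (q j - qb) + qb\<^sup>2))"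
    by (intro sum.cong) (auto simp: power2_eq_square algebra_simps)
  also have "\<dots> = (\<Sum>j\<in>V. (q j - qb)\<^sup>2) + (n - 1) * qb\<^sup>2"
    by (simp add: sum.distrib sum_distrib_left[symmetric] sum_qb cardV)
  also have "(n - 1) * qb\<^sup>2 = (\<delta> i)\<^sup>2 / (n - 1)"
  proof -
    have "x * (- d / x)\<^sup>2 = d\<^sup>2 / x" if "0 < x" for x d :: real using that by (simp add: power2_eq_square)
    then show ?thesis unfolding qb_def sum_q using n1 n2 by (simp add: of_nat_diff)
  qed
  also have "\<dots> \<le> M\<^sup>2 / (P / 2)"
  proof (rule frac_le)
    have "2 \<le> real n" "real (n - 1) = real n - 1" using n2 by (simp_all add: of_nat_diff)
    then show "P / 2 \<le> real (n - 1)" using P_le_n by linarith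
  qed (use \<delta>_sq_le[OF i] P_pos in auto)
  also have "\<dots> = 2 * (M\<^sup>2 / P)" by simp
  also have "\<dots> \<le> 2 * (\<l> * \<nu> + M\<^sup>2 / P)" using ln_ge \<nu>_pos by simp
  finally have "(\<Sum>j\<in>V. (q j)\<^sup>2) \<le> 100663296 / c\<^sup>2 * (\<l> * \<nu> + M\<^sup>2 / P) + 2 * (\<l> * \<nu> + M\<^sup>2 / P)"
    using centred by linarith
  then show ?thesis by (simp add: const_loo_def distrib_right q_def d_def V_def)
qed


text \<open>The quantity that the sparsity hypothesis sends to 0: multiplicative errors will be of
  order sqrt \<tau>, additive ones of order sqrt (\<tau> \<nu>).\<close>

definition \<tau> where "\<tau> = \<l> * sqrt \<l> / P"

lemma K_nonneg: "0 \<le> K_l2" "0 \<le> K_loo" "0 \<le> K_row" "0 \<le> K_abs" "0 \<le> K_sup" "0 \<le> K_loo'" "0 \<le> K_row'" "0 \<le> K_smooth" "0 \<le> K_lin" "0 \<le> K_rem"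
proof -
  show 1: "0 \<le> K_l2" "0 \<le> K_loo" by (simp_all add: const_l2_def const_loo_def)
  then show 4: "0 \<le> K_row" by (simp add: const_row_def)
  then show "0 \<le> K_abs" by (simp add: const_abs_def)
  then show 6: "0 \<le> K_sup" by (simp add: const_sup_def)
  show 7: "0 \<le> K_loo'" "0 \<le> K_row'" using 1 4 6 by (simp_all add: const_loo'_def const_row'_def)
  show 11: "0 \<le> K_smooth" using 6 by (simp add: const_smooth_def)
  show 12: "0 \<le> K_lin" using 1 6 7 11 by (simp add: const_lin_def)
  show "0 \<le> K_rem" using 7 12 c_bounds by (simp add: const_rem_def)
qed

lemma sqrt_ln_ge: "1 \<le> sqrt \<l>"
  using ln_ge by simp

lemma \<tau>_nonneg: "0 \<le> \<tau>"
  using ln_ge P_pos by (simp add: \<tau>_def)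

lemma ln_over_P_le: "\<l> / P \<le> \<tau>"
  unfolding \<tau>_def using ln_ge sqrt_ln_ge P_pos by (intro divide_right_mono) auto

lemma ln_le_P: "\<tau> \<le> 1 \<Longrightarrow> \<l> \<le> P"
proof -
  assume "\<tau> \<le> 1"
  then have "\<l> / P \<le> 1" using ln_over_P_le by linarith
  then show ?thesis using P_pos by (simp add: pos_divide_le_eq)
qed

lemma ln_sq_le: "\<tau> \<le> 1 \<Longrightarrow> \<l>\<^sup>2 \<le> P * sqrt \<l>"
proof -
  assume "\<tau> \<le> 1"
  then have "\<l> * sqrt \<l> \<le> P" using P_pos by (simp add: \<tau>_def pos_divide_le_eq)
  then have "\<l> * sqrt \<l> * sqrt \<l> \<le> P * sqrt \<l>" using ln_ge by (intro mult_right_mono) auto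
  then show ?thesis using ln_ge by (simp add: power2_eq_square mult.assoc)
qed

section \<open>Row sums of squares and the sup norm\<close>

definition Q where "Q i = (\<Sum>j\<in>{..<n} - {i}. (\<delta> j - \<D> i j)\<^sup>2)"

lemma Q_nonneg: "0 \<le> Q i"
  by (simp add: Q_def sum_nonneg)

lemma loo_sq_le:
  assumes "i < n" "j \<in> {..<n} - {i}"
  shows "(\<D> i j)\<^sup>2 \<le> 2 * M\<^sup>2 + 2 * Q i"
proof -
  have "(\<delta> j - \<D> i j)\<^sup>2 \<le> Q i" unfolding Q_def using assms by (intro member_le_sum) auto
  moreover have "(\<delta> j)\<^sup>2 \<le> M\<^sup>2" using assms \<delta>_sq_le by simp
  moreover have "(\<D> i j)\<^sup>2 \<le> 2 * (\<delta> j)\<^sup>2 + 2 * (\<delta> j - \<D> i j)\<^sup>2"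
    using zero_le_power2[of "2 * \<delta> j - \<D> i j"] by (simp add: power2_eq_square algebra_simps)
  ultimately show ?thesis by linarith
qed

lemma loo_l2:
  assumes "i < n"
  shows "(\<Sum>j\<in>{..<n} - {i}. (\<D> i j)\<^sup>2) \<le> 2 * (\<Sum>j<n. (\<delta> j)\<^sup>2) + 2 * Q i"
proof -
  have "(\<Sum>j\<in>{..<n} - {i}. (\<D> i j)\<^sup>2)
    \<le> (\<Sum>j\<in>{..<n} - {i}. 2 * (\<delta> j)\<^sup>2 + 2 * (\<delta> j - \<D> i j)\<^sup>2)"
  proof (rule sum_mono)
    fix j
    show "(\<D> i j)\<^sup>2 \<le> 2 * (\<delta> j)\<^sup>2 + 2 * (\<delta> j - \<D> i j)\<^sup>2"
      using zero_le_power2[of "2 * \<delta> j - \<D> i j"] by (simp add: power2_eq_square algebra_simps)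
  qed
  also have "\<dots> = 2 * (\<Sum>j\<in>{..<n} - {i}. (\<delta> j)\<^sup>2) + 2 * Q i" by (simp add: sum.distrib sum_distrib_left Q_def)
  also have "(\<Sum>j\<in>{..<n} - {i}. (\<delta> j)\<^sup>2) \<le> (\<Sum>j<n. (\<delta> j)\<^sup>2)" by (intro sum_mono2) auto
  finally show ?thesis by simp
qed

text \<open>Bernstein's inequality for the squared leave-one-out entries, which do not depend on row
  \<open>i\<close>. Their fourth powers sum to at most \<open>m * F\<close>, and the
  arithmetic-geometric mean inequality distributes the square root over \<open>p * F\<close> and
  \<open>\<l> * m\<close>.\<close>

lemma row_loo_sq:
  assumes i: "i < n"
  shows "(\<Sum>j\<in>{..<n} - {i}. A i j * (\<D> i j)\<^sup>2)
    \<le> 2 * p * (\<Sum>j\<in>{..<n} - {i}. (\<D> i j)\<^sup>2) + 36 * \<l> * (2 * M\<^sup>2 + 2 * Q i)"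
proof -
  define d where "d = \<D> i"
  define V where "V = {..<n} - {i}"
  define F where "F = (\<Sum>j\<in>V. (d j)\<^sup>2)"
  define m where "m = 2 * M\<^sup>2 + 2 * Q i"
  have F0: "0 \<le> F" by (simp add: F_def sum_nonneg)
  have m0: "0 \<le> m" using Q_nonneg by (simp add: m_def)
  have dm: "(d j)\<^sup>2 \<le> m" if "j \<in> V" for j using loo_sq_le[OF i] that by (simp add: d_def m_def V_def)
  have "\<bar>\<Sum>j\<in>V. (A i j - p) * (d j)\<^sup>2\<bar> \<le> 2 * sqrt (12 * \<l> * p * (\<Sum>j\<in>V. ((d j)\<^sup>2)\<^sup>2)) + 2 * (12 * \<l>) * m"
    unfolding V_def d_def by (rule bernstein_sq[OF i m0]) (use dm in \<open>simp add: V_def d_def\<close>)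
  moreover have "2 * sqrt (12 * \<l> * p * (\<Sum>j\<in>V. ((d j)\<^sup>2)\<^sup>2)) \<le> p * F + 12 * \<l> * m"
  proof -
    have "(\<Sum>j\<in>V. ((d j)\<^sup>2)\<^sup>2) \<le> (\<Sum>j\<in>V. m * (d j)\<^sup>2)"
      unfolding power2_eq_square[of "(_)\<^sup>2"] by (intro sum_mono mult_right_mono dm) auto
    also have "\<dots> = m * F" by (simp add: F_def sum_distrib_left)
    finally have "sqrt (12 * \<l> * p * (\<Sum>j\<in>V. ((d j)\<^sup>2)\<^sup>2)) \<le> sqrt (12 * \<l> * p * (m * F))"
      using ln_ge p_pos by (intro real_sqrt_le_mono mult_left_mono) auto
    also have "\<dots> = sqrt ((p * F) * (12 * \<l> * m))" by (simp add: ac_simps)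
    also have "\<dots> \<le> (p * F + 12 * \<l> * m) / 2"
      using p_pos F0 ln_ge m0 by (intro arith_geo_mean_sqrt) auto
    finally show ?thesis by simp
  qed
  moreover have "(\<Sum>j\<in>V. (A i j - p) * (d j)\<^sup>2) = (\<Sum>j\<in>V. A i j * (d j)\<^sup>2) - p * F"
    by (simp add: left_diff_distrib sum_subtractf F_def sum_distrib_left)
  ultimately have "(\<Sum>j\<in>V. A i j * (d j)\<^sup>2) \<le> 2 * p * F + 36 * \<l> * m" by (simp add: algebra_simps)
  then show ?thesis by (simp only: V_def d_def F_def m_def)
qed

text \<open>The entries of \<delta> depend on row \<open>i\<close>, so they are exchanged for
  leave-one-out entries at the cost of \<open>Q i\<close>. The neighbours of \<open>i\<close> then
  carry about their fair share of the l2 norm, up to a term in the still unknown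
  \<open>M\<close>.\<close>

lemma row_sq:
  assumes i: "i < n" and \<tau>: "\<tau> \<le> 1"
  shows "(\<Sum>j<n. A i j * (\<delta> j)\<^sup>2) \<le> K_row * (P * sqrt \<l> * \<nu> + \<l> * M\<^sup>2)"
proof -
  define d where "d = \<D> i"
  define V where "V = {..<n} - {i}"
  define D where "D = (\<Sum>j<n. (\<delta> j)\<^sup>2)"
  define X where "X = P * sqrt \<l> * \<nu> + \<l> * M\<^sup>2"
  have X1: "P * sqrt \<l> * \<nu> \<le> X" "\<l> * M\<^sup>2 \<le> X" "0 \<le> X" using P_pos ln_ge \<nu>_pos by (auto simp: X_def)
  have "(\<Sum>j<n. A i j * (\<delta> j)\<^sup>2) = (\<Sum>j\<in>V. A i j * (\<delta> j)\<^sup>2)"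
    unfolding V_def by (intro sum.mono_neutral_right) auto
  also have "\<dots> \<le> (\<Sum>j\<in>V. 2 * (A i j * (d j)\<^sup>2) + 2 * (\<delta> j - d j)\<^sup>2)"
  proof (rule sum_mono)
    fix j
    have "(\<delta> j)\<^sup>2 \<le> 2 * (d j)\<^sup>2 + 2 * (\<delta> j - d j)\<^sup>2"
      using zero_le_power2[of "\<delta> j - 2 * d j"] by (simp add: power2_eq_square algebra_simps)
    then have "A i j * (\<delta> j)\<^sup>2 \<le> A i j * (2 * (d j)\<^sup>2 + 2 * (\<delta> j - d j)\<^sup>2)" by (intro mult_left_mono adj_bounds)
    also have "\<dots> \<le> 2 * (A i j * (d j)\<^sup>2) + 2 * (\<delta> j - d j)\<^sup>2"
      using adj_bounds(2)[of \<omega> i j] by (simp add: distrib_left mult_left_le_one_le adj_bounds)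
    finally show "A i j * (\<delta> j)\<^sup>2 \<le> 2 * (A i j * (d j)\<^sup>2) + 2 * (\<delta> j - d j)\<^sup>2" .
  qed
  also have "\<dots> = 2 * (\<Sum>j\<in>V. A i j * (d j)\<^sup>2) + 2 * Q i"
    by (simp add: sum.distrib sum_distrib_left Q_def V_def d_def)
  also have "(\<Sum>j\<in>V. A i j * (d j)\<^sup>2) \<le> 2 * p * (2 * D + 2 * Q i) + 36 * \<l> * (2 * M\<^sup>2 + 2 * Q i)"
  proof -
    have "2 * p * (\<Sum>j\<in>V. (d j)\<^sup>2) \<le> 2 * p * (2 * D + 2 * Q i)"
      unfolding V_def d_def D_def using p_pos by (intro mult_left_mono loo_l2[OF i]) auto
    then show ?thesis using row_loo_sq[OF i] by (simp only: V_def d_def)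
  qed
  finally have 1: "(\<Sum>j<n. A i j * (\<delta> j)\<^sup>2) \<le> 8 * (p * D) + 8 * (p * Q i) + 144 * (\<l> * M\<^sup>2) + 144 * (\<l> * Q i) + 2 * Q i"
    by (simp add: algebra_simps)
  have "p * D \<le> p * (K_l2 * (n * sqrt \<l> * \<nu>))" using \<delta>_l2 p_pos by (intro mult_left_mono) (auto simp: D_def const_l2_def)
  also have "\<dots> = K_l2 * (P * sqrt \<l> * \<nu>)" by simp
  also have "\<dots> \<le> K_l2 * X" using X1 K_nonneg by (intro mult_left_mono) auto
  finally have 2: "p * D \<le> K_l2 * X" .
  have "\<l> * Q i \<le> \<l> * (K_loo * (\<l> * \<nu> + M\<^sup>2 / P))"
    unfolding Q_def using loo_close[OF i] ln_ge by (intro mult_left_mono) auto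
  also have "\<dots> = K_loo * (\<l>\<^sup>2 * \<nu> + \<l> * (M\<^sup>2 / P))" by (simp add: power2_eq_square algebra_simps)
  also have "\<dots> \<le> K_loo * X"
  proof (intro mult_left_mono K_nonneg)
    have "\<l>\<^sup>2 * \<nu> \<le> P * sqrt \<l> * \<nu>" using ln_sq_le[OF \<tau>] \<nu>_pos by (intro mult_right_mono) auto
    moreover have "M\<^sup>2 / P \<le> M\<^sup>2 / 1" using P_ge by (intro divide_left_mono) auto
    then have "\<l> * (M\<^sup>2 / P) \<le> \<l> * M\<^sup>2" using ln_ge by (intro mult_left_mono) auto
    ultimately show "\<l>\<^sup>2 * \<nu> + \<l> * (M\<^sup>2 / P) \<le> X" unfolding X_def by linarith
  qed
  finally have 3: "\<l> * Q i \<le> K_loo * X" .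
  have 4: "Q i \<le> \<l> * Q i" "p * Q i \<le> Q i"
    using ln_ge p_le p_pos Q_nonneg[of i] mult_right_mono[of 1 \<l> "Q i"] by (auto simp: mult_left_le_one_le)
  have "(\<Sum>j<n. A i j * (\<delta> j)\<^sup>2) \<le> 8 * (K_l2 * X) + 144 * X + 154 * (K_loo * X)" using 1 2 3 4 X1 by linarith
  also have "\<dots> = K_row * X" by (simp add: const_row_def algebra_simps)
  finally show ?thesis by (simp only: X_def)
qed

text \<open>If \<open>\<delta> i\<close> is nonnegative, moving the argument of \<open>phi\<close>
  from - \<open>\<delta> j\<close> to \<open>\<delta> i - \<delta> j\<close> raises it by at least
  \<open>c * \<delta> i\<close>, while the value at - \<open>\<delta> j\<close> is at most
  \<open>\<bar>\<delta> j\<bar>\<close> in modulus. The other sign is symmetric.\<close>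

lemma entry_bound:
  assumes i: "i < n"
  shows "c * (\<Sum>j<n. A i j) * \<bar>\<delta> i\<bar> \<le> \<bar>b i\<bar> + (\<Sum>j<n. A i j * \<bar>\<delta> j\<bar>)"
proof -
  have bi: "b i = (\<Sum>j<n. A i j * phi R \<theta> i j (\<delta> i - \<delta> j))" using \<delta>_flow[OF i] by (simp add: S.flow_def)
  have sum_eq: "(\<Sum>j<n. A i j * (c * \<bar>\<delta> i\<bar> - \<bar>\<delta> j\<bar>)) = c * (\<Sum>j<n. A i j) * \<bar>\<delta> i\<bar> - (\<Sum>j<n. A i j * \<bar>\<delta> j\<bar>)"
    by (simp add: right_diff_distrib sum_subtractf sum_distrib_left sum_distrib_right ac_simps)
  show ?thesis
  proof (cases "0 \<le> \<delta> i")
    case True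
    have "(\<Sum>j<n. A i j * (c * \<bar>\<delta> i\<bar> - \<bar>\<delta> j\<bar>)) \<le> b i" unfolding bi
    proof (intro sum_mono mult_left_mono adj_bounds)
      fix j
      have "c * (\<delta> i - \<delta> j - - \<delta> j) \<le> phi R \<theta> i j (\<delta> i - \<delta> j) - phi R \<theta> i j (- \<delta> j)"
        using True by (intro S.phi_lower) auto
      then show "c * \<bar>\<delta> i\<bar> - \<bar>\<delta> j\<bar> \<le> phi R \<theta> i j (\<delta> i - \<delta> j)"
        using True phi_abs_le[of i j "- \<delta> j"] by simp
    qed
    then show ?thesis unfolding sum_eq by linarith
  next
    case False
    have "b i \<le> (\<Sum>j<n. A i j * - (c * \<bar>\<delta> i\<bar> - \<bar>\<delta> j\<bar>))" unfolding bi
    proof (intro sum_mono mult_left_mono adj_bounds)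
      fix j
      have "c * (- \<delta> j - (\<delta> i - \<delta> j)) \<le> phi R \<theta> i j (- \<delta> j) - phi R \<theta> i j (\<delta> i - \<delta> j)"
        using False by (intro S.phi_lower) auto
      then show "phi R \<theta> i j (\<delta> i - \<delta> j) \<le> - (c * \<bar>\<delta> i\<bar> - \<bar>\<delta> j\<bar>)"
        using False phi_abs_le[of i j "- \<delta> j"] by simp
    qed
    then have "b i \<le> - (\<Sum>j<n. A i j * (c * \<bar>\<delta> i\<bar> - \<bar>\<delta> j\<bar>))" by (simp only: mult_minus_right sum_negf)
    then show ?thesis unfolding sum_eq by linarith
  qed
qed

lemma row_abs_sq:
  fixes x :: "nat \<Rightarrow> real"
  assumes "i < n"
  shows "(\<Sum>j<n. A i j * x j)\<^sup>2 \<le> 4 * P * (\<Sum>j<n. A i j * (x j)\<^sup>2)"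
proof -
  have "(\<Sum>j<n. A i j * (1 * x j))\<^sup>2 \<le> (\<Sum>j<n. A i j * 1\<^sup>2) * (\<Sum>j<n. A i j * (x j)\<^sup>2)"
    by (rule weighted_Cauchy_Schwarz) (simp add: adj_bounds)
  also have "\<dots> \<le> 4 * P * (\<Sum>j<n. A i j * (x j)\<^sup>2)"
    using deg_le[OF assms] by (intro mult_right_mono sum_nonneg) (auto simp: adj_bounds)
  finally show ?thesis by simp
qed

text \<open>At an index attaining the maximum, the entry bound and the row bound give an inequality
  with the square of \<open>M\<close> on both sides. On the right its coefficient is at most 1/2 by
  the smallness of \<tau>, so it is absorbed; this doubles the constant.\<close>

lemma M_sq_le:
  assumes \<tau>: "\<tau> \<le> 1" "K_abs * \<tau> \<le> 1 / 2"
  shows "M\<^sup>2 \<le> K_sup * (\<l> * \<nu>)"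
proof -
  obtain i where i: "i < n" "M = \<bar>\<delta> i\<bar>" using M_attained by blast
  define B where "B = (\<Sum>j<n. A i j * \<bar>\<delta> j\<bar>)"
  have "c * (P / 8) * M \<le> c * (\<Sum>j<n. A i j) * \<bar>\<delta> i\<bar>"
    unfolding i(2) using deg_ge[OF i(1)] c_bounds by (intro mult_right_mono mult_left_mono) auto
  also have "\<dots> \<le> \<bar>b i\<bar> + B" unfolding B_def by (rule entry_bound[OF i(1)])
  finally have "(c * (P / 8) * M)\<^sup>2 \<le> (\<bar>b i\<bar> + B)\<^sup>2"
    using c_bounds P_pos M_nonneg by (intro power_mono) auto
  also have "\<dots> \<le> 2 * (b i)\<^sup>2 + 2 * B\<^sup>2"
    using zero_le_power2[of "\<bar>b i\<bar> - B"] by (simp add: power2_eq_square algebra_simps)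
  also have "(b i)\<^sup>2 \<le> 48 * \<l> * P / L" by (rule b_sq_le[OF i(1)])
  also have "B\<^sup>2 \<le> 4 * P * (K_row * (P * sqrt \<l> * \<nu> + \<l> * M\<^sup>2))"
    using row_abs_sq[OF i(1), of "\<lambda>j. \<bar>\<delta> j\<bar>"] mult_left_mono[OF row_sq[OF i(1) \<tau>(1)], of "4 * P"] P_pos
    by (simp add: B_def)
  finally have "(c * (P / 8) * M)\<^sup>2 \<le> 2 * (48 * \<l> * P / L) + 2 * (4 * P * (K_row * (P * sqrt \<l> * \<nu> + \<l> * M\<^sup>2)))"
    by linarith
  also have "48 * \<l> * P / L = 48 * P\<^sup>2 * (\<l> * \<nu>)"
    using P_pos by (auto simp: \<nu>_def power2_eq_square)
  also have "4 * P * (K_row * (P * sqrt \<l> * \<nu> + \<l> * M\<^sup>2)) = 4 * P\<^sup>2 * (K_row * (sqrt \<l> * \<nu> + \<l> / P * M\<^sup>2))"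
    using P_pos by (auto simp: power2_eq_square field_simps)
  finally have "P\<^sup>2 * (c\<^sup>2 / 64 * M\<^sup>2) \<le> P\<^sup>2 * (96 * (\<l> * \<nu>) + 8 * (K_row * (sqrt \<l> * \<nu> + \<l> / P * M\<^sup>2)))"
    by (simp only: power_mult_distrib power_divide) (simp add: algebra_simps)
  then have "c\<^sup>2 / 64 * M\<^sup>2 \<le> 96 * (\<l> * \<nu>) + 8 * (K_row * (sqrt \<l> * \<nu> + \<l> / P * M\<^sup>2))"
    using P_pos by (simp only: mult_le_cancel_left_pos zero_less_power)
  also have "\<dots> \<le> (96 + 8 * K_row) * (\<l> * \<nu> + \<tau> * M\<^sup>2)"
  proof -
    have "sqrt \<l> * \<nu> + \<l> / P * M\<^sup>2 \<le> \<l> * \<nu> + \<tau> * M\<^sup>2"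
    proof (intro add_mono mult_right_mono ln_over_P_le)
      show "sqrt \<l> \<le> \<l>" using ln_ge sqrt_ln_ge by (metis mult_left_mono mult.right_neutral real_sqrt_ge_zero real_sqrt_mult_self abs_of_nonneg order_trans zero_le_one)
    qed (use \<nu>_pos in auto)
    then have "8 * (K_row * (sqrt \<l> * \<nu> + \<l> / P * M\<^sup>2)) \<le> 8 * (K_row * (\<l> * \<nu> + \<tau> * M\<^sup>2))"
      using K_nonneg by (intro mult_left_mono) auto
    moreover have "96 * (\<l> * \<nu>) \<le> 96 * (\<l> * \<nu> + \<tau> * M\<^sup>2)" using \<tau>_nonneg by simp
    ultimately show ?thesis by (simp add: algebra_simps)
  qed
  finally have "64 / c\<^sup>2 * (c\<^sup>2 / 64 * M\<^sup>2) \<le> 64 / c\<^sup>2 * ((96 + 8 * K_row) * (\<l> * \<nu> + \<tau> * M\<^sup>2))"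
    by (intro mult_left_mono) auto
  moreover have "64 / c\<^sup>2 * (c\<^sup>2 / 64 * M\<^sup>2) = M\<^sup>2" using c_bounds by simp
  ultimately have "M\<^sup>2 \<le> K_abs * (\<l> * \<nu> + \<tau> * M\<^sup>2)" by (simp only: const_abs_def mult.assoc)
  also have "\<dots> = K_abs * (\<l> * \<nu>) + (K_abs * \<tau>) * M\<^sup>2" by (simp add: algebra_simps)
  also have "(K_abs * \<tau>) * M\<^sup>2 \<le> 1 / 2 * M\<^sup>2" using \<tau>(2) by (intro mult_right_mono) auto
  finally show ?thesis by (simp add: const_sup_def)
qed


lemma Q_le:
  assumes i: "i < n" and \<tau>: "\<tau> \<le> 1" "K_abs * \<tau> \<le> 1 / 2"
  shows "Q i \<le> K_loo' * (\<l> * \<nu>)"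
proof -
  have "M\<^sup>2 / P \<le> M\<^sup>2 / 1" using P_ge by (intro divide_left_mono) auto
  then have "\<l> * \<nu> + M\<^sup>2 / P \<le> \<l> * \<nu> + K_sup * (\<l> * \<nu>)" using M_sq_le[OF \<tau>] by simp
  then have "K_loo * (\<l> * \<nu> + M\<^sup>2 / P) \<le> K_loo * (\<l> * \<nu> + K_sup * (\<l> * \<nu>))"
    using K_nonneg by (intro mult_left_mono) auto
  then show ?thesis using loo_close[OF i] by (simp add: Q_def const_loo'_def algebra_simps)
qed

lemma row_sq':
  assumes i: "i < n" and \<tau>: "\<tau> \<le> 1" "K_abs * \<tau> \<le> 1 / 2"
  shows "(\<Sum>j<n. A i j * (\<delta> j)\<^sup>2) \<le> K_row' * (P * sqrt \<l> * \<nu>)"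
proof -
  have "\<l> * M\<^sup>2 \<le> \<l> * (K_sup * (\<l> * \<nu>))" using M_sq_le[OF \<tau>] ln_ge by (intro mult_left_mono) auto
  also have "\<dots> = K_sup * (\<l>\<^sup>2 * \<nu>)" by (simp add: power2_eq_square ac_simps)
  also have "\<dots> \<le> K_sup * (P * sqrt \<l> * \<nu>)"
    using ln_sq_le[OF \<tau>(1)] \<nu>_pos K_nonneg by (intro mult_left_mono mult_right_mono) auto
  finally have "K_row * (P * sqrt \<l> * \<nu> + \<l> * M\<^sup>2) \<le> K_row * (P * sqrt \<l> * \<nu> + K_sup * (P * sqrt \<l> * \<nu>))"
    using K_nonneg by (intro mult_left_mono) auto
  also have "\<dots> = K_row' * (P * sqrt \<l> * \<nu>)" by (simp add: const_row'_def algebra_simps)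
  finally show ?thesis using row_sq[OF i \<tau>(1)] by linarith
qed

section \<open>The linear row term\<close>

definition \<rho> where "\<rho> j l = phi R \<theta> j l (\<delta> j - \<delta> l) - wgt R \<theta> j l * (\<delta> j - \<delta> l)"

lemma \<rho>_abs_le: "j < n \<Longrightarrow> l < n \<Longrightarrow> \<bar>\<rho> j l\<bar> \<le> 2 * (\<delta> j - \<delta> l)\<^sup>2"
  unfolding \<rho>_def by (rule phi_linearise)

lemma \<rho>_antisym: "\<rho> j l = - \<rho> l j"
  using S.phi_odd[of j l "\<delta> l - \<delta> j"] wgt_sym[of R \<theta> j l] by (simp add: \<rho>_def algebra_simps)

lemma W_flow_\<delta>: "j < n \<Longrightarrow> W.flow \<delta> j = b j - (\<Sum>l<n. A j l * \<rho> j l)"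
  using \<delta>_flow[of j] by (simp add: W.flow_def S.flow_def \<rho>_def right_diff_distrib sum_subtractf)

text \<open>Smooth linear functionals of \<open>\<delta>\<close> average out: testing the linearised equation with the
  potential turns them into a linear statistic of the noise, up to a quadratic remainder.\<close>

lemma smooth_functional:
  assumes i: "i < n" and \<tau>: "\<tau> \<le> 1" "K_abs * \<tau> \<le> 1 / 2"
  shows "((\<Sum>j<n. wgt R \<theta> i j * \<delta> j) / n)\<^sup>2 \<le> K_smooth * (\<tau> * \<nu>)"
proof -
  define h where "h = potential n \<theta> R i (fst \<omega>)"
  define ub where "ub = (\<Sum>k<n. wgt R \<theta> i k) / n"
  define E where "E = energy A {..<n} h"
  define hR where "hR = (\<Sum>j<n. h j * (\<Sum>l<n. A j l * \<rho> j l))"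
  define hb where "hb = (\<Sum>j<n. h j * b j)"
  have hf: "\<And>j. j < n \<Longrightarrow> W.flow h j = wgt R \<theta> i j - ub"
    using potential_solution[of i] by (auto simp: W.is_solution_def h_def ub_def)
  have E_le: "E \<le> 1024 / c\<^sup>2 * (n / P)" unfolding E_def h_def by (rule potential_energy)
  have E0: "0 \<le> E" by (auto simp: E_def energy_def intro!: sum_nonneg mult_nonneg_nonneg adj_bounds)
  have ED0: "0 \<le> energy A {..<n} \<delta>" by (auto simp: energy_def intro!: sum_nonneg mult_nonneg_nonneg adj_bounds)
  have W0: "W.flow (\<lambda>_. 0) j = 0" for j by (simp add: W.flow_def)
  have "(\<Sum>j<n. wgt R \<theta> i j * \<delta> j) = (\<Sum>j<n. \<delta> j * (W.flow h j - W.flow (\<lambda>_. 0) j)) + ub * (\<Sum>j<n. \<delta> j)"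
    unfolding W0 sum_distrib_left sum.distrib[symmetric]
    by (intro sum.cong refl) (simp add: hf, simp add: algebra_simps)
  \<comment> \<open>The linear flow is self-adjoint: summed by parts, both sides are the same
    symmetric form in \<open>h\<close> and \<delta>. The constant \<open>ub\<close> drops out
    because \<delta> sums to zero.\<close>
  also have "\<dots> = (\<Sum>j<n. h j * (W.flow \<delta> j - W.flow (\<lambda>_. 0) j))"
    unfolding W.flow_by_parts by (simp add: \<delta>_sum ac_simps)
  also have "\<dots> = hb - hR"
    by (simp add: W0 W_flow_\<delta> hb_def hR_def right_diff_distrib sum_subtractf)
  finally have eq: "(\<Sum>j<n. wgt R \<theta> i j * \<delta> j) = hb - hR" .
  have "\<bar>hb\<bar> \<le> sqrt (12 * \<l> * E / (2 * L))" unfolding hb_def h_def E_def by (rule lin_potential[OF i])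
  then have "\<bar>hb\<bar>\<^sup>2 \<le> (sqrt (12 * \<l> * E / (2 * L)))\<^sup>2" by (rule power_mono) simp
  also have "\<dots> = 6 * \<l> / L * E" using E0 ln_ge by simp
  also have "\<dots> \<le> 6 * \<l> / L * (1024 / c\<^sup>2 * (n / P))" using E_le ln_ge by (intro mult_left_mono) auto
  also have "\<dots> = 6 * (1024 / c\<^sup>2) * (n * (\<l> * \<nu>))" by (simp add: \<nu>_def)
  finally have hb: "hb\<^sup>2 \<le> 6 * (1024 / c\<^sup>2) * (n * (\<l> * \<nu>))" by simp
  have "hR = (\<Sum>j<n. \<Sum>l<n. A j l * \<rho> j l * (h j - h l)) / 2"
    unfolding hR_def
  proof (rule sum_by_parts)
    show "A j l * \<rho> j l = - (A l j * \<rho> l j)" for j l using \<rho>_antisym[of j l] adj_sym[of \<omega> j l] by simp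
  qed
  then have "hR\<^sup>2 = (\<Sum>j<n. \<Sum>l<n. A j l * (\<rho> j l * (h j - h l)))\<^sup>2 / 4" by (simp only: power_divide mult.assoc) simp
  also have "\<dots> \<le> ((\<Sum>j<n. \<Sum>l<n. A j l * (\<rho> j l)\<^sup>2) * (\<Sum>j<n. \<Sum>l<n. A j l * (h j - h l)\<^sup>2)) / 4"
    by (intro divide_right_mono weighted_Cauchy_Schwarz2 adj_bounds) simp
  also have "\<dots> = (\<Sum>j<n. \<Sum>l<n. A j l * (\<rho> j l)\<^sup>2) * E / 4" by (simp add: E_def energy_def)
  \<comment> \<open>The remainder is quadratic, so its square has four factors of differences: two
    are bounded by the sup norm, two are kept to form the energy.\<close>
  also have "(\<Sum>j<n. \<Sum>l<n. A j l * (\<rho> j l)\<^sup>2) \<le> (\<Sum>j<n. \<Sum>l<n. A j l * (16 * M\<^sup>2 * (\<delta> j - \<delta> l)\<^sup>2))"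
  proof (intro sum_mono mult_left_mono adj_bounds)
    fix j l assume "j \<in> {..<n}" "l \<in> {..<n}"
    then have jl: "j < n" "l < n" by auto
    have "\<bar>\<rho> j l\<bar>\<^sup>2 \<le> (2 * (\<delta> j - \<delta> l)\<^sup>2)\<^sup>2" by (intro power_mono \<rho>_abs_le jl) simp
    also have "\<dots> = 4 * ((\<delta> j - \<delta> l)\<^sup>2 * (\<delta> j - \<delta> l)\<^sup>2)" by (simp add: power2_eq_square)
    also have "(\<delta> j - \<delta> l)\<^sup>2 * (\<delta> j - \<delta> l)\<^sup>2 \<le> (2 * M)\<^sup>2 * (\<delta> j - \<delta> l)\<^sup>2"
      using power_mono[OF \<delta>_diff_le[OF jl], of 2] by (intro mult_right_mono) auto
    finally show "(\<rho> j l)\<^sup>2 \<le> 16 * M\<^sup>2 * (\<delta> j - \<delta> l)\<^sup>2" by (simp add: power_mult_distrib)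
  qed
  also have "\<dots> = 16 * M\<^sup>2 * energy A {..<n} \<delta>" by (simp add: energy_def sum_distrib_left ac_simps)
  finally have "hR\<^sup>2 \<le> 16 * M\<^sup>2 * energy A {..<n} \<delta> * E / 4"
    using E0 by (simp add: mult_right_mono)
  also have "\<dots> = 4 * (M\<^sup>2 * (energy A {..<n} \<delta> * E))" by simp
  also have "\<dots> \<le> 4 * (K_sup * (\<l> * \<nu>) * (20480 / c\<^sup>2 * (n * sqrt \<l> / L) * (1024 / c\<^sup>2 * (n / P))))"
    using M_sq_le[OF \<tau>] \<delta>_energy E_le E0 ED0 ln_ge
    by (intro mult_left_mono mult_mono) (auto intro!: mult_nonneg_nonneg simp: K_nonneg less_imp_le[OF \<nu>_pos])
  also have "\<dots> = 4 * K_sup * (1024 / c\<^sup>2) * (20480 / c\<^sup>2) * (n\<^sup>2 * (\<l> * sqrt \<l> * \<nu> * \<nu>))"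
    by (simp add: \<nu>_def power2_eq_square ac_simps)
  also have "\<dots> \<le> 4 * K_sup * (1024 / c\<^sup>2) * (20480 / c\<^sup>2) * (n\<^sup>2 * (\<tau> * \<nu>))"
  proof (intro mult_left_mono mult_right_mono)
    \<comment> \<open>Since \<open>P * \<nu>\<close> is 1/L, at most 1, one of the two factors \<nu>
      can be traded for 1/P, which yields \<tau>.\<close>
    have "\<l> * sqrt \<l> * \<nu> = \<tau> * (P * \<nu>)" using P_pos by (auto simp: \<tau>_def)
    also have "\<dots> \<le> \<tau> * 1" using P_\<nu>_le \<tau>_nonneg by (intro mult_left_mono) auto
    finally show "\<l> * sqrt \<l> * \<nu> \<le> \<tau>" by simp
  qed (use K_nonneg \<nu>_pos in auto)
  finally have hR: "hR\<^sup>2 \<le> 4 * K_sup * (1024 / c\<^sup>2) * (20480 / c\<^sup>2) * (n\<^sup>2 * (\<tau> * \<nu>))" .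
  have "n * (\<l> * \<nu>) \<le> n\<^sup>2 * (\<tau> * \<nu>)"
  proof -
    have "\<l> \<le> \<tau> * P" using ln_over_P_le P_pos by (simp add: pos_divide_le_eq)
    also have "\<dots> \<le> \<tau> * n" using P_le_n \<tau>_nonneg by (intro mult_left_mono) auto
    finally have "n * (\<l> * \<nu>) \<le> n * (\<tau> * n * \<nu>)" using \<nu>_pos by (intro mult_left_mono mult_right_mono) auto
    then show ?thesis by (simp add: power2_eq_square ac_simps)
  qed
  then have hb': "hb\<^sup>2 \<le> 6 * (1024 / c\<^sup>2) * (n\<^sup>2 * (\<tau> * \<nu>))"
    using hb mult_left_mono[of "n * (\<l> * \<nu>)" "n\<^sup>2 * (\<tau> * \<nu>)" "6 * (1024 / c\<^sup>2)"] by simp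
  have "(hb - hR)\<^sup>2 \<le> 2 * hb\<^sup>2 + 2 * hR\<^sup>2" using power2_add_le[of hb "- hR"] by simp
  also have "\<dots> \<le> K_smooth * (n\<^sup>2 * (\<tau> * \<nu>))" using hb' hR unfolding const_smooth_def distrib_right by linarith
  finally have "(hb - hR)\<^sup>2 / (real n)\<^sup>2 \<le> K_smooth * (n\<^sup>2 * (\<tau> * \<nu>)) / (real n)\<^sup>2" by (intro divide_right_mono) auto
  then show ?thesis unfolding eq using n2 by (simp add: power_divide)
qed

text \<open>Three sources of error: \<open>T1\<close> replaces \<delta> by the leave-one-out
  solution, \<open>T2\<close> is the fluctuation of row \<open>i\<close> about its mean, and
  \<open>T3\<close> is the mean, a smooth functional corrected by the entry at \<open>i\<close> and
  by the leave-one-out difference.\<close>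

lemma row_linear:
  assumes i: "i < n" and \<tau>: "\<tau> \<le> 1" "K_abs * \<tau> \<le> 1 / 2"
  shows "(\<Sum>j<n. A i j * (wgt R \<theta> i j * \<delta> j))\<^sup>2 \<le> P\<^sup>2 * (K_lin * (\<tau> * \<nu>))"
proof -
  define V where "V = {..<n} - {i}"
  define d where "d = \<D> i"
  define w where "w j = wgt R \<theta> i j" for j
  define q where "q j = \<delta> j - d j" for j
  define F where "F = (\<Sum>j\<in>V. (d j)\<^sup>2)"
  have w01: "0 \<le> w j" "w j \<le> 1" for j using wgt_bounds[of R \<theta> i j] c_bounds by (auto simp: w_def)
  have wsq: "(w j * x)\<^sup>2 \<le> x\<^sup>2" for j and x :: real
    using power_mono[OF w01(2) w01(1), of j 2] by (simp add: power_mult_distrib mult_left_le_one_le)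
  have ins: "sum g {..<n} = g i + sum g V" for g :: "nat \<Rightarrow> real"
    unfolding V_def using i by (intro sum.remove) auto
  have Qi: "(\<Sum>j\<in>V. (q j)\<^sup>2) = Q i" by (simp add: Q_def q_def V_def d_def)
  have Qle: "Q i \<le> K_loo' * (\<l> * \<nu>)" by (rule Q_le[OF i \<tau>])
  have l\<sigma>: "\<l> * \<nu> \<le> P * (\<tau> * \<nu>)"
    using ln_over_P_le P_pos \<nu>_pos by (simp add: pos_divide_le_eq mult_right_mono mult.left_commute mult.commute)
  define T1 where "T1 = (\<Sum>j\<in>V. A i j * (w j * q j))"
  define T2 where "T2 = (\<Sum>j\<in>V. (A i j - p) * (w j * d j))"
  define T3 where "T3 = p * (\<Sum>j\<in>V. w j * d j)"
  have eq: "(\<Sum>j<n. A i j * (wgt R \<theta> i j * \<delta> j)) = T1 + T2 + T3"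
    by (simp add: ins T1_def T2_def T3_def q_def w_def sum_distrib_left sum.distrib[symmetric])
      (intro sum.cong refl, simp add: algebra_simps)
  have T1: "T1\<^sup>2 \<le> P\<^sup>2 * (4 * K_loo' * (\<tau> * \<nu>))"
  proof -
    have "T1\<^sup>2 = (\<Sum>j\<in>V. A i j * (1 * (w j * q j)))\<^sup>2" by (simp add: T1_def)
    also have "\<dots> \<le> (\<Sum>j\<in>V. A i j * 1\<^sup>2) * (\<Sum>j\<in>V. A i j * (w j * q j)\<^sup>2)"
      by (rule weighted_Cauchy_Schwarz) (simp add: adj_bounds)
    also have "\<dots> \<le> (4 * P) * (K_loo' * (P * (\<tau> * \<nu>)))"
    proof (rule mult_mono)
      show "(\<Sum>j\<in>V. A i j * 1\<^sup>2) \<le> 4 * P" using deg_le[OF i] ins[of "A i"] by simp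
      have "(\<Sum>j\<in>V. A i j * (w j * q j)\<^sup>2) \<le> (\<Sum>j\<in>V. 1 * (q j)\<^sup>2)"
        by (intro sum_mono mult_mono adj_bounds wsq) auto
      also have "\<dots> \<le> K_loo' * (\<l> * \<nu>)" using Qi Qle by simp
      also have "\<dots> \<le> K_loo' * (P * (\<tau> * \<nu>))" using l\<sigma> K_nonneg by (intro mult_left_mono) auto
      finally show "(\<Sum>j\<in>V. A i j * (w j * q j)\<^sup>2) \<le> K_loo' * (P * (\<tau> * \<nu>))" .
    qed (use P_pos in \<open>auto intro!: sum_nonneg mult_nonneg_nonneg adj_bounds\<close>)
    finally show ?thesis by (simp add: power2_eq_square ac_simps)
  qed
  define m where "m = 2 * M\<^sup>2 + 2 * Q i"
  have m0: "0 \<le> m" using Q_nonneg by (simp add: m_def)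
  have m_le: "m \<le> 2 * (K_sup + K_loo') * (\<l> * \<nu>)" using M_sq_le[OF \<tau>] Qle by (simp add: m_def algebra_simps)
  have T2: "T2\<^sup>2 \<le> P\<^sup>2 * ((192 * (K_l2 + K_loo') + 2304 * (K_sup + K_loo')) * (\<tau> * \<nu>))"
  proof -
    have wd: "\<bar>w j * d j\<bar> \<le> sqrt m" if "j \<in> V" for j
    proof (rule real_le_rsqrt)
      have "\<bar>w j * d j\<bar>\<^sup>2 \<le> (d j)\<^sup>2" using wsq by simp
      also have "\<dots> \<le> m" using loo_sq_le[OF i] that by (simp add: m_def d_def V_def)
      finally show "\<bar>w j * d j\<bar>\<^sup>2 \<le> m" .
    qed
    have "\<bar>T2\<bar> \<le> 2 * sqrt (12 * \<l> * p * (\<Sum>j\<in>V. (w j * d j)\<^sup>2)) + 2 * (12 * \<l>) * sqrt m"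
      unfolding T2_def V_def d_def w_def
      by (rule bernstein_lin[OF i]) (use m0 wd in \<open>auto simp: V_def d_def w_def\<close>)
    also have "(\<Sum>j\<in>V. (w j * d j)\<^sup>2) \<le> F" unfolding F_def by (intro sum_mono wsq)
    finally have "\<bar>T2\<bar> \<le> 2 * sqrt (12 * \<l> * p * F) + 24 * \<l> * sqrt m"
      using ln_ge p_pos by (simp add: mult_left_mono)
    then have "\<bar>T2\<bar>\<^sup>2 \<le> (2 * sqrt (12 * \<l> * p * F) + 24 * \<l> * sqrt m)\<^sup>2" by (rule power_mono) simp
    also have "\<dots> \<le> 2 * (2 * sqrt (12 * \<l> * p * F))\<^sup>2 + 2 * (24 * \<l> * sqrt m)\<^sup>2" by (rule power2_add_le)
    also have "\<dots> = 96 * (\<l> * p * F) + 1152 * (\<l>\<^sup>2 * m)"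
    proof -
      have "(sqrt (12 * \<l> * p * F))\<^sup>2 = 12 * \<l> * p * F"
        using ln_ge p_pos by (intro real_sqrt_pow2) (auto simp: F_def intro!: mult_nonneg_nonneg sum_nonneg)
      then show ?thesis using m0 by (simp add: power_mult_distrib)
    qed
    finally have 1: "T2\<^sup>2 \<le> 96 * (\<l> * p * F) + 1152 * (\<l>\<^sup>2 * m)" by simp
    have "F \<le> 2 * (\<Sum>j<n. (\<delta> j)\<^sup>2) + 2 * Q i" unfolding F_def V_def d_def by (rule loo_l2[OF i])
    also have "\<dots> \<le> 2 * (K_l2 * (n * sqrt \<l> * \<nu>)) + 2 * (K_loo' * (n * sqrt \<l> * \<nu>))"
    proof -
      have "real n * 1 \<le> n * sqrt \<l>" using sqrt_ln_ge by (intro mult_left_mono) auto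
      then have "\<l> \<le> n * sqrt \<l>" using ln_le_P[OF \<tau>(1)] P_le_n by linarith
      then have "K_loo' * (\<l> * \<nu>) \<le> K_loo' * (n * sqrt \<l> * \<nu>)"
        using K_nonneg \<nu>_pos by (intro mult_left_mono mult_right_mono) auto
      then show ?thesis using \<delta>_l2 Qle unfolding const_l2_def by linarith
    qed
    also have "\<dots> = 2 * (K_l2 + K_loo') * (n * sqrt \<l> * \<nu>)" by (simp add: algebra_simps)
    finally have "\<l> * p * F \<le> \<l> * p * (2 * (K_l2 + K_loo') * (n * sqrt \<l> * \<nu>))"
      using ln_ge p_pos by (intro mult_left_mono) auto
    \<comment> \<open>Here the exponent 3/2 arises: \<open>\<l>\<close> from the confidence level
      times \<open>sqrt \<l>\<close> from the l2 bound, divided by \<open>P\<close>, is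
      \<tau>.\<close>
    also have "\<dots> = P\<^sup>2 * (2 * (K_l2 + K_loo') * (\<tau> * \<nu>))"
      using P_pos by (auto simp: \<tau>_def power2_eq_square)
    finally have 2: "\<l> * p * F \<le> P\<^sup>2 * (2 * (K_l2 + K_loo') * (\<tau> * \<nu>))" .
    have "\<l>\<^sup>2 * m \<le> \<l>\<^sup>2 * (2 * (K_sup + K_loo') * (\<l> * \<nu>))" using m_le by (intro mult_left_mono) auto
    also have "\<dots> = 2 * (K_sup + K_loo') * \<nu> * (\<l> * sqrt \<l>)\<^sup>2" using ln_ge by (simp add: power_mult_distrib power2_eq_square ac_simps)
    also have "\<l> * sqrt \<l> = \<tau> * P" using P_pos by (auto simp: \<tau>_def)
    also have "2 * (K_sup + K_loo') * \<nu> * (\<tau> * P)\<^sup>2 = P\<^sup>2 * (2 * (K_sup + K_loo') * (\<tau> * \<nu>)) * \<tau>"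
      by (simp add: power2_eq_square ac_simps)
    also have "\<dots> \<le> P\<^sup>2 * (2 * (K_sup + K_loo') * (\<tau> * \<nu>))"
      using \<tau> \<tau>_nonneg \<nu>_pos K_nonneg by (intro mult_right_le_one_le mult_nonneg_nonneg) auto
    finally have 3: "\<l>\<^sup>2 * m \<le> P\<^sup>2 * (2 * (K_sup + K_loo') * (\<tau> * \<nu>))" .
    show ?thesis using 1 2 3 by (simp add: algebra_simps)
  qed
  have T3: "T3\<^sup>2 \<le> P\<^sup>2 * (3 * (K_smooth + K_sup + K_loo') * (\<tau> * \<nu>))"
  proof -
    define u where "u = (\<Sum>j<n. w j * \<delta> j)"
    define v where "v = (\<Sum>j\<in>V. w j * q j)"
    \<comment> \<open>Back from leave-one-out entries to \<delta> and to the full index range,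
      because the potential argument controls only the sum over all vertices of the entries of
      \<delta>.\<close>
    have "(\<Sum>j\<in>V. w j * d j) = u + (- (w i * \<delta> i)) + (- v)"
      by (simp add: u_def v_def ins q_def right_diff_distrib sum_subtractf)
    then have "(\<Sum>j\<in>V. w j * d j)\<^sup>2 \<le> 3 * u\<^sup>2 + 3 * (w i * \<delta> i)\<^sup>2 + 3 * v\<^sup>2"
      using power2_add3_le[of u "- (w i * \<delta> i)" "- v"] by simp
    moreover have "u\<^sup>2 \<le> n\<^sup>2 * (K_smooth * (\<tau> * \<nu>))"
      using smooth_functional[OF i \<tau>] n2 by (simp add: u_def w_def power_divide pos_divide_le_eq mult.commute)
    moreover have nl: "n * (\<l> * \<nu>) \<le> n\<^sup>2 * (\<tau> * \<nu>)"
    proof -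
      have "n * (\<l> * \<nu>) \<le> n * (P * (\<tau> * \<nu>))" using l\<sigma> by (intro mult_left_mono) auto
      also have "\<dots> \<le> n * (n * (\<tau> * \<nu>))"
        using P_le_n \<tau>_nonneg \<nu>_pos by (intro mult_left_mono mult_right_mono) auto
      finally show ?thesis by (simp add: power2_eq_square ac_simps)
    qed
    moreover have "(w i * \<delta> i)\<^sup>2 \<le> K_sup * (n\<^sup>2 * (\<tau> * \<nu>))"
    proof -
      have "(w i * \<delta> i)\<^sup>2 \<le> M\<^sup>2" using wsq[of i "\<delta> i"] \<delta>_sq_le[OF i] by linarith
      also have "\<dots> \<le> K_sup * (1 * (\<l> * \<nu>))" using M_sq_le[OF \<tau>] by simp
      also have "\<dots> \<le> K_sup * (n * (\<l> * \<nu>))"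
        using K_nonneg n2 ln_ge \<nu>_pos by (intro mult_left_mono mult_right_mono) auto
      also have "\<dots> \<le> K_sup * (n\<^sup>2 * (\<tau> * \<nu>))" using nl K_nonneg by (intro mult_left_mono)
      finally show ?thesis .
    qed
    moreover have "v\<^sup>2 \<le> K_loo' * (n\<^sup>2 * (\<tau> * \<nu>))"
    proof -
      have "v\<^sup>2 \<le> (\<Sum>j\<in>V. (w j)\<^sup>2) * (\<Sum>j\<in>V. (q j)\<^sup>2)" unfolding v_def by (rule Cauchy_Schwarz_ineq_sum)
      also have "\<dots> \<le> n * (K_loo' * (\<l> * \<nu>))"
      proof (rule mult_mono)
        have "(\<Sum>j\<in>V. (w j)\<^sup>2) \<le> (\<Sum>j\<in>V. 1)" using w01 by (intro sum_mono power_le_one) auto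
        also have "\<dots> \<le> n" using i by (simp add: V_def)
        finally show "(\<Sum>j\<in>V. (w j)\<^sup>2) \<le> n" .
      qed (use Qi Qle Q_nonneg[of i] in auto)
      also have "\<dots> \<le> K_loo' * (n\<^sup>2 * (\<tau> * \<nu>))" using mult_left_mono[OF nl, of K_loo'] K_nonneg by (simp add: ac_simps)
      finally show ?thesis .
    qed
    ultimately have "(\<Sum>j\<in>V. w j * d j)\<^sup>2 \<le> n\<^sup>2 * (3 * (K_smooth + K_sup + K_loo') * (\<tau> * \<nu>))" by (simp add: algebra_simps)
    then have "p\<^sup>2 * (\<Sum>j\<in>V. w j * d j)\<^sup>2 \<le> p\<^sup>2 * (n\<^sup>2 * (3 * (K_smooth + K_sup + K_loo') * (\<tau> * \<nu>)))" by (intro mult_left_mono) auto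
    then show ?thesis by (simp add: T3_def power_mult_distrib ac_simps)
  qed
  have "(T1 + T2 + T3)\<^sup>2 \<le> 3 * T1\<^sup>2 + 3 * T2\<^sup>2 + 3 * T3\<^sup>2" by (rule power2_add3_le)
  also have "\<dots> \<le> 3 * (P\<^sup>2 * (4 * K_loo' * (\<tau> * \<nu>))) + 3 * (P\<^sup>2 * ((192 * (K_l2 + K_loo') + 2304 * (K_sup + K_loo')) * (\<tau> * \<nu>)))
      + 3 * (P\<^sup>2 * (3 * (K_smooth + K_sup + K_loo') * (\<tau> * \<nu>)))" using T1 T2 T3 by linarith
  also have "\<dots> = P\<^sup>2 * (K_lin * (\<tau> * \<nu>))" unfolding const_lin_def by (simp add: algebra_simps)
  finally show ?thesis unfolding eq .
qed


section \<open>Entrywise expansion of the score solution\<close>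

lemma M_le: "\<tau> \<le> 1 \<Longrightarrow> K_abs * \<tau> \<le> 1 / 2 \<Longrightarrow> M \<le> sqrt (K_sup * \<tau>)"
proof (rule real_le_rsqrt)
  assume \<tau>: "\<tau> \<le> 1" "K_abs * \<tau> \<le> 1 / 2"
  have "\<l> * \<nu> = \<l> / P * (P * \<nu>)" using P_pos by auto
  also have "\<dots> \<le> \<tau> * 1" using ln_over_P_le P_\<nu>_le \<tau>_nonneg \<nu>_pos P_pos by (intro mult_mono) auto
  finally have "K_sup * (\<l> * \<nu>) \<le> K_sup * \<tau>" using K_nonneg by (intro mult_left_mono) auto
  then show "M\<^sup>2 \<le> K_sup * \<tau>" using M_sq_le[OF \<tau>] by linarith
qed

lemma dvec_eq: "i < n \<Longrightarrow> dvec n \<theta> \<omega> i = (\<Sum>j<n. A i j * wgt R \<theta> i j)"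
  unfolding dvec_def by (rule sum.mono_neutral_cong_left) (auto simp: wgt_eq_psi')

lemma dvec_ge:
  assumes i: "i < n" shows "c * P / 8 \<le> dvec n \<theta> \<omega> i"
proof -
  have "c * P / 8 \<le> c * (\<Sum>j<n. A i j)"
    using mult_left_mono[OF deg_ge[OF i], of c] c_bounds by simp
  also have "\<dots> = (\<Sum>j<n. A i j * c)" by (simp add: sum_distrib_left mult.commute)
  also have "\<dots> \<le> dvec n \<theta> \<omega> i" unfolding dvec_eq[OF i] by (intro sum_mono mult_left_mono wgt_bounds adj_bounds)
  finally show ?thesis .
qed

text \<open>The score equation at \<open>i\<close> says that \<open>D * \<delta> i - b i\<close> is
  the linear row term minus the quadratic remainder. Of the remainder, the part with the square of
  \<open>\<delta> i\<close> is at most a multiple of \<open>M * \<bar>\<delta> i\<bar>\<close>,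
  hence a relative error; everything else is additive.\<close>

lemma score_expansion:
  assumes i: "i < n" and \<tau>: "\<tau> \<le> 1" "K_abs * \<tau> \<le> 1 / 2" "128 / c * sqrt (K_sup * \<tau>) \<le> 1 / 2"
  shows "\<bar>\<delta> i - b i / dvec n \<theta> \<omega> i\<bar>
    \<le> 256 / c * sqrt (K_sup * \<tau>) * \<bar>b i / dvec n \<theta> \<omega> i\<bar> + 2 * K_rem * sqrt (\<tau> * \<nu>)"
proof -
  define D where "D = dvec n \<theta> \<omega> i"
  define T where "T = (\<Sum>j<n. A i j * (wgt R \<theta> i j * \<delta> j))"
  define r where "r = (\<Sum>j<n. A i j * \<rho> i j)"
  \<comment> \<open>The constant is 16 P M divided by the lower bound c P / 8 of \<open>D\<close>,
    with \<open>M\<close> replaced by its bound.\<close>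
  define x where "x = 128 / c * sqrt (K_sup * \<tau>)"
  define s where "s = sqrt (\<tau> * \<nu>)"
  define \<beta> where "\<beta> = b i / D"
  have \<tau>\<sigma>: "0 \<le> \<tau> * \<nu>" using \<tau>_nonneg \<nu>_pos by simp
  have D_ge: "c * P / 8 \<le> D" using dvec_ge[OF i] by (simp add: D_def)
  have cP: "0 < c * P / 8" using c_bounds P_pos by simp
  then have D_pos: "0 < D" using D_ge by linarith
  have "b i = (\<Sum>j<n. A i j * wgt R \<theta> i j * \<delta> i - A i j * (wgt R \<theta> i j * \<delta> j) + A i j * \<rho> i j)"
    using \<delta>_flow[OF i] unfolding S.flow_def by (simp add: \<rho>_def algebra_simps)
  also have "\<dots> = D * \<delta> i - T + r"
    by (simp add: sum.distrib sum_subtractf D_def dvec_eq[OF i] T_def r_def sum_distrib_right)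
  finally have "D * \<delta> i - b i = T - r" by simp
  then have "\<delta> i - \<beta> = (T - r) / D" using D_pos by (simp add: \<beta>_def field_simps)
  then have "\<bar>\<delta> i - \<beta>\<bar> = \<bar>T - r\<bar> / D" using D_pos by simp
  also have "\<dots> \<le> \<bar>T - r\<bar> / (c * P / 8)" using D_ge cP by (intro divide_left_mono) auto
  also have "\<dots> \<le> (P * (sqrt K_lin * s) + (16 * P * M * \<bar>\<delta> i\<bar> + 4 * (K_row' * (P * s)))) / (c * P / 8)"
  proof (rule divide_right_mono)
    have "\<bar>T\<bar>\<^sup>2 \<le> P\<^sup>2 * (K_lin * (\<tau> * \<nu>))" using row_linear[OF i \<tau>(1,2)] by (simp add: T_def)
    then have "\<bar>T\<bar> \<le> sqrt (P\<^sup>2 * (K_lin * (\<tau> * \<nu>)))" by (rule real_le_rsqrt)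
    also have "\<dots> = P * (sqrt K_lin * s)" using P_pos by (simp add: real_sqrt_mult s_def)
    finally have T: "\<bar>T\<bar> \<le> P * (sqrt K_lin * s)" .
    have "\<bar>r\<bar> \<le> (\<Sum>j<n. \<bar>A i j * \<rho> i j\<bar>)" unfolding r_def by (rule sum_abs)
    also have "\<dots> \<le> (\<Sum>j<n. A i j * (4 * (\<delta> i)\<^sup>2 + 4 * (\<delta> j)\<^sup>2))"
    proof (rule sum_mono)
      fix j assume "j \<in> {..<n}"
      then have "\<bar>\<rho> i j\<bar> \<le> 2 * (\<delta> i - \<delta> j)\<^sup>2" using \<rho>_abs_le i by simp
      also have "\<dots> \<le> 4 * (\<delta> i)\<^sup>2 + 4 * (\<delta> j)\<^sup>2" using power2_add_le[of "\<delta> i" "- \<delta> j"] by simp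
      finally show "\<bar>A i j * \<rho> i j\<bar> \<le> A i j * (4 * (\<delta> i)\<^sup>2 + 4 * (\<delta> j)\<^sup>2)"
        by (simp add: abs_mult adj_bounds mult_left_mono)
    qed
    also have "\<dots> = 4 * (\<delta> i)\<^sup>2 * (\<Sum>j<n. A i j) + 4 * (\<Sum>j<n. A i j * (\<delta> j)\<^sup>2)"
      unfolding sum_distrib_left sum.distrib[symmetric] by (intro sum.cong refl) (simp add: algebra_simps)
    also have "4 * (\<delta> i)\<^sup>2 * (\<Sum>j<n. A i j) \<le> 4 * (M * \<bar>\<delta> i\<bar>) * (4 * P)"
    proof (intro mult_mono deg_le[OF i])
      show "(\<delta> i)\<^sup>2 \<le> M * \<bar>\<delta> i\<bar>" using mult_right_mono[OF M_ge[OF i], of "\<bar>\<delta> i\<bar>"] by (simp add: power2_eq_square)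
    qed (use M_nonneg in \<open>auto intro!: sum_nonneg adj_bounds\<close>)
    also have "(\<Sum>j<n. A i j * (\<delta> j)\<^sup>2) \<le> K_row' * (P * s)"
    proof -
      have "(sqrt \<l> * \<nu>)\<^sup>2 = \<l> / P * (P * \<nu>) * \<nu>" using ln_ge P_pos by (auto simp: power2_eq_square)
      also have "\<dots> \<le> \<tau> * 1 * \<nu>"
        using ln_over_P_le P_\<nu>_le \<tau>_nonneg \<nu>_pos P_pos by (intro mult_right_mono mult_mono) auto
      finally have "sqrt \<l> * \<nu> \<le> s" unfolding s_def by (intro real_le_rsqrt) simp
      then have "K_row' * (P * (sqrt \<l> * \<nu>)) \<le> K_row' * (P * s)" using K_nonneg P_pos by (intro mult_left_mono) auto
      then show ?thesis using row_sq'[OF i \<tau>(1,2)] by (simp add: mult.assoc)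
    qed
    finally have "\<bar>r\<bar> \<le> 4 * (M * \<bar>\<delta> i\<bar>) * (4 * P) + 4 * (K_row' * (P * s))" by simp
    moreover have "4 * (M * \<bar>\<delta> i\<bar>) * (4 * P) = 16 * P * M * \<bar>\<delta> i\<bar>" by simp
    ultimately show "\<bar>T - r\<bar> \<le> P * (sqrt K_lin * s) + (16 * P * M * \<bar>\<delta> i\<bar> + 4 * (K_row' * (P * s)))"
      using T by linarith
  qed (use cP in simp)
  also have "\<dots> = K_rem * s + 128 / c * M * \<bar>\<delta> i\<bar>"
  proof -
    have "(x * (k * s) + (16 * x * M * d + 4 * (k' * (x * s)))) / (c * x / 8)
        = 8 / c * (k + 4 * k') * s + 128 / c * M * d" if "0 < x" for x k k' d :: real
      using that c_bounds by (simp add: field_simps)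
    then show ?thesis unfolding const_rem_def using P_pos by blast
  qed
  also have "128 / c * M * \<bar>\<delta> i\<bar> \<le> x * \<bar>\<delta> i\<bar>"
    unfolding x_def using M_le[OF \<tau>(1,2)] c_bounds by (intro mult_right_mono mult_left_mono) auto
  also have "x * \<bar>\<delta> i\<bar> \<le> x * \<bar>\<delta> i - \<beta>\<bar> + x * \<bar>\<beta>\<bar>"
    using mult_left_mono[of "\<bar>\<delta> i\<bar>" "\<bar>\<delta> i - \<beta>\<bar> + \<bar>\<beta>\<bar>" x] c_bounds K_nonneg \<tau>_nonneg
    by (simp add: x_def distrib_left)
  \<comment> \<open>The relative error refers to \<open>\<delta> i\<close> itself; as
    \<open>x\<close> is at most 1/2, the excess over \<beta> moves to the left side at the price of
    a factor 2.\<close>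
  also have "x * \<bar>\<delta> i - \<beta>\<bar> \<le> 1 / 2 * \<bar>\<delta> i - \<beta>\<bar>"
    using \<tau>(3) unfolding x_def by (intro mult_right_mono) auto
  finally have "\<bar>\<delta> i - \<beta>\<bar> \<le> 2 * x * \<bar>\<beta>\<bar> + 2 * K_rem * s" by simp
  then show ?thesis by (simp add: x_def \<beta>_def s_def D_def)
qed

end

subsection \<open>The maximum likelihood estimator\<close>

lemma ybar_swap: "j \<noteq> l \<Longrightarrow> ybar L \<omega> l j = 1 - ybar L \<omega> j l"
  by (auto simp: ybar_def)

lemma loglik_eq:
  "loglik n L \<omega> \<theta> = (\<Sum>(j, l)\<in>pairs n. adj \<omega> j l * (softplus (\<theta> j - \<theta> l) - ybar L \<omega> j l * (\<theta> j - \<theta> l)))"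
  unfolding loglik_def
proof (intro sum.cong refl, clarify)
  fix j l assume "(j, l) \<in> pairs n"
  then have y: "ybar L \<omega> l j = 1 - ybar L \<omega> j l" by (intro ybar_swap) (auto simp: pairs_def)
  have "ln (1 / psi (\<theta> l - \<theta> j)) = softplus (\<theta> j - \<theta> l)"
    using ln_inverse_psi[of "\<theta> l - \<theta> j"] softplus_minus[of "\<theta> j - \<theta> l"] by simp
  then show "adj \<omega> j l * (ybar L \<omega> j l * ln (1 / psi (\<theta> j - \<theta> l)) + ybar L \<omega> l j * ln (1 / psi (\<theta> l - \<theta> j)))
      = adj \<omega> j l * (softplus (\<theta> j - \<theta> l) - ybar L \<omega> j l * (\<theta> j - \<theta> l))"
    by (simp add: ln_inverse_psi y algebra_simps)
qed

text \<open>At a zero of the score the first-order terms sum to zero after summation by parts, which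
  leaves the Bregman divergence of \<open>softplus\<close> on every edge.\<close>

lemma loglik_diff_score_zero:
  assumes score: "\<And>j. j < n \<Longrightarrow> (\<Sum>l<n. adj \<omega> j l * (psi (u j - u l) - ybar L \<omega> j l)) = 0"
  shows "loglik n L \<omega> v - loglik n L \<omega> u = (\<Sum>(j, l)\<in>pairs n. adj \<omega> j l *
    (softplus (v j - v l) - softplus (u j - u l) - psi (u j - u l) * ((v j - v l) - (u j - u l))))"
proof -
  define w where "w j = v j - u j" for j
  define g where "g j l = adj \<omega> j l * (psi (u j - u l) - ybar L \<omega> j l)" for j l
  have anti: "g j l = - g l j" for j l
  proof (cases "j = l")
    case False
    have "psi (u l - u j) = 1 - psi (u j - u l)" using psi_minus[of "u j - u l"] by simp
    then show ?thesis unfolding g_def ybar_swap[OF False] adj_sym[of \<omega> l j]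
      by (simp only:) (simp add: algebra_simps)
  qed (simp add: g_def)
  have "0 = (\<Sum>j<n. w j * (\<Sum>l<n. g j l))" using score by (simp add: g_def)
  also have "\<dots> = (\<Sum>j<n. \<Sum>l<n. g j l * (w j - w l)) / 2" by (rule sum_by_parts) (rule anti)
  also have "\<dots> = (\<Sum>(j, l)\<in>pairs n. g j l * (w j - w l))"
    by (subst sum_pairs) (use anti in \<open>metis minus_diff_eq minus_mult_minus\<close>, simp, simp)
  finally have zero: "(\<Sum>(j, l)\<in>pairs n. g j l * (w j - w l)) = 0" by simp
  have "loglik n L \<omega> v - loglik n L \<omega> u = (\<Sum>(j, l)\<in>pairs n. adj \<omega> j l *
    (softplus (v j - v l) - softplus (u j - u l) - psi (u j - u l) * ((v j - v l) - (u j - u l))) + g j l * (w j - w l))"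
    unfolding loglik_eq sum_subtractf[symmetric]
    by (intro sum.cong refl) (auto simp: g_def w_def algebra_simps)
  then show ?thesis using zero by (simp add: sum.distrib case_prod_unfold)
qed

context btl_score_solution
begin

definition mle :: "nat \<Rightarrow> real" where
  "mle j = (if j < n then \<theta> j + \<delta> j else 0)"

text \<open>With \<open>M \<le> 1 / 2\<close> all differences of \<delta> are at most 1, inside the
  margin where the modified and the true link agree; so the true score vanishes too.\<close>

lemma mle_score:
  assumes M: "M \<le> 1 / 2" and j: "j < n"
  shows "(\<Sum>l<n. A j l * (psi (mle j - mle l) - ybar L \<omega> j l)) = 0"
proof -
  have "(\<Sum>l<n. A j l * (psi (mle j - mle l) - ybar L \<omega> j l))
      = (\<Sum>l<n. A j l * phi R \<theta> j l (\<delta> j - \<delta> l) - noise L \<theta> \<omega> j l)"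
  proof (intro sum.cong refl)
    fix l assume "l \<in> {..<n}"
    then have l: "l < n" by simp
    have "\<bar>\<delta> j - \<delta> l\<bar> \<le> 1" using \<delta>_diff_le[OF j l] M by linarith
    then show "A j l * (psi (mle j - mle l) - ybar L \<omega> j l) = A j l * phi R \<theta> j l (\<delta> j - \<delta> l) - noise L \<theta> \<omega> j l"
      using j l by (simp add: phi_eq_psi noise_def mle_def algebra_simps)
  qed
  also have "\<dots> = 0" using \<delta>_flow[OF j] by (simp add: sum_subtractf S.flow_def bvec_eq_sum_noise[OF j])
  finally show ?thesis .
qed

text \<open>Every other minimiser has zero divergence on all edges, so by strict convexity it
  differs from \<open>mle\<close> by a vector of zero energy; the spectral gap and the common
  normalisation make this vector 0.\<close>

lemma is_mle_iff:
  assumes M: "M \<le> 1 / 2" and cent: "\<theta> \<in> centered n"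
  shows "is_mle n L \<omega> \<theta>h \<longleftrightarrow> \<theta>h = mle"
proof -
  define gain where "gain v j l = softplus (v j - v l) - softplus (mle j - mle l)
    - psi (mle j - mle l) * ((v j - v l) - (mle j - mle l))" for v j l
  have gain: "0 \<le> gain v j l" "gain v j l = 0 \<Longrightarrow> v j - v l = mle j - mle l" for v j l
    using softplus_convex[of "mle j - mle l" "v j - v l"] by (cases "mle j - mle l = v j - v l"; simp add: gain_def)+
  have diff: "loglik n L \<omega> v - loglik n L \<omega> mle = (\<Sum>(j, l)\<in>pairs n. A j l * gain v j l)" for v
    unfolding gain_def by (rule loglik_diff_score_zero) (rule mle_score[OF M])
  have min: "loglik n L \<omega> mle \<le> loglik n L \<omega> v" for v
  proof -
    have "0 \<le> (\<Sum>(j, l)\<in>pairs n. A j l * gain v j l)" by (auto intro!: sum_nonneg mult_nonneg_nonneg gain adj_bounds)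
    then show ?thesis using diff[of v] by linarith
  qed
  have mle_cent: "mle \<in> centered n"
    using cent \<delta>_sum by (simp add: centered_def mle_def sum.distrib)
  show ?thesis
  proof
    assume "\<theta>h = mle"
    then show "is_mle n L \<omega> \<theta>h" using min mle_cent by (simp add: is_mle_def)
  next
    assume mle: "is_mle n L \<omega> \<theta>h"
    define v where "v j = \<theta>h j - mle j" for j
    have "loglik n L \<omega> \<theta>h \<le> loglik n L \<omega> mle" using mle mle_cent by (simp add: is_mle_def)
    then have "(\<Sum>(j, l)\<in>pairs n. A j l * gain \<theta>h j l) = 0" using diff[of \<theta>h] min[of \<theta>h] by simp
    then have zero: "A j l * gain \<theta>h j l = 0" if "(j, l) \<in> pairs n" for j l
      using that finite_pairs
      by (subst (asm) sum_nonneg_eq_0_iff) (auto intro!: mult_nonneg_nonneg gain(1) adj_bounds(1))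
    have "energy A {..<n} v = 2 * (\<Sum>(j, l)\<in>pairs n. A j l * (v j - v l)\<^sup>2)"
      unfolding energy_def by (rule sum_pairs) (simp_all add: adj_sym power2_commute)
    also have "(\<Sum>(j, l)\<in>pairs n. A j l * (v j - v l)\<^sup>2) = 0"
    proof (intro sum.neutral ballI, clarify)
      fix j l assume "(j, l) \<in> pairs n"
      then have "A j l = 0 \<or> gain \<theta>h j l = 0" using zero by simp
      then show "A j l * (v j - v l)\<^sup>2 = 0" using gain(2)[of \<theta>h j l] by (auto simp: v_def algebra_simps)
    qed
    finally have E: "energy A {..<n} v = 0" by simp
    have "(\<Sum>j<n. v j) = 0" using mle mle_cent by (simp add: v_def sum_subtractf is_mle_def centered_def)
    then have "P / 256 * (\<Sum>j<n. (v j)\<^sup>2) \<le> 0" using gap[of v] E by simp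
    then have "(\<Sum>j<n. (v j)\<^sup>2) \<le> 0" using P_pos mult_pos_pos[of "P / 256" "\<Sum>j<n. (v j)\<^sup>2"] by linarith
    then have "(\<Sum>j<n. (v j)\<^sup>2) = 0" by (intro antisym sum_nonneg) auto
    then have "v j = 0" if "j < n" for j using that by (subst (asm) sum_nonneg_eq_0_iff) auto
    moreover have "v j = 0" if "\<not> j < n" for j
      using that mle by (simp add: v_def mle_def is_mle_def centered_def)
    ultimately show "\<theta>h = mle" by (intro ext) (metis eq_iff_diff_eq_0 v_def)
  qed
qed

end

text \<open>The error \<open>X - B\<close> is clipped at \<open>a * \<bar>B\<bar>\<close>: the
  clipped part divided by \<open>B\<close> is the multiplicative error, the rest is additive. For
  \<open>B = 0\<close> everything is additive.\<close>

lemma split_error: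
  fixes X B a t :: real
  assumes "\<bar>X - B\<bar> \<le> a * \<bar>B\<bar> + t" "0 \<le> a" "0 \<le> t"
  shows "\<exists>e1 e2. X = (1 + e1) * B + e2 \<and> \<bar>e1\<bar> \<le> a \<and> \<bar>e2\<bar> \<le> t"
proof (cases "B = 0")
  case True
  then show ?thesis using assms by (intro exI[of _ 0] exI[of _ X]) auto
next
  case False
  define z where "z = max (- (a * \<bar>B\<bar>)) (min (a * \<bar>B\<bar>) (X - B))"
  have "0 \<le> a * \<bar>B\<bar>" using assms by simp
  then have z: "\<bar>z\<bar> \<le> a * \<bar>B\<bar>" "\<bar>X - B - z\<bar> \<le> t" using assms(1,3) unfolding z_def by linarith+
  have "X = (1 + z / B) * B + (X - B - z)" using False by (simp add: algebra_simps)
  moreover have "\<bar>z / B\<bar> \<le> a" using z(1) False by (simp add: abs_divide pos_divide_le_eq)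
  ultimately show ?thesis using z(2) by blast
qed

lemma btl_good_expansion:
  fixes n :: nat and p R :: real and L :: nat and \<theta> :: "nat \<Rightarrow> real"
  defines "\<tau> \<equiv> ln (real n) * sqrt (ln (real n)) / (real n * p)" and "c \<equiv> psi' R"
  assumes good: "btl_good n p L \<theta> R \<omega>" and cent: "\<theta> \<in> centered n"
    and \<tau>: "\<tau> \<le> 1" "const_abs c * \<tau> \<le> 1 / 2" "128 / c * sqrt (const_sup c * \<tau>) \<le> 1 / 2"
  shows "(\<exists>\<theta>h. is_mle n L \<omega> \<theta>h) \<and>
    (\<forall>\<theta>h. is_mle n L \<omega> \<theta>h \<longrightarrow> (\<exists>\<epsilon>1 \<epsilon>2 :: nat \<Rightarrow> real. \<forall>i<n.
       \<theta>h i - \<theta> i = (1 + \<epsilon>1 i) * (bvec n L \<theta> \<omega> i / dvec n \<theta> \<omega> i) + \<epsilon>2 i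
       \<and> \<bar>\<epsilon>1 i\<bar> \<le> 256 / c * sqrt (const_sup c * \<tau>)
       \<and> \<bar>\<epsilon>2 i\<bar> \<le> 2 * const_rem c * sqrt \<tau> / sqrt (real n * p * real L)))"
proof -
  interpret G: btl_good n p L \<theta> R \<omega> by (rule good)
  obtain \<delta> where "G.S.is_solution (bvec n L \<theta> \<omega>) \<delta>" using G.score_solution_exists by blast
  then interpret B: btl_score_solution n p L \<theta> R \<omega> \<delta> by unfold_locales
  have eq: "B.\<tau> = \<tau>" by (simp add: B.\<tau>_def \<tau>_def)
  have c: "0 < c" "c \<le> 1" using G.c_bounds by (simp_all add: c_def)
  \<comment> \<open>As \<open>c \<le> 1\<close>, the factor 128/c exceeds 1, so the smallness
    hypothesis also bounds the sup norm by 1/2.\<close>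
  have "1 * sqrt (const_sup c * \<tau>) \<le> 128 / c * sqrt (const_sup c * \<tau>)"
    using c B.K_nonneg B.\<tau>_nonneg by (intro mult_right_mono) (auto simp: eq c_def field_simps)
  then have M: "B.M \<le> 1 / 2" using B.M_le \<tau> by (simp add: eq c_def)
  have mle: "is_mle n L \<omega> \<theta>h \<longleftrightarrow> \<theta>h = B.mle" for \<theta>h by (rule B.is_mle_iff[OF M cent])
  have "\<exists>e1 e2. \<delta> i = (1 + e1) * (bvec n L \<theta> \<omega> i / dvec n \<theta> \<omega> i) + e2
       \<and> \<bar>e1\<bar> \<le> 256 / c * sqrt (const_sup c * \<tau>)
       \<and> \<bar>e2\<bar> \<le> 2 * const_rem c * sqrt \<tau> / sqrt (real n * p * real L)" if "i < n" for i
  proof (rule split_error)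
    have "sqrt (\<tau> * B.\<nu>) = sqrt \<tau> / sqrt (real n * p * real L)"
      by (simp add: B.\<nu>_def real_sqrt_mult real_sqrt_divide)
    then show "\<bar>\<delta> i - bvec n L \<theta> \<omega> i / dvec n \<theta> \<omega> i\<bar> \<le> 256 / c * sqrt (const_sup c * \<tau>)
        * \<bar>bvec n L \<theta> \<omega> i / dvec n \<theta> \<omega> i\<bar> + 2 * const_rem c * sqrt \<tau> / sqrt (real n * p * real L)"
      using B.score_expansion[OF that] \<tau> by (simp add: eq c_def)
    show "0 \<le> 256 / c * sqrt (const_sup c * \<tau>)"
      using c B.K_nonneg B.\<tau>_nonneg by (auto simp: eq c_def)
    show "0 \<le> 2 * const_rem c * sqrt \<tau> / sqrt (real n * p * real L)"
      using B.K_nonneg B.\<tau>_nonneg G.p_pos by (auto simp: eq c_def)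
  qed
  then obtain e1 e2 where e: "\<And>i. i < n \<Longrightarrow> \<delta> i = (1 + e1 i) * (bvec n L \<theta> \<omega> i / dvec n \<theta> \<omega> i) + e2 i
       \<and> \<bar>e1 i\<bar> \<le> 256 / c * sqrt (const_sup c * \<tau>)
       \<and> \<bar>e2 i\<bar> \<le> 2 * const_rem c * sqrt \<tau> / sqrt (real n * p * real L)" by metis
  have "B.mle i - \<theta> i = \<delta> i" if "i < n" for i using that by (simp add: B.mle_def)
  then show ?thesis using mle e by metis
qed

subsection \<open>Probability of the good event\<close>

lemma prob_union_le:
  assumes "finite I" "\<And>i. i \<in> I \<Longrightarrow> measure_pmf.prob M (B i) \<le> e"
  shows "measure_pmf.prob M (\<Union>i\<in>I. B i) \<le> real (card I) * e"
proof -
  have "measure_pmf.prob M (\<Union>i\<in>I. B i) \<le> (\<Sum>i\<in>I. measure_pmf.prob M (B i))"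
    using assms by (intro measure_pmf.finite_measure_subadditive_finite) auto
  also have "\<dots> \<le> (\<Sum>i\<in>I. e)" by (intro sum_mono assms)
  finally show ?thesis by simp
qed

text \<open>Eight families of bad events, each of probability at most 2 n^-10 by a union bound,
  account for the constant 16.\<close>

lemma prob_btl_good:
  fixes n :: nat and p :: real and L :: nat and \<theta> :: "nat \<Rightarrow> real"
  assumes n2: "2 \<le> n" and p: "0 < p" "p \<le> 1" and L: "1 \<le> L" and R: "0 \<le> R"
    and theta: "\<And>j l. j < n \<Longrightarrow> l < n \<Longrightarrow> \<bar>\<theta> j - \<theta> l\<bar> \<le> R - 1"
    and P: "1024 \<le> n * p" "96 * ln n \<le> n * p" and ln1: "1 \<le> ln n"
  shows "1 - 16 / real n ^ 10 \<le> measure_pmf.prob (btl_pmf n p L \<theta>) {\<omega>. btl_good n p L \<theta> R \<omega>}"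
proof -
  let ?M = "btl_pmf n p L \<theta>"
  let ?pr = "measure_pmf.prob ?M"
  define N where "N = real n"
  define \<alpha> where "\<alpha> = 12 * ln N"
  define x where "x = 1 / N ^ 10"
  have N: "1 \<le> N" using n2 by (simp add: N_def)
  have \<alpha>: "0 < \<alpha>" using ln1 by (simp add: \<alpha>_def N_def)
  have ea: "exp (- \<alpha>) = 1 / N ^ 12"
  proof -
    have "exp \<alpha> = exp (ln N) ^ 12" unfolding \<alpha>_def using exp_of_nat_mult[of 12 "ln N"] by simp
    then show ?thesis using N by (simp add: exp_minus divide_inverse)
  qed
  have N2: "N\<^sup>2 * exp (- \<alpha>) = x"
  proof -
    have "N ^ 12 = N\<^sup>2 * N ^ 10" by (simp flip: power_add)
    moreover have "N\<^sup>2 / (N\<^sup>2 * N ^ 10) = 1 / N ^ 10" using N by (intro nonzero_divide_mult_cancel_left) auto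
    ultimately have "N\<^sup>2 / N ^ 12 = 1 / N ^ 10" by (simp only:)
    then show ?thesis by (simp add: ea x_def)
  qed
  have N1: "N * exp (- \<alpha>) \<le> x"
  proof -
    have "N * exp (- \<alpha>) \<le> N\<^sup>2 * exp (- \<alpha>)" using N by (intro mult_right_mono) (auto simp: power2_eq_square)
    then show ?thesis using N2 by simp
  qed
  have le1: "exp (- \<alpha>) * N \<le> 1"
  proof -
    have "x \<le> 1" using N by (simp add: x_def)
    then show ?thesis using N1 by (simp add: mult.commute)
  qed
  \<comment> \<open>The hypothesis with 96 = 8 * 12 makes the cut tail exp(-np/8) as small as n^-12;
    the other tails have room to spare.\<close>
  have eP: "exp (- (n * p / 8)) \<le> exp (- \<alpha>)" "exp (- 2 * (n * p)) \<le> exp (- \<alpha>)" "exp (- 2 * \<alpha>) \<le> exp (- \<alpha>)"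
    using P \<alpha> unfolding \<alpha>_def N_def exp_le_cancel_iff by linarith+
  define B1 where "B1 = {\<omega>. \<exists>S\<subseteq>{..<n}. S \<noteq> {} \<and> 2 * card S \<le> n \<and>
    (\<Sum>j\<in>S. \<Sum>l\<in>{..<n} - S. adj \<omega> j l) < n * p / 8 * card S}"
  define B2 where "B2 = (\<Union>i\<in>{..<n}. {\<omega>. 4 * (n * p) < (\<Sum>j<n. adj \<omega> i j)})"
  define B3 where "B3 = (\<Union>e\<in>pairs n. {\<omega>. sqrt (\<alpha> / L) < \<bar>ybar L \<omega> (fst e) (snd e) - psi (\<theta> (fst e) - \<theta> (snd e))\<bar>})"
  define LB where "LB \<beta> v = {\<omega>. sqrt (\<beta> * energy (adj \<omega>) {..<n} (v (fst \<omega>)) / (2 * L))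
        < \<bar>\<Sum>j<n. v (fst \<omega>) j * bvec n L \<theta> \<omega> j\<bar>}" for \<beta> :: real and v
  define B4 where "B4 = (\<Union>i\<in>{..<n}. LB \<alpha> (\<lambda>_ j. of_bool (j = i)))"
  define B5 where "B5 = (\<Union>i\<in>{..<n}. LB \<alpha> (potential n \<theta> R i))"
  define B6 where "B6 = (\<Union>S\<in>Pow {..<n}. LB n (\<lambda>_ j. if j \<in> S then 1 else - 1))"
  define RB where "RB f i = {\<omega>. \<exists>m\<ge>0. (\<forall>j\<in>{..<n} - {i}. \<bar>f \<omega> j\<bar> \<le> m) \<and>
        2 * sqrt (\<alpha> * p * (\<Sum>j\<in>{..<n} - {i}. (f \<omega> j)\<^sup>2)) + 2 * \<alpha> * m
        < \<bar>\<Sum>j\<in>{..<n} - {i}. (adj \<omega> i j - p) * f \<omega> j\<bar>}" for f i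
  define B7 where "B7 = (\<Union>i\<in>{..<n}. RB (\<lambda>\<omega> j. (loo n L \<theta> R i \<omega> j)\<^sup>2) i)"
  define B8 where "B8 = (\<Union>i\<in>{..<n}. RB (\<lambda>\<omega> j. wgt R \<theta> i j * loo n L \<theta> R i \<omega> j) i)"
  have p0: "0 \<le> p" using p by simp
  have x0: "0 \<le> x" using N by (simp add: x_def)
  have b1: "?pr B1 \<le> 2 * x"
  proof -
    have le: "n * exp (- (n * p / 8)) \<le> N * exp (- \<alpha>)" using eP(1) by (simp add: N_def mult_left_mono)
    have "?pr B1 \<le> 2 * real n * exp (- (n * p / 8))"
      unfolding B1_def by (rule prob_cuts[OF p0 p(2)]) (use le le1 in \<open>simp add: mult.commute\<close>)
    then show ?thesis using le N1 by simp
  qed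
  have b2: "?pr B2 \<le> 2 * x"
  proof -
    have "?pr B2 \<le> real (card {..<n}) * exp (- \<alpha>)" unfolding B2_def
      by (rule prob_union_le, simp, rule order_trans[OF prob_degree eP(2)]) (use p in auto)
    then show ?thesis using N1 x0 by (simp add: N_def)
  qed
  have b3: "?pr B3 \<le> 2 * x"
  proof -
    have "?pr B3 \<le> real (card (pairs n)) * (2 * exp (- \<alpha>))" unfolding B3_def
    proof (rule prob_union_le[OF finite_pairs])
      fix e assume "e \<in> pairs n"
      then have "?pr {\<omega>. sqrt (\<alpha> / L) < \<bar>ybar L \<omega> (fst e) (snd e) - psi (\<theta> (fst e) - \<theta> (snd e))\<bar>} \<le> 2 * exp (- 2 * \<alpha>)"
        using \<alpha> by (intro prob_ybar_deviation[OF L]) auto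
      then show "?pr {\<omega>. sqrt (\<alpha> / L) < \<bar>ybar L \<omega> (fst e) (snd e) - psi (\<theta> (fst e) - \<theta> (snd e))\<bar>} \<le> 2 * exp (- \<alpha>)"
        using eP(3) by linarith
    qed
    also have "real (card (pairs n)) \<le> N\<^sup>2"
    proof -
      have "card (pairs n) \<le> card ({..<n} \<times> {..<n})" by (intro card_mono) (auto simp: pairs_def)
      then have "card (pairs n) \<le> n * n" by simp
      then show ?thesis by (simp add: N_def power2_eq_square flip: of_nat_mult)
    qed
    finally show ?thesis using N2 by (simp add: mult_right_mono)
  qed
  have LB: "?pr (LB \<beta> v) \<le> 2 * exp (- 2 * \<beta>)" if "0 \<le> \<beta>" for \<beta> v
    unfolding LB_def by (rule prob_linear_noise[OF L that])
  have lin: "?pr (\<Union>i\<in>{..<n}. LB \<alpha> (v i)) \<le> 2 * x" for v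
  proof -
    have "?pr (\<Union>i\<in>{..<n}. LB \<alpha> (v i)) \<le> real (card {..<n}) * (2 * exp (- \<alpha>))"
    proof (rule prob_union_le)
      show "?pr (LB \<alpha> (v i)) \<le> 2 * exp (- \<alpha>)" for i using LB[of \<alpha> "v i"] \<alpha> eP(3) by linarith
    qed simp
    then show ?thesis using N1 by (simp add: N_def)
  qed
  have b4: "?pr B4 \<le> 2 * x" unfolding B4_def by (rule lin)
  have b5: "?pr B5 \<le> 2 * x" unfolding B5_def by (rule lin)
  have b6: "?pr B6 \<le> 2 * x"
  proof -
    have "?pr B6 \<le> real (card (Pow {..<n})) * (2 * exp (- 2 * real n))"
      unfolding B6_def by (rule prob_union_le, simp, rule LB) simp
    also have "\<dots> = 2 * (2 ^ n * exp (- 2 * real n))" by (simp add: card_Pow)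
    \<comment> \<open>The 2^n sign patterns consume at most half of the exponent 2n; what remains
      beats n^-12, because n is at least np and so at least 96 ln n.\<close>
    also have "(2::real) ^ n \<le> exp 1 ^ n" using exp_ge_add_one_self[of 1] by (intro power_mono) auto
    also have "exp (1::real) ^ n = exp n" using exp_of_nat_mult[of n "1::real"] by simp
    also have "exp (real n) * exp (- 2 * real n) = exp (- real n)" by (simp flip: exp_add)
    also have "\<dots> \<le> exp (- \<alpha>)"
    proof -
      have "real n * p \<le> real n" using p by (simp add: mult_left_le)
      then show ?thesis using P ln1 by (simp add: \<alpha>_def N_def)
    qed
    finally have "?pr B6 \<le> 2 * (1 * exp (- \<alpha>))" by simp
    also have "\<dots> \<le> 2 * (N * exp (- \<alpha>))" using N by (intro mult_left_mono mult_right_mono) auto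
    finally show ?thesis using N1 by simp
  qed
  have row: "?pr (\<Union>i\<in>{..<n}. RB (f i) i) \<le> 2 * x"
    if "\<And>i a a' y. (\<And>j l. j \<noteq> i \<Longrightarrow> l \<noteq> i \<Longrightarrow> a (j, l) = a' (j, l)) \<Longrightarrow> f i (a, y) = f i (a', y)" for f
  proof -
    have "?pr (\<Union>i\<in>{..<n}. RB (f i) i) \<le> real (card {..<n}) * (2 * exp (- \<alpha>))"
    proof (rule prob_union_le)
      fix i assume "i \<in> {..<n}"
      then have i: "i < n" by simp
      show "?pr (RB (f i) i) \<le> 2 * exp (- \<alpha>)" unfolding RB_def
        by (rule prob_row_bernstein[where f = "f i", OF p0 p(2) \<alpha> i]) (rule that)
    qed simp
    then show ?thesis using N1 by (simp add: N_def)
  qed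
  have loo: "\<forall>y. loo n L \<theta> R i (a, y) = loo n L \<theta> R i (a', y)"
    if "\<And>j l. j \<noteq> i \<Longrightarrow> l \<noteq> i \<Longrightarrow> a (j, l) = a' (j, l)" for i and a a' :: "nat \<times> nat \<Rightarrow> bool"
    using that by (intro allI loo_indep)
  have b7: "?pr B7 \<le> 2 * x" unfolding B7_def
    by (rule row[of "\<lambda>i \<omega> j. (loo n L \<theta> R i \<omega> j)\<^sup>2"], drule loo) simp
  have b8: "?pr B8 \<le> 2 * x" unfolding B8_def
    by (rule row[of "\<lambda>i \<omega> j. wgt R \<theta> i j * loo n L \<theta> R i \<omega> j"], drule loo) simp
  have good: "btl_good n p L \<theta> R \<omega>"
    if "\<omega> \<notin> B1 \<union> (B2 \<union> (B3 \<union> (B4 \<union> (B5 \<union> (B6 \<union> (B7 \<union> B8))))))" for \<omega>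
  proof
    show "\<bar>\<Sum>j\<in>{..<n} - {i}. (adj \<omega> i j - p) * (loo n L \<theta> R i \<omega> j)\<^sup>2\<bar>
      \<le> 2 * sqrt (12 * ln n * p * (\<Sum>j\<in>{..<n} - {i}. ((loo n L \<theta> R i \<omega> j)\<^sup>2)\<^sup>2)) + 2 * (12 * ln n) * m"
      if "i < n" "0 \<le> m" "\<forall>j\<in>{..<n} - {i}. \<bar>(loo n L \<theta> R i \<omega> j)\<^sup>2\<bar> \<le> m" for i m
    proof (rule ccontr)
      assume "\<not> ?thesis"
      then have "\<omega> \<in> B7" unfolding B7_def RB_def \<alpha>_def N_def using that by (auto simp: not_le)
      then show False using \<open>\<omega> \<notin> _\<close> by simp
    qed
    show "\<bar>\<Sum>j\<in>{..<n} - {i}. (adj \<omega> i j - p) * (wgt R \<theta> i j * loo n L \<theta> R i \<omega> j)\<bar>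
      \<le> 2 * sqrt (12 * ln n * p * (\<Sum>j\<in>{..<n} - {i}. (wgt R \<theta> i j * loo n L \<theta> R i \<omega> j)\<^sup>2)) + 2 * (12 * ln n) * m"
      if "i < n" "0 \<le> m" "\<forall>j\<in>{..<n} - {i}. \<bar>wgt R \<theta> i j * loo n L \<theta> R i \<omega> j\<bar> \<le> m" for i m
    proof (rule ccontr)
      assume "\<not> ?thesis"
      then have "\<omega> \<in> B8" unfolding B8_def RB_def \<alpha>_def N_def using that by (auto simp: not_le)
      then show False using \<open>\<omega> \<notin> _\<close> by simp
    qed
  qed (use that n2 p L R theta P ln1 in
      \<open>auto simp: B1_def B2_def B3_def B4_def B5_def B6_def LB_def \<alpha>_def N_def not_less\<close>)
  have un: "?pr (X \<union> Y) \<le> a + b" if "?pr X \<le> a" "?pr Y \<le> b" for X Y a b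
    using measure_Un_le[of X ?M Y] that by simp
  have "?pr (B1 \<union> (B2 \<union> (B3 \<union> (B4 \<union> (B5 \<union> (B6 \<union> (B7 \<union> B8)))))))
      \<le> 2 * x + (2 * x + (2 * x + (2 * x + (2 * x + (2 * x + (2 * x + 2 * x))))))"
    by (intro un b1 b2 b3 b4 b5 b6 b7 b8)
  moreover have "?pr (- (B1 \<union> (B2 \<union> (B3 \<union> (B4 \<union> (B5 \<union> (B6 \<union> (B7 \<union> B8))))))))
      \<le> ?pr {\<omega>. btl_good n p L \<theta> R \<omega>}"
    using good by (intro measure_pmf.finite_measure_mono) auto
  moreover have "?pr (- (B1 \<union> (B2 \<union> (B3 \<union> (B4 \<union> (B5 \<union> (B6 \<union> (B7 \<union> B8))))))))
      = 1 - ?pr (B1 \<union> (B2 \<union> (B3 \<union> (B4 \<union> (B5 \<union> (B6 \<union> (B7 \<union> B8)))))))"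
    using measure_pmf.prob_compl[of _ ?M] by (simp add: Compl_eq_Diff_UNIV)
  ultimately show ?thesis by (simp add: x_def N_def)
qed

theorem theorem2p2:
  fixes p :: "nat \<Rightarrow> real" and L :: "nat \<Rightarrow> nat" and \<kappa> :: "nat \<Rightarrow> real"
    and \<theta>s :: "nat \<Rightarrow> nat \<Rightarrow> real"
  assumes p_range: "\<And>n. 0 < p n \<and> p n \<le> 1"
    and L_pos: "\<And>n. L n \<ge> 1"
    and \<kappa>_pos: "\<And>n. \<kappa> n > 0"
    and \<theta>_in: "\<And>n. \<theta>s n \<in> Theta n (\<kappa> n)"
    and \<kappa>_bounded: "\<exists>K. \<forall>n. \<kappa> n \<le> K"
    and sparsity: "((\<lambda>n. ln (real n) powr (3/2) / (real n * p n)) \<longlongrightarrow> 0) at_top"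
  shows "\<exists>\<delta>1 \<delta>2 :: nat \<Rightarrow> real. \<exists>C :: real.
           (\<delta>1 \<longlonglongrightarrow> 0) \<and> (\<delta>2 \<longlonglongrightarrow> 0) \<and>
           (\<forall>n\<ge>2. measure_pmf.prob (btl_pmf n (p n) (L n) (\<theta>s n))
              {\<omega>. (\<exists>\<theta>h. is_mle n (L n) \<omega> \<theta>h) \<and>
                   (\<forall>\<theta>h. is_mle n (L n) \<omega> \<theta>h \<longrightarrow>
                      (\<exists>\<epsilon>1 \<epsilon>2 :: nat \<Rightarrow> real.
                         (\<forall>i<n. \<theta>h i - \<theta>s n i
                                  = (1 + \<epsilon>1 i) * (bvec n (L n) (\<theta>s n) \<omega> i / dvec n (\<theta>s n) \<omega> i)
                                    + \<epsilon>2 i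
                                \<and> \<bar>\<epsilon>1 i\<bar> \<le> \<delta>1 n
                                \<and> \<bar>\<epsilon>2 i\<bar> \<le> \<delta>2 n / sqrt (real n * p n * real (L n)))))}
              \<ge> 1 - C / real n ^ 10)"
proof -
  obtain K where K: "\<And>n. \<kappa> n \<le> K" using \<kappa>_bounded by blast
  have K0: "0 < K" using K[of 0] \<kappa>_pos[of 0] by linarith
  \<comment> \<open>The extra 1 is the margin required by \<open>btl_good\<close> between true
    differences and the range of the unmodified link.\<close>
  define R where "R = K + 1"
  define c where "c = psi' R"
  define \<tau> where "\<tau> n = ln (real n) * sqrt (ln (real n)) / (real n * p n)" for n
  have R0: "0 \<le> R" using K0 by (simp add: R_def)
  have "\<forall>\<^sub>F n in sequentially. ln (real n) powr (3/2) / (real n * p n) = \<tau> n"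
  proof (rule eventually_sequentiallyI[of 2])
    fix n :: nat assume "2 \<le> n"
    then have "0 < ln (real n)" by simp
    then have "ln (real n) powr (1 + 1/2) = ln (real n) * sqrt (ln (real n))"
      by (subst powr_add) (simp add: powr_half_sqrt)
    then show "ln (real n) powr (3/2) / (real n * p n) = \<tau> n" by (simp add: \<tau>_def)
  qed
  then have \<tau>0: "\<tau> \<longlonglongrightarrow> 0" using sparsity by (rule Lim_transform_eventually[rotated])
  have lims: "(\<lambda>n. const_abs c * \<tau> n) \<longlonglongrightarrow> 0" "(\<lambda>n. 128 / c * sqrt (const_sup c * \<tau> n)) \<longlonglongrightarrow> 0"
    "(\<lambda>n. 256 / c * sqrt (const_sup c * \<tau> n)) \<longlonglongrightarrow> 0" "(\<lambda>n. 2 * const_rem c * sqrt (\<tau> n)) \<longlonglongrightarrow> 0"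
    using \<tau>0 psi'_pos[of R] by (auto intro!: tendsto_eq_intros simp: c_def)
  have "filterlim (\<lambda>n. ln (real n)) at_top sequentially"
    by (rule filterlim_compose[OF ln_at_top filterlim_real_sequentially])
  \<comment> \<open>Together with \<tau> < 1/96, which yields np at least 96 ln n, the value 11
    ensures np at least 1056, above the required 1024.\<close>
  then have "\<forall>\<^sub>F n in sequentially. 11 \<le> ln (real n)" by (simp add: filterlim_at_top)
  moreover have "\<forall>\<^sub>F n in sequentially. \<tau> n < 1 / 96" by (rule order_tendstoD[OF \<tau>0]) simp
  moreover have "\<forall>\<^sub>F n in sequentially. const_abs c * \<tau> n < 1 / 2" by (rule order_tendstoD[OF lims(1)]) simp
  moreover have "\<forall>\<^sub>F n in sequentially. 128 / c * sqrt (const_sup c * \<tau> n) < 1 / 2"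
    by (rule order_tendstoD[OF lims(2)]) simp
  ultimately have "\<forall>\<^sub>F n in sequentially. 11 \<le> ln (real n) \<and> \<tau> n < 1 / 96 \<and> const_abs c * \<tau> n < 1 / 2
      \<and> 128 / c * sqrt (const_sup c * \<tau> n) < 1 / 2" by eventually_elim simp
  then obtain n0 where n0: "\<And>n. n0 \<le> n \<Longrightarrow> 11 \<le> ln (real n) \<and> \<tau> n < 1 / 96 \<and> const_abs c * \<tau> n < 1 / 2
      \<and> 128 / c * sqrt (const_sup c * \<tau> n) < 1 / 2" unfolding eventually_sequentially by blast
  \<comment> \<open>The second summand makes the lower bound nonpositive for the finitely many n
    below \<open>n0\<close>; beyond \<open>n0\<close> the constant 16 suffices.\<close>
  define C where "C = 16 + real n0 ^ 10"
  let ?G = "\<lambda>n. {\<omega>. (\<exists>\<theta>h. is_mle n (L n) \<omega> \<theta>h) \<and>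
                   (\<forall>\<theta>h. is_mle n (L n) \<omega> \<theta>h \<longrightarrow>
                      (\<exists>\<epsilon>1 \<epsilon>2 :: nat \<Rightarrow> real.
                         (\<forall>i<n. \<theta>h i - \<theta>s n i
                                  = (1 + \<epsilon>1 i) * (bvec n (L n) (\<theta>s n) \<omega> i / dvec n (\<theta>s n) \<omega> i)
                                    + \<epsilon>2 i
                                \<and> \<bar>\<epsilon>1 i\<bar> \<le> 256 / c * sqrt (const_sup c * \<tau> n)
                                \<and> \<bar>\<epsilon>2 i\<bar> \<le> 2 * const_rem c * sqrt (\<tau> n) / sqrt (real n * p n * real (L n)))))}"
  have "1 - C / real n ^ 10 \<le> measure_pmf.prob (btl_pmf n (p n) (L n) (\<theta>s n)) (?G n)" if n2: "2 \<le> n" for n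
  proof (cases "n0 \<le> n")
    case False
    then have "real n ^ 10 \<le> real n0 ^ 10" by (intro power_mono) auto
    then have "real n ^ 10 \<le> C" unfolding C_def by linarith
    then have "1 - C / real n ^ 10 \<le> 0" using n2 by (simp add: field_simps)
    then show ?thesis using measure_nonneg order_trans by blast
  next
    case True
    note small = n0[OF True]
    have p: "0 < p n" "p n \<le> 1" using p_range by auto
    have pos: "0 < real n * p n" using p n2 by simp
    have "1 \<le> sqrt (ln (real n))" using small by simp
    then have "ln (real n) * 1 \<le> ln (real n) * sqrt (ln (real n))" using small by (intro mult_left_mono) auto
    also have "\<dots> \<le> 1 / 96 * (real n * p n)" using small pos by (simp add: \<tau>_def pos_divide_less_eq)
    finally have P: "96 * ln (real n) \<le> real n * p n" by simp
    have th: "\<theta>s n \<in> Theta n (\<kappa> n)" by (rule \<theta>_in)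
    have "1 - C / real n ^ 10 \<le> 1 - 16 / real n ^ 10" by (simp add: C_def divide_right_mono)
    also have "\<dots> \<le> measure_pmf.prob (btl_pmf n (p n) (L n) (\<theta>s n)) {\<omega>. btl_good n (p n) (L n) (\<theta>s n) R \<omega>}"
    proof (rule prob_btl_good[OF n2 p L_pos R0])
      fix j l assume "j < n" "l < n"
      then have "\<theta>s n j - \<theta>s n l \<le> \<kappa> n" "\<theta>s n l - \<theta>s n j \<le> \<kappa> n" using th by (auto simp: Theta_def)
      then show "\<bar>\<theta>s n j - \<theta>s n l\<bar> \<le> R - 1" using K[of n] by (simp add: R_def abs_le_iff)
    qed (use P small in auto)
    also have "\<dots> \<le> measure_pmf.prob (btl_pmf n (p n) (L n) (\<theta>s n)) (?G n)"
    proof (rule measure_pmf.finite_measure_mono)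
      have cent: "\<theta>s n \<in> centered n" using th by (simp add: Theta_def centered_def)
      show "{\<omega>. btl_good n (p n) (L n) (\<theta>s n) R \<omega>} \<subseteq> ?G n"
      proof
        fix \<omega> assume "\<omega> \<in> {\<omega>. btl_good n (p n) (L n) (\<theta>s n) R \<omega>}"
        then have good: "btl_good n (p n) (L n) (\<theta>s n) R \<omega>" by simp
        show "\<omega> \<in> ?G n" unfolding mem_Collect_eq
          by (rule btl_good_expansion[OF good cent, folded \<tau>_def[of n] c_def]) (use small in auto)
      qed
    qed simp
    finally show ?thesis .
  qed
  then show ?thesis using lims(3,4)
    by (intro exI[of _ "\<lambda>n. 256 / c * sqrt (const_sup c * \<tau> n)"] exI[of _ "\<lambda>n. 2 * const_rem c * sqrt (\<tau> n)"] exI[of _ C]) simp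
qed

end
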